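(* The differential operators $$2\sum_{k=1}^d x_{ik}\partial_{y_i}\partial_{y_k}+y_i\partial_{y_i}+1\quad(i=1,\dots,d),$$ $$\partial_{x_{ij}}-2\partial_{y_i}\partial_{y_j}\quad(1\le i<j\le d),\qquad \partial_{x_{ii}}-\partial_{y_i}^2\quad(1\le i\le d)$$ annihilate the function $$g(x,y)=\int_0^\infty\cdots\int_0^\infty\exp\left(\sum_{i,j=1}^d x_{ij}t_it_j+\sum_{i=1}^d y_it_i\right)dt_1\cdots dt_d,$$ and generate a holonomic (left) ideal $I$ in the ring $D_{xy}$.
   Context: Here $x=(x_{ij})$ is a real symmetric $d\times d$ matrix with $-x$ positive definite and $y\in\mathbf{R}^d$; the coordinates on symmetric matrices are $x_{ij}$ with $i\le j$, and $x_{ij}=x_{ji}$. $D_{xy}=\mathbf{C}\langle x_{ij},y_k,\partial_{x_{ij}},\partial_{y_k}: 1\le i\le j\le d,\ 1\le k\le d\rangle$ is the Weyl algebra (differential operators with polynomial coefficients), $\partial_z=\partial/\partial z$. A left ideal $I$ of $D_{xy}$ is holonomic if $D_{xy}/I$ is a holonomic left $D_{xy}$-module. *)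

theory Defs
  imports
    "HOL-Analysis.Analysis"
    "HOL-Library.Poly_Mapping"
    "HOL-Library.Uprod"
    "HOL-Computational_Algebra.Polynomial"
begin

section \<open>The Weyl algebra\<close>

text \<open>
  The Weyl algebra over the complex numbers in a finite set of variables \<open>'v\<close> is the subalgebra
  of the linear endomorphisms of the polynomial ring generated by the multiplications by the
  variables and by the partial derivatives.  A polynomial is a finitely supported map from
  exponent vectors to coefficients.
\<close>

type_synonym 'v mpoly = "('v \<Rightarrow>\<^sub>0 nat) \<Rightarrow>\<^sub>0 complex"

definition mvar :: "'v \<Rightarrow> 'v mpoly" where
  "mvar v = Poly_Mapping.single (Poly_Mapping.single v 1) 1"

definition mconst :: "complex \<Rightarrow> 'v mpoly" where
  "mconst c = Poly_Mapping.single 0 c"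

text \<open>The coefficient of \<open>x\<^sup>m\<close> in \<open>\<partial>p/\<partial>x\<^sub>v\<close> is \<open>m\<^sub>v + 1\<close> times the one of \<open>x\<^sup>m x\<^sub>v\<close> in \<open>p\<close>.\<close>

lift_definition mdiff :: "'v \<Rightarrow> 'v mpoly \<Rightarrow> 'v mpoly" is
  "\<lambda>v p m. of_nat (Poly_Mapping.lookup m v + 1) * p (m + Poly_Mapping.single v 1)"
proof -
  fix v :: 'v and p :: "('v \<Rightarrow>\<^sub>0 nat) \<Rightarrow> complex"
  assume fin: "finite {m. p m \<noteq> 0}"
  have "inj (\<lambda>m. m + Poly_Mapping.single v (1::nat))"
    by (simp add: inj_on_def)
  then have "finite ((\<lambda>m. m + Poly_Mapping.single v 1) -` {m. p m \<noteq> 0})"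
    using fin by (rule finite_vimageI[rotated])
  then show "finite {m. of_nat (Poly_Mapping.lookup m v + 1) * p (m + Poly_Mapping.single v 1) \<noteq> 0}"
    by (rule rev_finite_subset) auto
qed

inductive_set weyl_ops :: "('v mpoly \<Rightarrow> 'v mpoly) set" where
  const: "(\<lambda>p. mconst c * p) \<in> weyl_ops"
| var: "(\<lambda>p. mvar v * p) \<in> weyl_ops"
| deriv: "mdiff v \<in> weyl_ops"
| add: "S \<in> weyl_ops \<Longrightarrow> T \<in> weyl_ops \<Longrightarrow> (\<lambda>p. S p + T p) \<in> weyl_ops"
| comp: "S \<in> weyl_ops \<Longrightarrow> T \<in> weyl_ops \<Longrightarrow> (\<lambda>p. S (T p)) \<in> weyl_ops"

lemma mconst_simps:
  "mconst 0 = 0" "mconst 1 = 1" "mconst (- c) = - mconst c"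
  "mconst (c + d) = mconst c + mconst d" "mconst (c * d) = mconst c * mconst d"
  by (simp_all add: mconst_def single_add single_uminus mult_single)

lemma lookup_mconst_mult: "Poly_Mapping.lookup (mconst c * p) m = c * Poly_Mapping.lookup p m"
  unfolding mconst_def mult_map_scale_conv_mult[symmetric]
  by (simp add: Poly_Mapping.map.rep_eq when_def)

lemma mdiff_add: "mdiff v (p + q) = mdiff v p + mdiff v q"
  by (rule poly_mapping_eqI) (simp add: mdiff.rep_eq lookup_add algebra_simps)

lemma mdiff_mconst: "mdiff v (mconst c * p) = mconst c * mdiff v p"
  by (rule poly_mapping_eqI) (simp add: mdiff.rep_eq lookup_mconst_mult)

lemma weyl_ops_add: "S \<in> weyl_ops \<Longrightarrow> S (p + q) = S p + S q"
  by (induction S arbitrary: p q rule: weyl_ops.induct) (simp_all add: mdiff_add algebra_simps)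

lemma weyl_ops_mconst: "S \<in> weyl_ops \<Longrightarrow> S (mconst c * p) = mconst c * S p"
  by (induction S arbitrary: p rule: weyl_ops.induct) (simp_all add: mdiff_mconst distrib_left mult.left_commute)

lemma weyl_ops_uminus: "S \<in> weyl_ops \<Longrightarrow> (\<lambda>p. - S p) \<in> weyl_ops"
  using weyl_ops.comp[OF weyl_ops.const[of "-1"]] by (simp add: mconst_simps)

lemma weyl_ops_zero: "(\<lambda>p. 0) \<in> weyl_ops"
  by (rule back_subst[of "\<lambda>T. T \<in> weyl_ops", OF weyl_ops.const[of 0]]) (simp add: fun_eq_iff mconst_simps)

lemma weyl_ops_id: "(\<lambda>p. p) \<in> weyl_ops"
  by (rule back_subst[of "\<lambda>T. T \<in> weyl_ops", OF weyl_ops.const[of 1]]) (simp add: fun_eq_iff mconst_simps)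

typedef 'v weyl = "weyl_ops :: ('v mpoly \<Rightarrow> 'v mpoly) set"
  morphisms weyl_op Abs_weyl
  using weyl_ops_id by blast

setup_lifting type_definition_weyl

instantiation weyl :: (type) ring_1
begin

lift_definition zero_weyl :: "'a weyl" is "\<lambda>p. 0" by (rule weyl_ops_zero)
lift_definition one_weyl :: "'a weyl" is "\<lambda>p. p" by (rule weyl_ops_id)
lift_definition plus_weyl :: "'a weyl \<Rightarrow> 'a weyl \<Rightarrow> 'a weyl" is "\<lambda>S T p. S p + T p"
  by (rule weyl_ops.add)
lift_definition uminus_weyl :: "'a weyl \<Rightarrow> 'a weyl" is "\<lambda>S p. - S p"
  by (rule weyl_ops_uminus)
lift_definition minus_weyl :: "'a weyl \<Rightarrow> 'a weyl \<Rightarrow> 'a weyl" is "\<lambda>S T p. S p - T p"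
  using weyl_ops.add weyl_ops_uminus by fastforce
lift_definition times_weyl :: "'a weyl \<Rightarrow> 'a weyl \<Rightarrow> 'a weyl" is "\<lambda>S T p. S (T p)"
  by (rule weyl_ops.comp)

instance
proof
  fix P Q R :: "'a weyl"
  show "P * (Q + R) = P * Q + P * R"
    by transfer (rule ext, rule weyl_ops_add)
  show "(0::'a weyl) \<noteq> 1"
    by transfer (metis zero_neq_one)
qed (transfer; simp add: fun_eq_iff ac_simps)+

end

lift_definition weyl_const :: "complex \<Rightarrow> 'v weyl" is "\<lambda>c p. mconst c * p"
  by (rule weyl_ops.const)

lift_definition weyl_var :: "'v \<Rightarrow> 'v weyl" is "\<lambda>v p. mvar v * p"
  by (rule weyl_ops.var)

lift_definition weyl_deriv :: "'v \<Rightarrow> 'v weyl" is mdiff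
  by (rule weyl_ops.deriv)

definition weyl_scale :: "complex \<Rightarrow> 'v weyl \<Rightarrow> 'v weyl" where
  "weyl_scale c P = weyl_const c * P"

lemma weyl_const_simps:
  "weyl_const 0 = 0" "weyl_const 1 = 1"
  "weyl_const (c + d) = weyl_const c + weyl_const d"
  "weyl_const (c * d) = weyl_const c * weyl_const d"
  by (transfer; simp add: fun_eq_iff mconst_simps distrib_right mult.assoc)+

interpretation weyl: vector_space weyl_scale
  by standard (simp_all add: weyl_scale_def weyl_const_simps algebra_simps)

lemma weyl_const_commute: "P * weyl_const c = weyl_const c * P"
  by transfer (rule ext, rule weyl_ops_mconst)

lemma mult_weyl_scale: "P * weyl_scale c Q = weyl_scale c (P * Q)"
  by (metis mult.assoc weyl_const_commute weyl_scale_def)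

lemma weyl_scale_mult: "weyl_scale c P * Q = weyl_scale c (P * Q)"
  by (simp add: weyl_scale_def mult.assoc)

lemma weyl_induct [case_names const var deriv add mult]:
  assumes "\<And>c. R (weyl_const c)" "\<And>v. R (weyl_var v)" "\<And>v. R (weyl_deriv v)"
    "\<And>P Q. R P \<Longrightarrow> R Q \<Longrightarrow> R (P + Q)" "\<And>P Q. R P \<Longrightarrow> R Q \<Longrightarrow> R (P * Q)"
  shows "R P"
proof -
  have "R (Abs_weyl T)" if "T \<in> weyl_ops" for T
    using that
  proof (induction rule: weyl_ops.induct)
    case (const c)
    then show ?case using assms(1)[of c] by (simp add: weyl_const_def)
  next
    case (var v)
    then show ?case using assms(2)[of v] by (simp add: weyl_var_def)
  next
    case (deriv v)
    then show ?case using assms(3)[of v] by (simp add: weyl_deriv_def)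
  next
    case (add S T)
    then show ?case using assms(4)[of "Abs_weyl S" "Abs_weyl T"]
      by (simp add: plus_weyl_def Abs_weyl_inverse)
  next
    case (comp S T)
    then show ?case using assms(5)[of "Abs_weyl S" "Abs_weyl T"]
      by (simp add: times_weyl_def Abs_weyl_inverse)
  qed
  then show ?thesis
    by (metis weyl_op weyl_op_inverse)
qed

lemma lookup_mvar_mult:
  "Poly_Mapping.lookup (mvar v * p) (m + Poly_Mapping.single v 1) = Poly_Mapping.lookup p m"
  "Poly_Mapping.lookup m v = 0 \<Longrightarrow> Poly_Mapping.lookup (mvar v * p) m = 0"
proof -
  have *: "Poly_Mapping.lookup (mvar v * p) k =
      (\<Sum>q. Poly_Mapping.lookup p q when k = Poly_Mapping.single v 1 + q)" for k
  proof -
    have "(\<Sum>l. Poly_Mapping.lookup (mvar v) l *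
          (\<Sum>q. Poly_Mapping.lookup p q when k = l + q)) =
        (\<Sum>l. (\<Sum>q. Poly_Mapping.lookup p q when k = l + q)
            when l = Poly_Mapping.single v 1)"
      by (rule Sum_any.cong) (auto simp: mvar_def lookup_single when_def)
    then show ?thesis
      unfolding lookup_mult by simp
  qed
  have "(\<Sum>q. Poly_Mapping.lookup p q when m + Poly_Mapping.single v 1 = Poly_Mapping.single v 1 + q)
      = (\<Sum>q. Poly_Mapping.lookup p q when q = m)"
    by (rule Sum_any.cong) (auto simp: when_def add.commute)
  then show "Poly_Mapping.lookup (mvar v * p) (m + Poly_Mapping.single v 1) = Poly_Mapping.lookup p m"
    using * by simp
  assume "Poly_Mapping.lookup m v = 0"
  then have "m \<noteq> Poly_Mapping.single v 1 + q" for q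
    by (auto simp: lookup_add)
  then show "Poly_Mapping.lookup (mvar v * p) m = 0"
    using * by simp
qed

lemma exponent_decompose:
  assumes "Poly_Mapping.lookup (m :: 'v \<Rightarrow>\<^sub>0 nat) v \<noteq> 0"
  obtains m' where "m = m' + Poly_Mapping.single v 1"
proof
  show "m = (m - Poly_Mapping.single v 1) + Poly_Mapping.single v 1"
    using assms
    by (intro poly_mapping_eqI) (auto simp: lookup_add minus_poly_mapping.rep_eq lookup_single when_def)
qed

lemma mdiff_mvar: "mdiff v (mvar w * p) = mvar w * mdiff v p + (if v = w then p else 0)"
proof (rule poly_mapping_eqI)
  fix m
  show "Poly_Mapping.lookup (mdiff v (mvar w * p)) m =
    Poly_Mapping.lookup (mvar w * mdiff v p + (if v = w then p else 0)) m"
  proof (cases "Poly_Mapping.lookup m w = 0")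
    case True
    show ?thesis
    proof (cases "v = w")
      case True
      with \<open>Poly_Mapping.lookup m w = 0\<close> show ?thesis
        using lookup_mvar_mult(1)[of w p m] lookup_mvar_mult(2)[of m w "mdiff w p"]
        by (simp add: mdiff.rep_eq lookup_add)
    next
      case False
      then have "Poly_Mapping.lookup (m + Poly_Mapping.single v 1) w = 0"
        using True by (simp add: lookup_add lookup_single)
      with False True show ?thesis
        using lookup_mvar_mult(2)[of _ w] by (simp add: mdiff.rep_eq)
    qed
  next
    case False
    then obtain m' where m': "m = m' + Poly_Mapping.single w 1"
      by (rule exponent_decompose)
    have "m + Poly_Mapping.single v 1 = (m' + Poly_Mapping.single v 1) + Poly_Mapping.single w 1"
      by (simp add: m' algebra_simps)
    then have 1: "Poly_Mapping.lookup (mvar w * p) (m + Poly_Mapping.single v 1) =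
        Poly_Mapping.lookup p (m' + Poly_Mapping.single v 1)"
      by (metis lookup_mvar_mult(1))
    have 2: "Poly_Mapping.lookup (mvar w * mdiff v p) m = Poly_Mapping.lookup (mdiff v p) m'"
      unfolding m' by (rule lookup_mvar_mult(1))
    show ?thesis
      using 1 2 by (auto simp: mdiff.rep_eq lookup_add lookup_single m' algebra_simps)
  qed
qed

lemma weyl_var_commute: "weyl_var v * weyl_var w = weyl_var w * weyl_var v"
  by transfer (simp add: fun_eq_iff algebra_simps)

lemma weyl_deriv_commute: "weyl_deriv v * weyl_deriv w = weyl_deriv w * weyl_deriv v"
proof transfer
  fix v w :: 'a
  have "mdiff v (mdiff w p) = mdiff w (mdiff v p)" for p
    by (rule poly_mapping_eqI)
       (cases "v = w"; simp add: mdiff.rep_eq lookup_add lookup_single ac_simps)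
  then show "(\<lambda>p. mdiff v (mdiff w p)) = (\<lambda>p. mdiff w (mdiff v p))"
    by simp
qed

lemma weyl_deriv_var:
  "weyl_deriv v * weyl_var w = weyl_var w * weyl_deriv v + (if v = w then 1 else 0)"
  by (cases "v = w"; simp; transfer; simp add: fun_eq_iff mdiff_mvar)

subsection \<open>Normally ordered monomials\<close>

text \<open>
  Products over all variables are taken along a fixed enumeration; its choice is irrelevant here
  because the factors commute, and likewise for iterated partial derivatives of smooth functions.
\<close>

definition var_enum :: "'v::finite list" where
  "var_enum = (SOME vs. distinct vs \<and> set vs = UNIV)"

lemma var_enum: "distinct (var_enum :: 'v::finite list)" "set (var_enum :: 'v::finite list) = UNIV"
proof -
  have "\<exists>vs :: 'v list. distinct vs \<and> set vs = UNIV"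
    using finite_distinct_list[of "UNIV :: 'v set"] by auto
  from someI_ex[OF this] show "distinct (var_enum :: 'v list)" "set (var_enum :: 'v list) = UNIV"
    unfolding var_enum_def by auto
qed

definition weyl_monom :: "('v::finite \<Rightarrow>\<^sub>0 nat) \<Rightarrow> ('v \<Rightarrow>\<^sub>0 nat) \<Rightarrow> 'v weyl" where
  "weyl_monom a b =
     prod_list (map (\<lambda>v. weyl_var v ^ Poly_Mapping.lookup a v) var_enum) *
     prod_list (map (\<lambda>v. weyl_deriv v ^ Poly_Mapping.lookup b v) var_enum)"

lemma commuting_prod_list:
  fixes Z :: "'v \<Rightarrow> 'r::monoid_mult"
  assumes comm: "\<And>v w. Z v * Z w = Z w * Z v" and "distinct vs"
  shows "Z u * prod_list (map (\<lambda>v. Z v ^ Poly_Mapping.lookup a v) vs) =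
    (if u \<in> set vs
     then prod_list (map (\<lambda>v. Z v ^ Poly_Mapping.lookup (a + Poly_Mapping.single u 1) v) vs)
     else prod_list (map (\<lambda>v. Z v ^ Poly_Mapping.lookup a v) vs) * Z u)"
  using assms(2)
proof (induction vs)
  case Nil
  then show ?case by simp
next
  case (Cons w vs)
  have pc: "Z u * Z w ^ k = Z w ^ k * Z u" for k
    using comm power_commuting_commutes by metis
  show ?case
  proof (cases "u = w")
    case True
    then have "prod_list (map (\<lambda>v. Z v ^ Poly_Mapping.lookup (a + Poly_Mapping.single u 1) v) vs)
        = prod_list (map (\<lambda>v. Z v ^ Poly_Mapping.lookup a v) vs)"
      using Cons.prems
      by (intro arg_cong[where f = prod_list] map_cong) (auto simp: lookup_add lookup_single when_def)
    with True show ?thesis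
      by (simp add: lookup_add mult.assoc[symmetric])
  next
    case False
    have "Z u * (Z w ^ Poly_Mapping.lookup a w * r) = Z w ^ Poly_Mapping.lookup a w * (Z u * r)" for r
      by (metis mult.assoc pc)
    with False Cons show ?thesis
      by (simp add: lookup_add lookup_single mult.assoc)
  qed
qed

lemma weyl_var_monom: "weyl_var u * weyl_monom a b = weyl_monom (a + Poly_Mapping.single u 1) b"
  unfolding weyl_monom_def mult.assoc[symmetric]
  by (subst commuting_prod_list) (simp_all add: weyl_var_commute var_enum)

lemma weyl_deriv_monom0: "weyl_deriv u * weyl_monom 0 b = weyl_monom 0 (b + Poly_Mapping.single u 1)"
  unfolding weyl_monom_def
  using commuting_prod_list[of weyl_deriv var_enum u b, OF weyl_deriv_commute var_enum(1)]
  by (simp add: map_replicate_const prod_list_replicate var_enum)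

abbreviation weyl_monoms :: "'v::finite weyl set" where
  "weyl_monoms \<equiv> {weyl_monom a b | a b. True}"

lemma mult_in_span_monoms:
  assumes "\<And>a b. P * weyl_monom a b \<in> weyl.span weyl_monoms" and "Q \<in> weyl.span weyl_monoms"
  shows "P * Q \<in> weyl.span weyl_monoms"
  using assms(2)
proof (induction rule: weyl.span_induct_alt)
  case base
  then show ?case by (simp add: weyl.span_zero)
next
  case (step c x y)
  then show ?case
    using assms(1)
    by (auto simp: distrib_left mult_weyl_scale intro!: weyl.span_add weyl.span_scale)
qed

lemma exponent_induct [case_names zero add]:
  fixes a :: "'v::finite \<Rightarrow>\<^sub>0 nat"
  assumes "R 0" "\<And>a u. R a \<Longrightarrow> R (a + Poly_Mapping.single u 1)"
  shows "R a"
proof (induction "\<Sum>v\<in>UNIV. Poly_Mapping.lookup a v" arbitrary: a rule: less_induct)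
  case less
  show ?case
  proof (cases "a = 0")
    case False
    then obtain u where "Poly_Mapping.lookup a u \<noteq> 0"
      by (metis lookup_zero poly_mapping_eqI)
    then obtain a' where a': "a = a' + Poly_Mapping.single u 1"
      by (rule exponent_decompose)
    have "(\<Sum>v\<in>UNIV. Poly_Mapping.lookup a' v) < (\<Sum>v\<in>UNIV. Poly_Mapping.lookup a v)"
      by (rule sum_strict_mono_ex1) (auto simp: a' lookup_add intro!: exI[of _ u])
    from less[OF this] show ?thesis
      using assms(2) a' by simp
  qed (simp add: assms(1))
qed

lemma weyl_span_monoms: "P \<in> weyl.span weyl_monoms"
proof -
  have monom: "weyl_monom a b \<in> weyl.span weyl_monoms" for a b :: "'a \<Rightarrow>\<^sub>0 nat"
    by (rule weyl.span_base) auto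
  have var: "weyl_var v * Q \<in> weyl.span weyl_monoms"
    if "Q \<in> weyl.span weyl_monoms" for v :: 'a and Q
    using that by (rule mult_in_span_monoms[rotated]) (simp only: weyl_var_monom monom)
  have deriv': "weyl_deriv v * weyl_monom a b \<in> weyl.span weyl_monoms" for v :: 'a and a b
  proof (induction a rule: exponent_induct)
    case zero
    then show ?case by (simp only: weyl_deriv_monom0 monom)
  next
    case (add a u)
    have "weyl_deriv v * weyl_monom (a + Poly_Mapping.single u 1) b =
        weyl_var u * (weyl_deriv v * weyl_monom a b) + (if v = u then 1 else 0) * weyl_monom a b"
      unfolding weyl_var_monom[symmetric]
      by (simp only: mult.assoc[symmetric] weyl_deriv_var distrib_right)
    then show ?case
      using var[OF add] monom weyl.span_zero by (auto intro!: weyl.span_add)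
  qed
  have "P * Q \<in> weyl.span weyl_monoms" if "Q \<in> weyl.span weyl_monoms" for P Q :: "'a weyl"
    using that
  proof (induction P arbitrary: Q rule: weyl_induct)
    case (const c)
    have "weyl_const c * Q = weyl_scale c Q"
      by (simp add: weyl_scale_def)
    then show ?case
      using weyl.span_scale[OF const, of c] by (simp only:)
  next
    case (var v)
    then show ?case by (rule \<open>\<And>v Q. Q \<in> _ \<Longrightarrow> weyl_var v * Q \<in> _\<close>)
  next
    case (deriv v)
    then show ?case by (rule mult_in_span_monoms[OF deriv'])
  next
    case (add P Q)
    then show ?case by (simp add: distrib_right weyl.span_add)
  next
    case (mult P Q)
    then show ?case by (simp add: mult.assoc)
  qed
  from this[OF monom] have "P * weyl_monom 0 0 \<in> weyl.span weyl_monoms"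
    .
  moreover have "weyl_monom 0 0 = (1 :: 'a weyl)"
    by (simp add: weyl_monom_def map_replicate_const prod_list_replicate)
  ultimately show ?thesis
    by (simp only: mult_1_right)
qed

lemma weyl_op_monom_deriv:
  fixes b :: "'v::finite \<Rightarrow>\<^sub>0 nat"
  shows "\<exists>K. K \<noteq> 0 \<and> (\<forall>p. Poly_Mapping.lookup (weyl_op (weyl_monom 0 b) p) m =
     K * Poly_Mapping.lookup p (m + b))"
proof (induction b arbitrary: m rule: exponent_induct)
  case zero
  have "weyl_monom 0 0 = (1 :: 'v weyl)"
    by (simp add: weyl_monom_def map_replicate_const prod_list_replicate)
  then show ?case by (intro exI[of _ 1]) (simp add: one_weyl.rep_eq)
next
  case (add b u)
  obtain K where K: "K \<noteq> 0" "\<And>p. Poly_Mapping.lookup (weyl_op (weyl_monom 0 b) p)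
      (m + Poly_Mapping.single u 1) = K * Poly_Mapping.lookup p (m + Poly_Mapping.single u 1 + b)"
    using add[of "m + Poly_Mapping.single u 1"] by blast
  have "Poly_Mapping.lookup (weyl_op (weyl_monom 0 (b + Poly_Mapping.single u 1)) p) m =
      of_nat (Poly_Mapping.lookup m u + 1) * K *
        Poly_Mapping.lookup p (m + (b + Poly_Mapping.single u 1))" for p
    unfolding weyl_deriv_monom0[symmetric]
    by (simp add: times_weyl.rep_eq weyl_deriv.rep_eq mdiff.rep_eq K ac_simps del: One_nat_def)
  moreover have "of_nat (Poly_Mapping.lookup m u + 1) * K \<noteq> 0"
    using K(1) by (metis add_is_0 mult_eq_0_iff of_nat_eq_0_iff one_neq_zero)
  ultimately show ?case by blast
qed

lemma weyl_op_monom: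
  "weyl_op (weyl_monom a b) p = Poly_Mapping.single a 1 * weyl_op (weyl_monom 0 b) p"
proof (induction a rule: exponent_induct)
  case (add a u)
  then show ?case
    unfolding weyl_var_monom[symmetric]
    by (simp add: times_weyl.rep_eq weyl_var.rep_eq mvar_def mult_single mult.assoc[symmetric] add.commute)
qed simp

definition weyl_of_coeffs ::
    "(('v::finite \<Rightarrow>\<^sub>0 nat) \<times> ('v \<Rightarrow>\<^sub>0 nat) \<Rightarrow>\<^sub>0 complex) \<Rightarrow> 'v weyl" where
  "weyl_of_coeffs c =
     (\<Sum>(a, b)\<in>Poly_Mapping.keys c. weyl_scale (Poly_Mapping.lookup c (a, b)) (weyl_monom a b))"

lemma weyl_of_coeffs_superset:
  assumes "finite A" "Poly_Mapping.keys c \<subseteq> A"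
  shows "weyl_of_coeffs c = (\<Sum>(a, b)\<in>A. weyl_scale (Poly_Mapping.lookup c (a, b)) (weyl_monom a b))"
  unfolding weyl_of_coeffs_def using assms
  by (intro sum.mono_neutral_left) (auto simp: in_keys_iff)

lemma weyl_of_coeffs_add: "weyl_of_coeffs (c + d) = weyl_of_coeffs c + weyl_of_coeffs d"
proof -
  let ?A = "Poly_Mapping.keys c \<union> Poly_Mapping.keys d"
  have "Poly_Mapping.keys (c + d) \<subseteq> ?A"
    by (rule keys_add)
  then show ?thesis
    by (simp add: weyl_of_coeffs_superset[where A = ?A] sum.distrib[symmetric] split_def
        lookup_add weyl.scale_left_distrib)
qed

lemma weyl_of_coeffs_single: "weyl_of_coeffs (Poly_Mapping.single (a, b) k) = weyl_scale k (weyl_monom a b)"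
  by (simp add: weyl_of_coeffs_superset[where A = "{(a, b)}"])

lemma ex_weyl_of_coeffs: "\<exists>c. weyl_of_coeffs c = P"
  using weyl_span_monoms[of P]
proof (induction rule: weyl.span_induct_alt)
  case base
  show ?case by (rule exI[of _ 0]) (simp add: weyl_of_coeffs_def)
next
  case (step k x y)
  then obtain a b c where "x = weyl_monom a b" "weyl_of_coeffs c = y" by blast
  then have "weyl_of_coeffs (Poly_Mapping.single (a, b) k + c) = weyl_scale k x + y"
    by (simp add: weyl_of_coeffs_add weyl_of_coeffs_single)
  then show ?case ..
qed

lemma weyl_op_sum: "weyl_op (sum f A) p = (\<Sum>x\<in>A. weyl_op (f x) p)"
  by (induction A rule: infinite_finite_induct) (simp_all add: zero_weyl.rep_eq plus_weyl.rep_eq)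

lemma weyl_of_coeffs_eq_0:
  assumes "weyl_of_coeffs c = 0"
  shows "c = 0"
proof (rule ccontr)
  assume "c \<noteq> 0"
  let ?deg = "\<lambda>b :: 'a \<Rightarrow>\<^sub>0 nat. \<Sum>v\<in>UNIV. Poly_Mapping.lookup b v"
  from \<open>c \<noteq> 0\<close> have "Poly_Mapping.keys c \<noteq> {}" by simp
  then obtain a\<^sub>0 \<beta> where ab: "(a\<^sub>0, \<beta>) \<in> Poly_Mapping.keys c"
    and min: "\<And>a b. (a, b) \<in> Poly_Mapping.keys c \<Longrightarrow> ?deg \<beta> \<le> ?deg b"
    using ex_min_if_finite[of "(\<lambda>x. ?deg (snd x)) ` Poly_Mapping.keys c"]
    by (auto simp: image_iff) (metis linorder_not_less snd_conv)
  define q :: "'a mpoly" where "q = Poly_Mapping.single \<beta> 1"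
  obtain K where K: "K \<noteq> 0"
    "\<And>p. Poly_Mapping.lookup (weyl_op (weyl_monom 0 \<beta>) p) 0 = K * Poly_Mapping.lookup p \<beta>"
    using weyl_op_monom_deriv[of \<beta> 0] by auto
  have 1: "weyl_op (weyl_monom 0 b) q = (if b = \<beta> then Poly_Mapping.single 0 K else 0)"
    if "(a, b) \<in> Poly_Mapping.keys c" for a b
  proof (rule poly_mapping_eqI)
    fix m
    obtain K' where K': "\<And>p. Poly_Mapping.lookup (weyl_op (weyl_monom 0 b) p) m =
        K' * Poly_Mapping.lookup p (m + b)"
      using weyl_op_monom_deriv[of b m] by auto
    show "Poly_Mapping.lookup (weyl_op (weyl_monom 0 b) q) m =
        Poly_Mapping.lookup (if b = \<beta> then Poly_Mapping.single 0 K else 0) m"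
    proof (cases "\<beta> = m + b")
      case True
      have "?deg \<beta> = ?deg m + ?deg b"
        by (simp add: True lookup_add sum.distrib)
      with min[OF that] have "?deg m = 0" by simp
      then have "m = 0" by (intro poly_mapping_eqI) simp
      with True K(2)[of q] show ?thesis by (simp add: q_def)
    next
      case False
      then show ?thesis using K' by (auto simp: q_def lookup_single when_def)
    qed
  qed
  have "0 = Poly_Mapping.lookup (weyl_op (weyl_of_coeffs c) q) a\<^sub>0"
    by (simp add: assms zero_weyl.rep_eq)
  also have "\<dots> = (\<Sum>(a, b)\<in>Poly_Mapping.keys c. Poly_Mapping.lookup c (a, b) *
      Poly_Mapping.lookup (Poly_Mapping.single a 1 * weyl_op (weyl_monom 0 b) q) a\<^sub>0)"
    by (simp add: weyl_of_coeffs_def weyl_op_sum lookup_sum split_def weyl_scale_def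
        times_weyl.rep_eq weyl_const.rep_eq lookup_mconst_mult weyl_op_monom[symmetric])
  also have "\<dots> = (\<Sum>x\<in>Poly_Mapping.keys c.
      if x = (a\<^sub>0, \<beta>) then Poly_Mapping.lookup c x * K else 0)"
    by (rule sum.cong) (auto simp: 1 mult_single lookup_single when_def split: if_splits)
  also have "\<dots> = Poly_Mapping.lookup c (a\<^sub>0, \<beta>) * K"
    using ab by simp
  finally show False
    using ab K(1) by (simp add: in_keys_iff)
qed

lemma ex1_weyl_of_coeffs: "\<exists>!c. weyl_of_coeffs c = P"
proof (rule ex_ex1I[OF ex_weyl_of_coeffs])
  fix c d assume "weyl_of_coeffs c = P" "weyl_of_coeffs d = P"
  moreover have "weyl_of_coeffs (c - d) + weyl_of_coeffs d = weyl_of_coeffs c"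
    by (simp add: weyl_of_coeffs_add[symmetric])
  ultimately show "c = d"
    using weyl_of_coeffs_eq_0[of "c - d"] by simp
qed

definition weyl_coeffs ::
    "'v::finite weyl \<Rightarrow> ('v \<Rightarrow>\<^sub>0 nat) \<times> ('v \<Rightarrow>\<^sub>0 nat) \<Rightarrow>\<^sub>0 complex" where
  "weyl_coeffs P = (THE c. weyl_of_coeffs c = P)"

lemma weyl_of_coeffs_coeffs [simp]: "weyl_of_coeffs (weyl_coeffs P) = P"
  unfolding weyl_coeffs_def by (rule theI'[OF ex1_weyl_of_coeffs])

lemma weyl_coeffs_of_coeffs [simp]: "weyl_coeffs (weyl_of_coeffs c) = c"
  using ex1_weyl_of_coeffs weyl_of_coeffs_coeffs by metis

section \<open>Holonomic left ideals\<close>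

definition left_ideal :: "'v weyl set \<Rightarrow> bool" where
  "left_ideal I \<longleftrightarrow> 0 \<in> I \<and> (\<forall>P\<in>I. \<forall>Q\<in>I. P + Q \<in> I) \<and> (\<forall>P. \<forall>Q\<in>I. P * Q \<in> I)"

definition bernstein_filtration :: "nat \<Rightarrow> 'v::finite weyl set" where
  "bernstein_filtration k = weyl.span {weyl_monom a b | a b.
     (\<Sum>v\<in>UNIV. Poly_Mapping.lookup a v) + (\<Sum>v\<in>UNIV. Poly_Mapping.lookup b v) \<le> k}"

text \<open>
  The image of \<open>F\<^sub>k\<close> in the cyclic module \<open>D/I\<close> is isomorphic to \<open>F\<^sub>k/(F\<^sub>k \<inter> I)\<close>, and these images
  form a good filtration of \<open>D/I\<close>.
\<close>

definition quotient_hilbert_function :: "'v::finite weyl set \<Rightarrow> nat \<Rightarrow> nat" where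
  "quotient_hilbert_function I k =
     weyl.dim (bernstein_filtration k :: 'v weyl set) - weyl.dim (bernstein_filtration k \<inter> I)"

text \<open>
  With \<open>n\<close> variables, \<open>D/I\<close> is holonomic if it is zero or has Bernstein dimension \<open>n\<close>, the Bernstein
  dimension being the degree of the Hilbert polynomial of a good filtration.
\<close>

definition has_bernstein_dimension :: "'v::finite weyl set \<Rightarrow> nat \<Rightarrow> bool" where
  "has_bernstein_dimension I \<delta> \<longleftrightarrow>
     (\<exists>p :: real poly. (\<forall>\<^sub>F k in sequentially. real (quotient_hilbert_function I k) = poly p (real k))
        \<and> p \<noteq> 0 \<and> degree p = \<delta>)"

definition holonomic_ideal :: "'v::finite weyl set \<Rightarrow> bool" where
  "holonomic_ideal I \<longleftrightarrow> left_ideal I \<and> (I = UNIV \<or> has_bernstein_dimension I CARD('v))"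

section \<open>Action on smooth functions\<close>

definition partial :: "'v::finite \<Rightarrow> (real^'v \<Rightarrow> complex) \<Rightarrow> real^'v \<Rightarrow> complex" where
  "partial v f p = vector_derivative (\<lambda>s. f (p + s *\<^sub>R axis v 1)) (at 0)"

definition partials :: "('v::finite \<Rightarrow>\<^sub>0 nat) \<Rightarrow> (real^'v \<Rightarrow> complex) \<Rightarrow> real^'v \<Rightarrow> complex" where
  "partials b f = foldr (\<lambda>v. partial v ^^ Poly_Mapping.lookup b v) var_enum f"

definition weyl_apply :: "'v::finite weyl \<Rightarrow> (real^'v \<Rightarrow> complex) \<Rightarrow> real^'v \<Rightarrow> complex" where
  "weyl_apply P f p =
     (\<Sum>(a, b)\<in>Poly_Mapping.keys (weyl_coeffs P).
        Poly_Mapping.lookup (weyl_coeffs P) (a, b) *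
        (\<Prod>v\<in>UNIV. complex_of_real (p $ v) ^ Poly_Mapping.lookup a v) * partials b f p)"

primrec Ck_on :: "nat \<Rightarrow> (real^'v::finite) set \<Rightarrow> (real^'v \<Rightarrow> complex) \<Rightarrow> bool" where
  "Ck_on 0 U f \<longleftrightarrow> continuous_on U f"
| "Ck_on (Suc k) U f \<longleftrightarrow> continuous_on U f \<and>
     (\<forall>v. (\<forall>p\<in>U. (\<lambda>s. f (p + s *\<^sub>R axis v 1)) differentiable (at (0::real))) \<and> Ck_on k U (partial v f))"

definition smooth_on :: "(real^'v::finite) set \<Rightarrow> (real^'v \<Rightarrow> complex) \<Rightarrow> bool" where
  "smooth_on U f \<longleftrightarrow> open U \<and> (\<forall>k. Ck_on k U f)"

text \<open>Smoothness is required because \<open>partial\<close> takes a meaningless value where no derivative exists.\<close>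

definition annihilates_on :: "(real^'v::finite) set \<Rightarrow> 'v weyl \<Rightarrow> (real^'v \<Rightarrow> complex) \<Rightarrow> bool" where
  "annihilates_on U P f \<longleftrightarrow> smooth_on U f \<and> (\<forall>p\<in>U. weyl_apply P f p = 0)"

section \<open>The orthant integral and its operators\<close>

instance uprod :: (finite) finite
  by standard simp

text \<open>
  The dimension \<open>d\<close> is the cardinality of \<open>'n\<close>.  The coordinates \<open>x\<^sub>i\<^sub>j\<close> of a symmetric matrix,
  with \<open>x\<^sub>i\<^sub>j = x\<^sub>j\<^sub>i\<close>, are indexed by the unordered pairs \<open>Upair i j\<close>, where \<open>i = j\<close> is allowed; so
  there are \<open>d (d + 1) / 2\<close> of them.
\<close>

type_synonym 'n coord = "'n uprod + 'n"

definition x_part :: "real^('n::finite) coord \<Rightarrow> real^'n^'n" where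
  "x_part p = (\<chi> i j. p $ Inl (Upair i j))"

definition y_part :: "real^('n::finite) coord \<Rightarrow> real^'n" where
  "y_part p = (\<chi> i. p $ Inr i)"

definition positive_definite :: "real^'n^'n::finite \<Rightarrow> bool" where
  "positive_definite A \<longleftrightarrow> transpose A = A \<and> (\<forall>v. v \<noteq> 0 \<longrightarrow> v \<bullet> (A *v v) > 0)"

definition orthant_domain :: "(real^('n::finite) coord) set" where
  "orthant_domain = {p. positive_definite (- x_part p)}"

definition orthant_integral :: "real^'n^'n \<Rightarrow> real^'n \<Rightarrow> real" where
  "orthant_integral x y =
     (LINT t:{t :: real^'n::finite. \<forall>i. 0 \<le> t $ i}|lborel.
        exp ((\<Sum>i\<in>UNIV. \<Sum>j\<in>UNIV. x $ i $ j * t $ i * t $ j) + (\<Sum>i\<in>UNIV. y $ i * t $ i)))"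

abbreviation x_var :: "'n \<Rightarrow> 'n \<Rightarrow> ('n::finite) coord weyl" where
  "x_var i j \<equiv> weyl_var (Inl (Upair i j))"

abbreviation y_var :: "'n \<Rightarrow> ('n::finite) coord weyl" where
  "y_var i \<equiv> weyl_var (Inr i)"

abbreviation dx :: "'n \<Rightarrow> 'n \<Rightarrow> ('n::finite) coord weyl" where
  "dx i j \<equiv> weyl_deriv (Inl (Upair i j))"

abbreviation dy :: "'n \<Rightarrow> ('n::finite) coord weyl" where
  "dy i \<equiv> weyl_deriv (Inr i)"

text \<open>
  The second family is symmetric in \<open>i\<close> and \<open>j\<close>, so ranging over \<open>i \<noteq> j\<close> is the same as ranging
  over \<open>i < j\<close> for any linear order on \<open>'n\<close>.
\<close>

definition orthant_operators :: "('n::finite) coord weyl set" where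
  "orthant_operators =
     {2 * (\<Sum>k\<in>UNIV. x_var i k * dy i * dy k) + y_var i * dy i + 1 | i. True} \<union>
     {dx i j - 2 * dy i * dy j | i j. i \<noteq> j} \<union>
     {dx i i - dy i ^ 2 | i. True}"

end

theory Submission
  imports
    Defs
    "HOL-Library.List_Lexorder"
    "HOL-Probability.Distributions"
begin

text \<open>
  Put \<open>D\<^sub>i = y\<^sub>i + 2 \<Sum>\<^sub>k x\<^sub>i\<^sub>k \<partial>\<^sub>y\<^sub>k\<close> and \<open>E\<^sub>i\<^sub>j = \<partial>\<^sub>x\<^sub>i\<^sub>j - c \<partial>\<^sub>y\<^sub>i \<partial>\<^sub>y\<^sub>j\<close> with \<open>c = 2\<close> for \<open>i \<noteq> j\<close> and \<open>c = 1\<close> for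
  \<open>i = j\<close>.  The generators of \<open>I\<close> are \<open>\<partial>\<^sub>y\<^sub>i D\<^sub>i\<close> and \<open>E\<^sub>i\<^sub>j\<close>, and \<open>(x\<^sub>i\<^sub>j, E\<^sub>i\<^sub>j)\<close>, \<open>(\<partial>\<^sub>y\<^sub>i, D\<^sub>i)\<close> are
  canonical pairs, commuting with each other, which generate the Weyl algebra.  Hence products
  containing from each pair \<open>(A, B)\<close> only powers of \<open>A\<close> or only powers of \<open>B\<close> span \<open>D/I\<close>.  The old
  generators have degree at most 2 in the new ones, so the Hilbert function of \<open>D/I\<close> is
  \<open>O(k\<^sup>N)\<close> for \<open>N\<close> variables.  In the other direction, conjugation with the exponential of the quadratic
  form and Fourier transform in \<open>y\<close> make \<open>D\<close> act on polynomials so that \<open>I\<close> kills 1 while the \<open>x\<^sup>a \<partial>\<^sub>y\<^sup>b\<close>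
  produce all monomials; so the Hilbert function grows at least like \<open>k\<^sup>N\<close>.  It is eventually
  polynomial because it counts the monomials outside a monoid ideal, the set of leading monomials
  of \<open>I\<close> in a graded order.

  On the analytic side, differentiating under the integral turns each partial derivative into a
  monomial factor in \<open>t\<close>, and the first family of operators expresses the invariance of the integral
  under the substitutions \<open>t\<^sub>i \<mapsto> \<lambda> t\<^sub>i\<close>, differentiated at \<open>\<lambda> = 1\<close>.
\<close>

section \<open>Counting complements of up-closed sets\<close>

definition up_closed :: "nat \<Rightarrow> nat list set \<Rightarrow> bool" where
  "up_closed n U \<longleftrightarrow> U \<subseteq> {xs. length xs = n} \<and> (\<forall>xs\<in>U. \<forall>ys. list_all2 (\<le>) xs ys \<longrightarrow> ys \<in> U)"

definition slice :: "nat list set \<Rightarrow> nat \<Rightarrow> nat list set" where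
  "slice U j = {xs. j # xs \<in> U}"

lemma up_closed_slice: "up_closed (Suc n) U \<Longrightarrow> up_closed n (slice U j)"
  unfolding up_closed_def slice_def by fastforce

lemma slice_mono:
  assumes "up_closed (Suc n) U" "i \<le> j"
  shows "slice U i \<subseteq> slice U j"
proof
  fix xs assume "xs \<in> slice U i"
  then have "i # xs \<in> U" by (simp add: slice_def)
  moreover have "list_all2 (\<le>) (i # xs) (j # xs)"
    using assms(2) by (simp add: list_all2_refl)
  ultimately show "xs \<in> slice U j"
    using assms(1) unfolding up_closed_def slice_def by blast
qed

text \<open>This is the ascending chain form of Dickson's lemma. Slices by the first entry are
  monotone in both indices, so the diagonal chain \<open>slice (U i) i\<close> becomes constant by
  the induction hypothesis and squeezes all slices of large index; the finitely many slices with
  \<open>j < N\<close> stabilise one by one.\<close>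

lemma up_closed_chain_stabilises:
  fixes U :: "nat \<Rightarrow> nat list set"
  assumes "\<And>i. up_closed n (U i)" "\<And>i j. i \<le> j \<Longrightarrow> U i \<subseteq> U j"
  shows "\<exists>N. \<forall>i\<ge>N. U i = U N"
  using assms
proof (induction n arbitrary: U)
  case 0
  then have sub: "U i \<subseteq> {[]}" for i by (auto simp: up_closed_def)
  show ?case
  proof (cases "\<exists>i. U i \<noteq> {}")
    case True
    then obtain i where "U i = {[]}" using sub by blast
    then have "U j = U i" if "i \<le> j" for j using sub[of j] 0(2)[OF that] by blast
    then show ?thesis by blast
  qed auto
next
  case (Suc n)
  have up: "up_closed n (slice (U i) j)" for i j
    using Suc.prems(1) by (rule up_closed_slice)
  have mono: "slice (U i) j \<subseteq> slice (U i') j'" if "i \<le> i'" "j \<le> j'" for i i' j j'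
    using slice_mono[OF Suc.prems(1) that(2)] Suc.prems(2)[OF that(1)] by (fastforce simp: slice_def)
  have "\<exists>N. \<forall>i\<ge>N. slice (U i) i = slice (U N) N"
    by (rule Suc.IH[OF up mono])
  then obtain N where N: "\<And>i. i \<ge> N \<Longrightarrow> slice (U i) i = slice (U N) N" by blast
  have "\<exists>M. \<forall>i\<ge>M. slice (U i) j = slice (U M) j" for j
    by (rule Suc.IH[OF up mono]) simp_all
  then obtain M where M: "\<And>i j. i \<ge> M j \<Longrightarrow> slice (U i) j = slice (U (M j)) j" by metis
  define K where "K = Max (insert N (M ` {..<N}))"
  have K: "N \<le> K" "\<And>j. j < N \<Longrightarrow> M j \<le> K"
    by (auto simp: K_def)
  have "slice (U i) j = slice (U K) j" if "K \<le> i" for i j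
  proof (cases "j < N")
    case True
    then show ?thesis using M[of j i] M[of j K] K(2) that by fastforce
  next
    case False
    have "slice (U i') j = slice (U N) N" if "K \<le> i'" for i'
    proof
      show "slice (U N) N \<subseteq> slice (U i') j"
        by (rule mono) (use False K that in auto)
      have "slice (U i') j \<subseteq> slice (U (max i' j)) (max i' j)"
        by (rule mono) auto
      also have "\<dots> = slice (U N) N"
        by (rule N) (use False in auto)
      finally show "slice (U i') j \<subseteq> slice (U N) N" .
    qed
    from this[OF that] this[of K] show ?thesis by simp
  qed
  moreover have "U i = U i'" if "\<And>j. slice (U i) j = slice (U i') j" for i i'
  proof (rule set_eqI)
    fix xs
    show "xs \<in> U i \<longleftrightarrow> xs \<in> U i'"
    proof (cases xs)
      case Nil
      then show ?thesis using Suc.prems(1)[of i] Suc.prems(1)[of i'] by (auto simp: up_closed_def)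
    next
      case (Cons j ys)
      then show ?thesis using that[of j] by (auto simp: slice_def)
    qed
  qed
  ultimately show ?case by metis
qed

section \<open>Functions that are eventually polynomial\<close>

definition eventually_poly :: "(nat \<Rightarrow> real) \<Rightarrow> bool" where
  "eventually_poly f \<longleftrightarrow> (\<exists>p. \<forall>\<^sub>F k in sequentially. f k = poly p (real k))"

lemma eventually_poly_const: "eventually_poly (\<lambda>_. c)"
  unfolding eventually_poly_def by (intro exI[of _ "[:c:]"]) simp

lemma eventually_poly_add:
  assumes "eventually_poly f" "eventually_poly g"
  shows "eventually_poly (\<lambda>k. f k + g k)"
proof -
  from assms obtain p q where "\<forall>\<^sub>F k in sequentially. f k = poly p (real k)"
    "\<forall>\<^sub>F k in sequentially. g k = poly q (real k)" by (auto simp: eventually_poly_def)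
  then have "\<forall>\<^sub>F k in sequentially. f k + g k = poly (p + q) (real k)"
    by eventually_elim simp
  then show ?thesis unfolding eventually_poly_def by blast
qed

lemma eventually_poly_sum:
  assumes "finite A" "\<And>j. j \<in> A \<Longrightarrow> eventually_poly (f j)"
  shows "eventually_poly (\<lambda>k. \<Sum>j\<in>A. f j k)"
  using assms by (induction A) (auto intro: eventually_poly_const eventually_poly_add)

lemma eventually_poly_cong:
  assumes "\<forall>\<^sub>F k in sequentially. f k = g k" "eventually_poly g"
  shows "eventually_poly f"
proof -
  from assms(2) obtain p where "\<forall>\<^sub>F k in sequentially. g k = poly p (real k)"
    by (auto simp: eventually_poly_def)
  with assms(1) have "\<forall>\<^sub>F k in sequentially. f k = poly p (real k)"
    by eventually_elim simp
  then show ?thesis unfolding eventually_poly_def by blast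
qed

lemma eventually_poly_shift:
  assumes "eventually_poly f"
  shows "eventually_poly (\<lambda>k. f (k - j))"
proof -
  from assms obtain p where p: "\<forall>\<^sub>F k in sequentially. f k = poly p (real k)"
    by (auto simp: eventually_poly_def)
  have "\<forall>\<^sub>F k in sequentially. f (k - j) = poly p (real (k - j))"
    using p filterlim_minus_const_nat_at_top[of j] unfolding filterlim_iff by blast
  then have "\<forall>\<^sub>F k in sequentially. f (k - j) = poly (pcompose p [:- real j, 1:]) (real k)"
    using eventually_ge_at_top[of j] by eventually_elim (simp add: poly_pcompose of_nat_diff)
  then show ?thesis unfolding eventually_poly_def by blast
qed

text \<open>Induction on the degree: (x+1)^(n+1) - x^(n+1) has leading term (n+1) x^n, so the
  difference of a multiple of x^(n+1) removes the top coefficient of \<open>p\<close>.\<close>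

lemma ex_poly_difference:
  "\<exists>q :: real poly. \<forall>x. poly q (x + 1) - poly q x = poly p x"
proof (induction "degree p" arbitrary: p rule: less_induct)
  case less
  define n where "n = degree p"
  define q where "q = smult (coeff p n / (real n + 1)) (monom 1 (Suc n))"
  define s where "s = smult (coeff p n / (real n + 1)) ([:1, 1:] ^ Suc n - monom 1 (Suc n))"
  have ps: "poly s x = poly q (x + 1) - poly q x" for x
    by (simp add: s_def q_def poly_monom poly_power add.commute right_diff_distrib del: power_Suc)
  have cs: "coeff s i = (coeff p n / (real n + 1)) * (if i \<le> n then of_nat (Suc n choose i) else 0)" for i
    by (cases "i \<le> Suc n"; cases "i = Suc n")
       (auto simp add: s_def coeff_linear_poly_power coeff_eq_0 degree_linear_power simp del: power_Suc)
  have "coeff (p - s) i = 0" if "n \<le> i" for i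
    using that by (cases "i = n") (auto simp: cs n_def coeff_eq_0 field_simps simp del: binomial_Suc_Suc)
  then have deg: "degree (p - s) < n \<or> p - s = 0"
    by (metis leading_coeff_0_iff not_le)
  have "\<exists>r. \<forall>x. poly r (x + 1) - poly r x = poly (p - s) x"
  proof (cases "p - s = 0")
    case True
    then show ?thesis by (intro exI[of _ 0]) simp
  next
    case False
    with deg show ?thesis by (intro less) (simp add: n_def)
  qed
  then obtain r where r: "\<And>x. poly r (x + 1) - poly r x = poly (p - s) x" by blast
  have "poly (q + r) (x + 1) - poly (q + r) x = poly p x" for x
    using ps[of x] r[of x] by simp
  then show ?case by blast
qed

lemma eventually_poly_cumulative:
  assumes "eventually_poly f"
  shows "eventually_poly (\<lambda>k. \<Sum>i\<le>k. f i)"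
proof -
  from assms obtain p K where p: "\<And>k. k \<ge> K \<Longrightarrow> f k = poly p (real k)"
    by (auto simp: eventually_poly_def eventually_sequentially)
  \<comment> \<open>The increment of the sum from \<open>m\<close> to \<open>m + 1\<close> is
    \<open>f (m + 1)\<close>, so the discrete antiderivative is taken of \<open>p\<close> shifted by
    1. The values up to \<open>K\<close> enter through the additive constant below.\<close>
  obtain q where q: "\<And>x. poly q (x + 1) - poly q x = poly (pcompose p [:1, 1:]) x"
    using ex_poly_difference by blast
  have "(\<Sum>i\<le>k. f i) = poly ([:(\<Sum>i\<le>K. f i) - poly q (real K):] + q) (real k)" if "K \<le> k" for k
    using that
  proof (induction k rule: dec_induct)
    case (step m)
    have "f (Suc m) = poly q (real m + 1) - poly q (real m)"
      using p[of "Suc m"] step.hyps q[of "real m"] by (simp add: poly_pcompose)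
    with step.IH show ?case by (simp add: add.commute)
  qed simp
  then show ?thesis
    unfolding eventually_poly_def eventually_sequentially by blast
qed

lemma finite_lists_sum_le: "finite {xs :: nat list. length xs = n \<and> sum_list xs \<le> k}"
proof (rule finite_subset)
  show "{xs. length xs = n \<and> sum_list xs \<le> k} \<subseteq> {xs. set xs \<subseteq> {..k} \<and> length xs = n}"
    using member_le_sum_list by fastforce
  show "finite {xs. set xs \<subseteq> {..k} \<and> length xs = n}"
    by (rule finite_lists_length_eq) simp
qed

text \<open>Grouping by the first entry \<open>j\<close> leaves a count for \<open>slice U j\<close>
  with budget \<open>k - j\<close>. The slices are constant from some \<open>N\<close> on, so the
  tail is a cumulative sum of one eventually polynomial function, and the rest is a finite sum of
  shifted ones.\<close>

theorem eventually_poly_card_complement_up_closed: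
  assumes "up_closed n U"
  shows "eventually_poly (\<lambda>k. real (card {xs. length xs = n \<and> sum_list xs \<le> k \<and> xs \<notin> U}))"
  using assms
proof (induction n arbitrary: U)
  case 0
  have "{xs :: nat list. length xs = 0 \<and> sum_list xs \<le> k \<and> xs \<notin> U} = (if [] \<in> U then {} else {[]})" for k
    by auto
  then show ?case by (auto intro: eventually_poly_const)
next
  case (Suc n)
  define H where "H = (\<lambda>V k. card {xs :: nat list. length xs = n \<and> sum_list xs \<le> k \<and> xs \<notin> V})"
  have "\<exists>N. \<forall>j\<ge>N. slice U j = slice U N"
    by (rule up_closed_chain_stabilises) (auto intro: up_closed_slice slice_mono[THEN subsetD] Suc.prems)
  then obtain N where N: "\<And>j. j \<ge> N \<Longrightarrow> slice U j = slice U N" by blast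
  have ev: "eventually_poly (\<lambda>k. real (H (slice U j) k))" for j
    unfolding H_def by (rule Suc.IH[OF up_closed_slice[OF Suc.prems]])
  have card: "card {xs. length xs = Suc n \<and> sum_list xs \<le> k \<and> xs \<notin> U} = (\<Sum>j\<le>k. H (slice U j) (k - j))" for k
  proof -
    have "{xs. length xs = Suc n \<and> sum_list xs \<le> k \<and> xs \<notin> U} =
        (\<Union>j\<le>k. Cons j ` {xs. length xs = n \<and> sum_list xs \<le> k - j \<and> xs \<notin> slice U j})"
    proof (rule set_eqI)
      fix xs
      show "xs \<in> {xs. length xs = Suc n \<and> sum_list xs \<le> k \<and> xs \<notin> U} \<longleftrightarrow>
          xs \<in> (\<Union>j\<le>k. Cons j ` {xs. length xs = n \<and> sum_list xs \<le> k - j \<and> xs \<notin> slice U j})"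
        by (cases xs) (auto simp: slice_def image_iff)
    qed
    also have "card \<dots> = (\<Sum>j\<le>k. card (Cons j ` {xs. length xs = n \<and> sum_list xs \<le> k - j \<and> xs \<notin> slice U j}))"
      by (rule card_UN_disjoint)
         (auto intro!: finite_imageI intro: finite_subset[OF _ finite_lists_sum_le[of n]])
    finally show ?thesis
      by (simp add: H_def card_image)
  qed
  \<comment> \<open>Indices \<open>j \<ge> N\<close> all see \<open>slice U N\<close>; reversing the
    order turns the tail into the cumulative sum up to \<open>k - N\<close>.\<close>
  have split: "(\<Sum>j\<le>k. real (H (slice U j) (k - j))) =
      (\<Sum>j<N. real (H (slice U j) (k - j))) + (\<Sum>i\<le>k - N. real (H (slice U N) i))" if "N \<le> k" for k
  proof -
    have "{..k} = {..<N} \<union> {N..k}" using that by auto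
    then have "(\<Sum>j\<le>k. real (H (slice U j) (k - j))) =
        (\<Sum>j<N. real (H (slice U j) (k - j))) + (\<Sum>j\<in>{N..k}. real (H (slice U j) (k - j)))"
      by (simp add: sum.union_disjoint ivl_disj_int)
    also have "(\<Sum>j\<in>{N..k}. real (H (slice U j) (k - j))) = (\<Sum>j\<in>{N..k}. real (H (slice U N) (k - j)))"
      by (rule sum.cong) (auto dest!: N)
    also have "\<dots> = (\<Sum>i\<le>k - N. real (H (slice U N) i))"
      by (rule sum.reindex_bij_witness[of _ "\<lambda>i. k - i" "\<lambda>j. k - j"]) (use that in auto)
    finally show ?thesis .
  qed
  show ?case
  proof (rule eventually_poly_cong)
    show "\<forall>\<^sub>F k in sequentially. real (card {xs. length xs = Suc n \<and> sum_list xs \<le> k \<and> xs \<notin> U}) =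
        (\<Sum>j<N. real (H (slice U j) (k - j))) + (\<Sum>i\<le>k - N. real (H (slice U N) i))"
      using eventually_ge_at_top[of N] by eventually_elim (simp add: card split)
    show "eventually_poly (\<lambda>k. (\<Sum>j<N. real (H (slice U j) (k - j))) + (\<Sum>i\<le>k - N. real (H (slice U N) i)))"
      by (intro eventually_poly_add eventually_poly_sum eventually_poly_shift[OF ev]
          eventually_poly_shift[OF eventually_poly_cumulative[OF ev]]) simp
  qed
qed

text \<open>Compatibility of the lexicographic order with addition makes \<open>grlex\<close> below
  a monomial order.\<close>

lemma list_less_map2_add:
  fixes xs ys zs :: "nat list"
  assumes "xs < ys" "length xs = length ys" "length zs = length xs"
  shows "map2 (+) xs zs < map2 (+) ys zs"
  using assms(2,3,1)
proof (induction xs ys arbitrary: zs rule: list_induct2)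
  case (Cons x xs y ys)
  then show ?case by (cases zs) auto
qed simp

section \<open>Standard monomials of a left ideal\<close>

type_synonym 'v exponents = "('v \<Rightarrow>\<^sub>0 nat) \<times> ('v \<Rightarrow>\<^sub>0 nat)"

text \<open>Flattening both exponent vectors into one list transfers the count of standard monomials
  to the combinatorics of \<open>up_closed\<close> sets and supplies the lexicographic
  tie-break.\<close>

definition exps :: "'v::finite exponents \<Rightarrow> nat list" where
  "exps m = map (Poly_Mapping.lookup (fst m)) var_enum @ map (Poly_Mapping.lookup (snd m)) var_enum"

definition deg :: "'v::finite exponents \<Rightarrow> nat" where
  "deg m = (\<Sum>v\<in>UNIV. Poly_Mapping.lookup (fst m) v) + (\<Sum>v\<in>UNIV. Poly_Mapping.lookup (snd m) v)"

text \<open>The degree leads because reordering factors in the Weyl algebra only creates terms of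
  smaller degree, which a graded order ranks below the main term.\<close>

definition grlex :: "'v::finite exponents \<Rightarrow> nat list" where
  "grlex m = deg m # exps m"

definition wmon :: "'v::finite exponents \<Rightarrow> 'v weyl" where
  "wmon m = weyl_monom (fst m) (snd m)"

lemma length_var_enum: "length (var_enum :: 'v::finite list) = CARD('v)"
  using distinct_card[OF var_enum(1)] var_enum(2) by metis

lemma length_exps [simp]: "length (exps (m :: 'v::finite exponents)) = 2 * CARD('v)"
  by (simp add: exps_def length_var_enum)

lemma sum_list_exps: "sum_list (exps m) = deg m"
  by (simp add: exps_def deg_def sum_list_distinct_conv_sum_set var_enum)

lemma inj_exps: "inj exps"
proof (rule injI)
  fix m m' :: "'v::finite exponents"
  assume "exps m = exps m'"
  then have "map (Poly_Mapping.lookup (fst m)) var_enum = map (Poly_Mapping.lookup (fst m')) var_enum"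
    "map (Poly_Mapping.lookup (snd m)) var_enum = map (Poly_Mapping.lookup (snd m')) var_enum"
    by (simp_all add: exps_def)
  then show "m = m'"
    by (intro prod_eqI poly_mapping_eqI) (simp_all add: map_eq_conv var_enum)
qed

lemma exps_surj:
  assumes "length xs = 2 * CARD('v)"
  shows "\<exists>m :: 'v::finite exponents. exps m = xs"
proof -
  let ?n = "CARD('v)"
  have "\<exists>a :: 'v \<Rightarrow>\<^sub>0 nat. map (Poly_Mapping.lookup a) var_enum = ys" if "length ys = ?n" for ys
  proof -
    let ?f = "\<lambda>v :: 'v. the (map_of (zip var_enum ys) v)"
    have "map ?f var_enum = ys"
    proof (rule nth_equalityI)
      fix i assume "i < length (map ?f var_enum)"
      then have "map_of (zip (var_enum :: 'v list) ys) (var_enum ! i) = Some (ys ! i)"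
        by (intro map_of_zip_nth) (simp_all add: that length_var_enum var_enum)
      with \<open>i < _\<close> show "map ?f var_enum ! i = ys ! i" by simp
    qed (simp add: that length_var_enum)
    moreover have "Poly_Mapping.lookup (Abs_poly_mapping ?f) = ?f"
      by (rule lookup_Abs_poly_mapping) simp
    ultimately show ?thesis by metis
  qed
  from this[of "take ?n xs"] this[of "drop ?n xs"] obtain a b :: "'v \<Rightarrow>\<^sub>0 nat"
    where "map (Poly_Mapping.lookup a) var_enum = take ?n xs"
      "map (Poly_Mapping.lookup b) var_enum = drop ?n xs"
    using assms by auto
  then have "exps (a, b) = xs" by (simp add: exps_def)
  then show ?thesis ..
qed

lemma exps_add: "exps (a + a', b + b') = map2 (+) (exps (a, b)) (exps (a', b'))"
  by (simp add: exps_def zip_append map2_map_map lookup_add)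

lemma deg_add: "deg (a + a', b + b') = deg (a, b) + deg (a', b')"
  by (simp add: deg_def lookup_add sum.distrib)

lemma deg_single [simp]:
  "deg (Poly_Mapping.single u 1, 0) = 1" "deg (0, Poly_Mapping.single u 1) = 1"
  "deg (Poly_Mapping.single u (Suc 0), 0) = 1" "deg (0, Poly_Mapping.single u (Suc 0)) = 1"
  "deg (0, 0) = 0"
  by (simp_all add: deg_def lookup_single when_def)

lemma deg_add_single:
  "deg (a + Poly_Mapping.single u 1, b) = Suc (deg (a, b))"
  "deg (a, b + Poly_Mapping.single u 1) = Suc (deg (a, b))"
  using deg_add[of a "Poly_Mapping.single u 1" b 0] deg_add[of a 0 b "Poly_Mapping.single u 1"]
  by simp_all

lemma grlex_less_iff: "grlex m < grlex m' \<longleftrightarrow> deg m < deg m' \<or> deg m = deg m' \<and> exps m < exps m'"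
  by (simp add: grlex_def)

lemma grlex_less_add:
  assumes "grlex (a, b) < grlex (c, d)"
  shows "grlex (a + a', b + b') < grlex (c + a', d + b')"
  using assms list_less_map2_add[of "exps (a, b)" "exps (c, d)" "exps (a', b')"]
  by (auto simp: grlex_less_iff deg_add exps_add)

lemma grlex_eq_iff: "grlex m = grlex m' \<longleftrightarrow> m = m'"
  by (auto simp: grlex_def inj_eq[OF inj_exps])

lemma finite_deg_le: "finite {m :: 'v::finite exponents. deg m \<le> k}"
proof (rule finite_imageD)
  show "finite (exps ` {m :: 'v exponents. deg m \<le> k})"
    by (rule finite_subset[OF _ finite_lists_sum_le[of "2 * CARD('v)" k]])
       (auto simp: sum_list_exps)
qed (meson inj_exps inj_on_subset subset_UNIV)

lemma finite_grlex_less: "finite {m'. grlex m' < grlex m}"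
  by (rule finite_subset[OF _ finite_deg_le[of "deg m"]]) (auto simp: grlex_less_iff)

lemma weyl_coeffs_scale_monom_add:
  "weyl_coeffs (weyl_scale c (wmon m) + P) = Poly_Mapping.single m c + weyl_coeffs P"
proof -
  have "weyl_of_coeffs (Poly_Mapping.single m c + weyl_coeffs P) = weyl_scale c (wmon m) + P"
    by (cases m) (simp add: weyl_of_coeffs_add weyl_of_coeffs_single wmon_def)
  then show ?thesis by (metis weyl_coeffs_of_coeffs)
qed

lemma weyl_coeffs_0: "weyl_coeffs 0 = 0"
  using weyl_coeffs_of_coeffs[of 0] by (simp add: weyl_of_coeffs_def)

lemma keys_weyl_coeffs_span:
  assumes "P \<in> weyl.span (wmon ` A)"
  shows "Poly_Mapping.keys (weyl_coeffs P) \<subseteq> A"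
  using assms
proof (induction rule: weyl.span_induct_alt)
  case (step c x y)
  then obtain m where "x = wmon m" "m \<in> A" by blast
  with step show ?case
    using keys_add[of "Poly_Mapping.single m c" "weyl_coeffs y"]
    by (auto simp: weyl_coeffs_scale_monom_add split: if_splits)
qed (simp add: weyl_coeffs_0)

lemma wmon_in_span_iff: "wmon m \<in> weyl.span (wmon ` A) \<longleftrightarrow> m \<in> A"
proof
  assume "wmon m \<in> weyl.span (wmon ` A)"
  then show "m \<in> A"
    using keys_weyl_coeffs_span weyl_coeffs_scale_monom_add[of 1 m 0]
    by (fastforce simp: weyl_coeffs_0)
qed (simp add: weyl.span_base)

lemma inj_wmon: "inj wmon"
proof (rule injI)
  fix m m' :: "'v::finite exponents"
  assume "wmon m = wmon m'"
  then have "wmon m \<in> weyl.span (wmon ` {m'})" by (simp add: weyl.span_base)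
  then show "m = m'" by (simp only: wmon_in_span_iff) simp
qed

lemma independent_wmon: "weyl.independent (wmon ` A)"
proof
  assume "weyl.dependent (wmon ` A)"
  then obtain m where "m \<in> A" "wmon m \<in> weyl.span (wmon ` A - {wmon m})"
    by (auto simp: weyl.dependent_def)
  moreover have "wmon ` A - {wmon m} = wmon ` (A - {m})"
    by (auto simp: inj_eq[OF inj_wmon])
  ultimately show False by (simp add: wmon_in_span_iff)
qed

section \<open>Leading monomials and normal forms modulo a left ideal\<close>

definition lead :: "'v::finite exponents \<Rightarrow> 'v weyl \<Rightarrow> bool" where
  "lead m P \<longleftrightarrow> (\<exists>c R. c \<noteq> 0 \<and> R \<in> weyl.span (wmon ` {m'. grlex m' < grlex m}) \<and> P = weyl_scale c (wmon m) + R)"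

text \<open>The maximum of \<open>grlex\<close> over the occurring monomials is attained only once,
  because \<open>grlex\<close> is injective, so all other terms are strictly smaller.\<close>

lemma ex_lead:
  assumes "P \<noteq> 0"
  shows "\<exists>m\<in>Poly_Mapping.keys (weyl_coeffs P). lead m P"
proof -
  let ?K = "Poly_Mapping.keys (weyl_coeffs P)" and ?c = "Poly_Mapping.lookup (weyl_coeffs P)"
  have P: "P = (\<Sum>m\<in>?K. weyl_scale (?c m) (wmon m))"
    using weyl_of_coeffs_coeffs[of P] by (simp add: weyl_of_coeffs_def wmon_def split_def)
  with assms have "?K \<noteq> {}" by auto
  then have "Max (grlex ` ?K) \<in> grlex ` ?K" by (intro Max_in) auto
  then obtain m where m: "m \<in> ?K" "grlex m = Max (grlex ` ?K)" by auto
  have less: "grlex m' < grlex m" if "m' \<in> ?K - {m}" for m'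
  proof -
    have "grlex m' \<le> grlex m" unfolding m(2) by (rule Max_ge) (use that in auto)
    moreover have "grlex m' \<noteq> grlex m" using that by (simp add: grlex_eq_iff)
    ultimately show ?thesis by simp
  qed
  have "P = weyl_scale (?c m) (wmon m) + (\<Sum>m\<in>?K - {m}. weyl_scale (?c m) (wmon m))"
    by (subst P, rule sum.remove) (use m in auto)
  moreover have "(\<Sum>m\<in>?K - {m}. weyl_scale (?c m) (wmon m)) \<in> weyl.span (wmon ` {m'. grlex m' < grlex m})"
    by (intro weyl.span_sum weyl.span_scale weyl.span_base) (use less in auto)
  moreover have "?c m \<noteq> 0" using m(1) by (simp add: in_keys_iff)
  ultimately have "lead m P" unfolding lead_def by blast
  with m(1) show ?thesis by blast
qed

lemma mult_span_wmon:
  assumes "Q \<in> weyl.span (wmon ` A)" "\<And>m. m \<in> A \<Longrightarrow> P * wmon m \<in> weyl.span (wmon ` B)"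
  shows "P * Q \<in> weyl.span (wmon ` B)"
  using assms(1)
proof (induction rule: weyl.span_induct_alt)
  case (step c x y)
  then show ?case
    using assms(2) by (auto simp: distrib_left mult_weyl_scale intro!: weyl.span_add weyl.span_scale)
qed (simp add: weyl.span_zero)

lemma weyl_var_wmon: "weyl_var u * wmon (a, b) = wmon (a + Poly_Mapping.single u 1, b)"
  by (simp only: wmon_def fst_conv snd_conv weyl_var_monom)

text \<open>Each exchange of \<open>weyl_deriv v\<close> with a variable leaves a scalar, so moving
  it into normal position costs only terms that are at least one degree below the main
  monomial.\<close>

lemma weyl_deriv_wmon:
  "weyl_deriv v * wmon (a, b) - wmon (a, b + Poly_Mapping.single v 1) \<in> weyl.span (wmon ` {m. deg m \<le> deg (a, b)})"
proof (induction a rule: exponent_induct)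
  case zero
  show ?case by (simp only: wmon_def fst_conv snd_conv weyl_deriv_monom0 diff_self weyl.span_zero)
next
  case (add a u)
  let ?R = "weyl_deriv v * wmon (a, b) - wmon (a, b + Poly_Mapping.single v 1)"
  have "weyl_deriv v * wmon (a + Poly_Mapping.single u 1, b) =
      weyl_var u * (weyl_deriv v * wmon (a, b)) + (if v = u then 1 else 0) * wmon (a, b)"
    unfolding weyl_var_wmon[symmetric]
    by (simp only: mult.assoc[symmetric] weyl_deriv_var distrib_right)
  then have "weyl_deriv v * wmon (a + Poly_Mapping.single u 1, b) -
      wmon (a + Poly_Mapping.single u 1, b + Poly_Mapping.single v 1) =
      weyl_var u * ?R + (if v = u then 1 else 0) * wmon (a, b)"
    unfolding weyl_var_wmon[symmetric] by (simp add: algebra_simps)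
  moreover have "weyl_var u * ?R \<in> weyl.span (wmon ` {m. deg m \<le> deg (a + Poly_Mapping.single u 1, b)})"
    by (rule mult_span_wmon[OF add])
       (auto simp only: weyl_var_wmon wmon_in_span_iff deg_add_single mem_Collect_eq Suc_le_mono)
  moreover have "(if v = u then 1 else 0) * wmon (a, b) \<in> weyl.span (wmon ` {m. deg m \<le> deg (a + Poly_Mapping.single u 1, b)})"
    by (auto simp only: wmon_in_span_iff deg_add_single weyl.span_zero split: if_splits) (auto simp: wmon_in_span_iff weyl.span_zero)
  ultimately show ?case by (simp only: weyl.span_add)
qed

lemma lead_weyl_var:
  assumes "lead (a, b) P"
  shows "lead (a + Poly_Mapping.single u 1, b) (weyl_var u * P)"
proof -
  from assms obtain c R where P: "c \<noteq> 0" "R \<in> weyl.span (wmon ` {m'. grlex m' < grlex (a, b)})"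
    "P = weyl_scale c (wmon (a, b)) + R" by (auto simp: lead_def)
  have "weyl_var u * R \<in> weyl.span (wmon ` {m'. grlex m' < grlex (a + Poly_Mapping.single u 1, b)})"
  proof (rule mult_span_wmon[OF P(2)])
    fix m :: "'a exponents" assume "m \<in> {m'. grlex m' < grlex (a, b)}"
    then show "weyl_var u * wmon m \<in> weyl.span (wmon ` {m'. grlex m' < grlex (a + Poly_Mapping.single u 1, b)})"
      using grlex_less_add[of "fst m" "snd m" a b "Poly_Mapping.single u 1" 0]
      by (cases m) (simp del: One_nat_def add: weyl_var_wmon wmon_in_span_iff)
  qed
  with P show ?thesis
    unfolding lead_def by (metis distrib_left mult_weyl_scale weyl_var_wmon)
qed

text \<open>Unlike a variable, a derivative does not map normally ordered monomials to such
  monomials, but the correction has smaller total degree than the new leading monomial and is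
  absorbed into the remainder.\<close>

lemma lead_weyl_deriv:
  assumes "lead (a, b) P"
  shows "lead (a, b + Poly_Mapping.single u 1) (weyl_deriv u * P)"
proof -
  let ?S = "weyl.span (wmon ` {m'. grlex m' < grlex (a, b + Poly_Mapping.single u 1)})"
  from assms obtain c R where P: "c \<noteq> 0" "R \<in> weyl.span (wmon ` {m'. grlex m' < grlex (a, b)})"
    "P = weyl_scale c (wmon (a, b)) + R" by (auto simp: lead_def)
  have low: "weyl_deriv u * wmon (a', b') - wmon (a', b' + Poly_Mapping.single u 1) \<in> ?S"
    if "deg (a', b') \<le> deg (a, b)" for a' b' :: "'a \<Rightarrow>\<^sub>0 nat"
    using weyl_deriv_wmon[of u a' b']
    by (rule weyl.span_mono[THEN subsetD, rotated])
       (use that in \<open>auto simp del: One_nat_def simp: grlex_less_iff deg_add_single\<close>)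
  have "weyl_deriv u * R \<in> ?S"
  proof (rule mult_span_wmon[OF P(2)])
    fix m :: "'a exponents" assume m: "m \<in> {m'. grlex m' < grlex (a, b)}"
    obtain a' b' where m': "m = (a', b')" by fastforce
    have "wmon (a', b' + Poly_Mapping.single u 1) \<in> ?S"
      using m grlex_less_add[of a' b' a b 0 "Poly_Mapping.single u 1"]
      by (simp del: One_nat_def add: m' wmon_in_span_iff)
    moreover have "deg (a', b') \<le> deg (a, b)"
      using m by (auto simp: m' grlex_less_iff)
    ultimately show "weyl_deriv u * wmon m \<in> ?S"
      using weyl.span_add low[of a' b'] by (fastforce simp: m')
  qed
  moreover have "weyl_deriv u * P = weyl_scale c (wmon (a, b + Poly_Mapping.single u 1)) +
     (weyl_scale c (weyl_deriv u * wmon (a, b) - wmon (a, b + Poly_Mapping.single u 1)) + weyl_deriv u * R)"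
    by (simp add: P(3) distrib_left mult_weyl_scale weyl.scale_right_diff_distrib)
  ultimately show ?thesis
    unfolding lead_def using P(1) low[OF order_refl] by (blast intro: weyl.span_add weyl.span_scale)
qed

definition leads :: "'v::finite weyl set \<Rightarrow> 'v exponents set" where
  "leads I = {m. \<exists>P\<in>I. lead m P}"

lemma left_ideal_subspace: "left_ideal I \<Longrightarrow> weyl.subspace I"
  by (auto simp: left_ideal_def weyl.subspace_def weyl_scale_def)

lemma leads_add:
  assumes "left_ideal I" "(a, b) \<in> leads I"
  shows "(a + a', b + b') \<in> leads I"
proof -
  have "(a + a', b) \<in> leads I"
  proof (induction a' rule: exponent_induct)
    case (add a' u)
    then show ?case
      using lead_weyl_var assms(1) unfolding leads_def left_ideal_def
      by (fastforce simp: add.assoc[symmetric])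
  qed (simp add: assms)
  then show ?thesis
  proof (induction b' rule: exponent_induct)
    case (add b' u)
    then show ?case
      using lead_weyl_deriv assms(1) unfolding leads_def left_ideal_def
      by (fastforce simp: add.assoc[symmetric])
  qed simp
qed

lemma up_closed_leads:
  assumes "left_ideal (I :: 'v::finite weyl set)"
  shows "up_closed (2 * CARD('v)) (exps ` leads I)"
  unfolding up_closed_def
proof (intro conjI ballI allI impI)
  fix xs ys assume "xs \<in> exps ` leads I" and le: "list_all2 (\<le>) xs ys"
  then obtain a b where ab: "(a, b) \<in> leads I" "xs = exps (a, b)" by auto
  with le have "length ys = 2 * CARD('v)" by (simp add: list_all2_lengthD[symmetric])
  then obtain m :: "'v exponents" where m: "exps m = ys" using exps_surj by blast
  obtain c d where cd: "m = (c, d)" by fastforce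
  have "list_all2 (\<le>) (exps (a, b)) (exps (c, d))" using le ab m cd by simp
  then have "\<forall>v. Poly_Mapping.lookup a v \<le> Poly_Mapping.lookup c v"
    "\<forall>v. Poly_Mapping.lookup b v \<le> Poly_Mapping.lookup d v"
    by (auto simp: exps_def list_all2_append list_all2_map1 list_all2_map2 list_all2_same var_enum)
  then have "c = a + (c - a)" "d = b + (d - b)"
    by (auto intro!: poly_mapping_eqI simp: lookup_add lookup_minus)
  then have "(c, d) \<in> leads I" using leads_add[OF assms ab(1)] by metis
  with m cd show "ys \<in> exps ` leads I" by auto
qed auto

text \<open>Division with remainder by \<open>I\<close>: a leading monomial is exchanged for the
  lower terms of an ideal element. This terminates because only finitely many monomials lie below a
  given one, and the degree bound persists since the order is graded.\<close>

lemma normal_form: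
  assumes I: "left_ideal (I :: 'v::finite weyl set)"
  shows "\<exists>R\<in>weyl.span (wmon ` {m'. m' \<notin> leads I \<and> deg m' \<le> deg m}). wmon m - R \<in> I"
proof (induction "card {m' :: 'v exponents. grlex m' < grlex m}" arbitrary: m rule: less_induct)
  case less
  let ?S = "weyl.span (wmon ` {m'. m' \<notin> leads I \<and> deg m' \<le> deg m})"
  note sub = left_ideal_subspace[OF I]
  show ?case
  proof (cases "m \<in> leads I")
    case False
    then show ?thesis
      using weyl.subspace_0[OF sub] by (intro bexI[of _ "wmon m"]) (auto simp: wmon_in_span_iff)
  next
    case True
    then obtain c R where P: "c \<noteq> 0" "R \<in> weyl.span (wmon ` {m'. grlex m' < grlex m})"
      "weyl_scale c (wmon m) + R \<in> I" by (auto simp: lead_def leads_def)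
    have "\<exists>R'\<in>?S. R - R' \<in> I"
      using P(2)
    proof (induction rule: weyl.span_induct_alt)
      case base
      then show ?case using weyl.span_zero weyl.subspace_0[OF sub] by (intro bexI[of _ 0]) auto
    next
      case (step k x y)
      then obtain m' R' where m': "x = wmon m'" "grlex m' < grlex m" and R': "R' \<in> ?S" "y - R' \<in> I" by auto
      have "m' \<in> {m'' :: 'v exponents. grlex m'' < grlex m} - {m'' :: 'v exponents. grlex m'' < grlex m'}"
        "{m'' :: 'v exponents. grlex m'' < grlex m'} \<subseteq> {m'' :: 'v exponents. grlex m'' < grlex m}"
        using m'(2) by auto
      then have "{m'' :: 'v exponents. grlex m'' < grlex m'} \<subset> {m'' :: 'v exponents. grlex m'' < grlex m}" by (metis DiffE psubsetI)
      then have "card {m'' :: 'v exponents. grlex m'' < grlex m'} < card {m'' :: 'v exponents. grlex m'' < grlex m}"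
        by (rule psubset_card_mono[OF finite_grlex_less])
      from less[OF this] obtain R'' where R'':
        "R'' \<in> weyl.span (wmon ` {m''. m'' \<notin> leads I \<and> deg m'' \<le> deg m'})" "wmon m' - R'' \<in> I" by auto
      have "R'' \<in> ?S"
        using R''(1) by (rule weyl.span_mono[THEN subsetD, rotated]) (use m'(2) in \<open>auto simp: grlex_less_iff\<close>)
      then have "weyl_scale k R'' + R' \<in> ?S" using R' by (intro weyl.span_add weyl.span_scale)
      moreover have "weyl_scale k x + y - (weyl_scale k R'' + R') = weyl_scale k (wmon m' - R'') + (y - R')"
        by (simp add: m' weyl.scale_right_diff_distrib)
      moreover have "weyl_scale k (wmon m' - R'') + (y - R') \<in> I"
        by (intro weyl.subspace_add[OF sub] weyl.subspace_scale[OF sub] R''(2) R'(2))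
      ultimately show ?case by (intro bexI[of _ "weyl_scale k R'' + R'"]) (simp_all only:)
    qed
    then obtain R' where R': "R' \<in> ?S" "R - R' \<in> I" by blast
    \<comment> \<open>Dividing by the leading coefficient solves the ideal relation for
      \<open>wmon m\<close>.\<close>
    have "weyl_scale (1 / c) (weyl_scale c (wmon m) + R - (R - R')) \<in> I"
      by (intro weyl.subspace_scale[OF sub] weyl.subspace_diff[OF sub] P R')
    also have "weyl_scale (1 / c) (weyl_scale c (wmon m) + R - (R - R')) = wmon m - weyl_scale (- 1 / c) R'"
      using P(1) by (simp add: weyl.scale_right_distrib)
    finally show ?thesis using R'(1) by (blast intro: weyl.span_scale)
  qed
qed

text \<open>A nonzero \<open>P\<close> would have a leading monomial that occurs in
  \<open>P\<close>, hence lies in \<open>A\<close>, and that also lies in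
  \<open>leads I\<close>.\<close>

lemma span_standard_Int_ideal:
  assumes "P \<in> weyl.span (wmon ` A)" "A \<inter> leads I = {}" "P \<in> I"
  shows "P = 0"
proof (rule ccontr)
  assume "P \<noteq> 0"
  from ex_lead[OF this] obtain m where "m \<in> Poly_Mapping.keys (weyl_coeffs P)" "lead m P" by blast
  then have "m \<in> A" "m \<in> leads I"
    using keys_weyl_coeffs_span[OF assms(1)] assms(3) by (auto simp: leads_def)
  with assms(2) show False by blast
qed

text \<open>The span of \<open>A\<close> meets \<open>I\<close> only in 0 and the span of
  \<open>B\<close> stays inside \<open>I\<close>, so the two spans form a direct sum. The elements
  of \<open>A\<close> are added to \<open>B\<close> one at a time.\<close>

lemma independent_Un_ideal:
  assumes sub: "weyl.subspace I" and A: "finite A" "weyl.independent A" "\<And>P. P \<in> weyl.span A \<Longrightarrow> P \<in> I \<Longrightarrow> P = 0"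
    and B: "B \<subseteq> I" "weyl.independent B"
  shows "weyl.independent (A \<union> B)" "A \<inter> B = {}"
proof -
  have spanB: "weyl.span B \<subseteq> I" using B(1) sub by (rule weyl.span_minimal)
  show "A \<inter> B = {}"
  proof (rule ccontr)
    assume "A \<inter> B \<noteq> {}"
    then obtain a where "a \<in> A" "a \<in> B" by blast
    then have "a = 0" using A(3) B(1) weyl.span_base by blast
    with \<open>a \<in> A\<close> A(2) show False using weyl.dependent_zero by blast
  qed
  have "weyl.independent (A' \<union> B)" if "finite A'" "A' \<subseteq> A" for A'
    using that
  proof (induction A')
    case (insert a A')
    have "a \<notin> weyl.span (A' \<union> B)"
    proof
      assume "a \<in> weyl.span (A' \<union> B)"
      then obtain p q where pq: "a = p + q" "p \<in> weyl.span A'" "q \<in> weyl.span B"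
        by (auto simp: weyl.span_Un)
      have "p \<in> weyl.span A" "a \<in> weyl.span A"
        using pq(2) insert.prems weyl.span_mono[of A' A] weyl.span_base by auto
      then have "q \<in> weyl.span A" using pq(1) weyl.span_diff[of a A p] by simp
      then have "q = 0" using A(3) spanB pq(3) by blast
      moreover have "a \<notin> weyl.span A'"
        using weyl.independent_mono[OF A(2) insert.prems] insert.hyps
        by (simp add: weyl.independent_insert)
      ultimately show False using pq by simp
    qed
    then show ?case using insert by (simp add: weyl.independent_insert)
  qed (simp add: B)
  from this[OF A(1) order_refl] show "weyl.independent (A \<union> B)" .
qed

text \<open>Comparison of dimensions in the quotient by \<open>I\<close>, carried out without
  forming it: the corrections \<open>P - r P\<close> lie in \<open>I\<close>, and a basis
  \<open>B\<close> of their span extends \<open>A\<close> to an independent set inside the span of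
  \<open>S \<union> B\<close>. The common summand \<open>card B\<close> then cancels.\<close>

lemma card_independent_mod_le:
  assumes sub: "weyl.subspace I" and A: "finite A" "weyl.independent A" "\<And>P. P \<in> weyl.span A \<Longrightarrow> P \<in> I \<Longrightarrow> P = 0"
    and S: "finite S" "\<And>P. P \<in> A \<Longrightarrow> \<exists>R\<in>weyl.span S. P - R \<in> I"
  shows "card A \<le> card S"
proof -
  from S(2) obtain r where r: "\<And>P. P \<in> A \<Longrightarrow> r P \<in> weyl.span S" "\<And>P. P \<in> A \<Longrightarrow> P - r P \<in> I" by metis
  define Q where "Q = (\<lambda>P. P - r P) ` A"
  have Q: "finite Q" "Q \<subseteq> I" using A(1) r by (auto simp: Q_def)
  obtain B where B: "B \<subseteq> Q" "weyl.independent B" "Q \<subseteq> weyl.span B"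
    by (meson weyl.maximal_independent_subset)
  have finB: "finite B" using B(1) Q(1) by (rule finite_subset)
  note ind = independent_Un_ideal[OF sub A order_trans[OF B(1) Q(2)] B(2)]
  have "A \<union> B \<subseteq> weyl.span (S \<union> B)"
  proof -
    have "P \<in> weyl.span (S \<union> B)" if "P \<in> A" for P
    proof -
      have "r P \<in> weyl.span (S \<union> B)" using r(1)[OF that] weyl.span_mono[of S "S \<union> B"] by blast
      moreover have "P - r P \<in> weyl.span (S \<union> B)"
        using that B(3) weyl.span_mono[of B "S \<union> B"] by (auto simp: Q_def)
      ultimately show ?thesis using weyl.span_add by fastforce
    qed
    then show ?thesis using weyl.span_base by blast
  qed
  then have "card (A \<union> B) \<le> card (S \<union> B)"
    using weyl.independent_span_bound[of "S \<union> B" "A \<union> B"] ind(1) S(1) finB by blast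
  then show ?thesis
    using ind(2) A(1) finB card_Un_le[of S B] by (simp add: card_Un_disjoint)
qed

section \<open>The Hilbert function as the number of standard monomials\<close>

lemma bernstein_filtration_eq:
  "(bernstein_filtration k :: 'v::finite weyl set) = weyl.span (wmon ` {m. deg m \<le> k})"
proof -
  have "{weyl_monom a b | a (b :: 'v \<Rightarrow>\<^sub>0 nat). deg (a, b) \<le> k} = wmon ` {m. deg m \<le> k}"
    unfolding wmon_def image_def by fastforce
  then show ?thesis by (simp add: bernstein_filtration_def deg_def)
qed

lemma bernstein_normal_form:
  assumes I: "left_ideal I" and "P \<in> bernstein_filtration k"
  shows "\<exists>R\<in>weyl.span (wmon ` {m. m \<notin> leads I \<and> deg m \<le> k}). P - R \<in> I"
  using assms(2) unfolding bernstein_filtration_eq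
proof (induction rule: weyl.span_induct_alt)
  case base
  then show ?case
    using weyl.span_zero weyl.subspace_0[OF left_ideal_subspace[OF I]] by (intro bexI[of _ 0]) auto
next
  case (step c x y)
  let ?S = "weyl.span (wmon ` {m. m \<notin> leads I \<and> deg m \<le> k})"
  note sub = left_ideal_subspace[OF I]
  from step obtain m R' where m: "x = wmon m" "deg m \<le> k" and R': "R' \<in> ?S" "y - R' \<in> I" by auto
  obtain R where R: "R \<in> weyl.span (wmon ` {m'. m' \<notin> leads I \<and> deg m' \<le> deg m})" "wmon m - R \<in> I"
    using normal_form[OF I] by blast
  have "R \<in> ?S" using R(1) by (rule weyl.span_mono[THEN subsetD, rotated]) (use m in auto)
  then have "weyl_scale c R + R' \<in> ?S" using R' by (intro weyl.span_add weyl.span_scale)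
  moreover have "weyl_scale c x + y - (weyl_scale c R + R') = weyl_scale c (wmon m - R) + (y - R')"
    by (simp add: m weyl.scale_right_diff_distrib)
  moreover have "weyl_scale c (wmon m - R) + (y - R') \<in> I"
    by (intro weyl.subspace_add[OF sub] weyl.subspace_scale[OF sub] R(2) R'(2))
  ultimately show ?case by (intro bexI[of _ "weyl_scale c R + R'"]) (simp_all only:)
qed

text \<open>The standard monomials of degree at most \<open>k\<close> span a complement of
  \<open>?F \<inter> I\<close> inside the filtration step: normal forms show that the two span
  everything, \<open>span_standard_Int_ideal\<close> that the sum is direct.\<close>

lemma quotient_hilbert_function_eq:
  assumes I: "left_ideal (I :: 'v::finite weyl set)"
  shows "quotient_hilbert_function I k = card {m. m \<notin> leads I \<and> deg m \<le> k}"
proof -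
  let ?F = "bernstein_filtration k :: 'v weyl set"
  define S where "S = wmon ` {m. m \<notin> leads I \<and> deg m \<le> k}"
  have finS: "finite S"
    unfolding S_def by (intro finite_imageI finite_subset[OF _ finite_deg_le[of k]]) auto
  have cardS: "card S = card {m. m \<notin> leads I \<and> deg m \<le> k}"
    unfolding S_def by (rule card_image) (meson inj_wmon inj_on_subset subset_UNIV)
  note sub = left_ideal_subspace[OF I]
  obtain B where B: "B \<subseteq> ?F \<inter> I" "weyl.independent B" "?F \<inter> I \<subseteq> weyl.span B" "card B = weyl.dim (?F \<inter> I)"
    by (rule weyl.basis_exists)
  \<comment> \<open>Finiteness of \<open>B\<close> has to be secured since \<open>card\<close> is 0
    on infinite sets.\<close>
  have "finite B \<and> card B \<le> card (wmon ` {m :: 'v exponents. deg m \<le> k})"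
    by (rule weyl.independent_span_bound[OF _ B(2)])
       (use B(1) finite_deg_le in \<open>auto simp: bernstein_filtration_eq\<close>)
  then have finB: "finite B" by simp
  have S0: "P = 0" if "P \<in> weyl.span S" "P \<in> I" for P
    by (rule span_standard_Int_ideal[OF that(1)[unfolded S_def] _ that(2)]) auto
  have BI: "B \<subseteq> I" using B(1) by blast
  note ind = independent_Un_ideal[OF sub finS independent_wmon[of "{m. m \<notin> leads I \<and> deg m \<le> k}", folded S_def] S0 BI B(2)]
  have SF: "weyl.span S \<subseteq> ?F"
    unfolding S_def bernstein_filtration_eq by (rule weyl.span_mono) auto
  have "?F \<subseteq> weyl.span (S \<union> B)"
  proof
    fix P assume P: "P \<in> ?F"
    then obtain R where R: "R \<in> weyl.span S" "P - R \<in> I"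
      using bernstein_normal_form[OF I] unfolding S_def by blast
    have "P - R \<in> ?F" using P R(1) SF unfolding bernstein_filtration_eq by (blast intro: weyl.span_diff)
    then have "P - R \<in> weyl.span B" using R(2) B(3) by blast
    then have "R + (P - R) \<in> weyl.span (S \<union> B)"
      using R(1) weyl.span_mono[of S "S \<union> B"] weyl.span_mono[of B "S \<union> B"] by (blast intro: weyl.span_add)
    then show "P \<in> weyl.span (S \<union> B)" by simp
  qed
  then have "weyl.dim ?F = card (S \<union> B)"
    using B(1) SF weyl.span_superset[of S] ind(1)
    by (intro weyl.basis_card_eq_dim[symmetric]) auto
  then show ?thesis
    unfolding quotient_hilbert_function_def
    using ind(2) finS finB B(4) cardS by (simp add: card_Un_disjoint)
qed

lemma eventually_poly_quotient_hilbert_function: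
  assumes I: "left_ideal (I :: 'v::finite weyl set)"
  shows "eventually_poly (\<lambda>k. real (quotient_hilbert_function I k))"
proof -
  have "card {m. m \<notin> leads I \<and> deg m \<le> k} =
      card {xs. length xs = 2 * CARD('v) \<and> sum_list xs \<le> k \<and> xs \<notin> exps ` leads I}" for k
  proof (rule bij_betw_same_card)
    show "bij_betw exps {m. m \<notin> leads I \<and> deg m \<le> k}
        {xs. length xs = 2 * CARD('v) \<and> sum_list xs \<le> k \<and> xs \<notin> exps ` leads I}"
      unfolding bij_betw_def
    proof
      show "exps ` {m. m \<notin> leads I \<and> deg m \<le> k} =
          {xs. length xs = 2 * CARD('v) \<and> sum_list xs \<le> k \<and> xs \<notin> exps ` leads I}"
      proof (intro equalityI subsetI)
        fix xs assume "xs \<in> {xs. length xs = 2 * CARD('v) \<and> sum_list xs \<le> k \<and> xs \<notin> exps ` leads I}"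
        moreover from this obtain m :: "'v exponents" where "exps m = xs"
          using exps_surj[of xs] by blast
        ultimately show "xs \<in> exps ` {m. m \<notin> leads I \<and> deg m \<le> k}"
          by (auto simp: sum_list_exps)
      qed (auto simp: sum_list_exps dest: injD[OF inj_exps])
    qed (meson inj_exps inj_on_subset subset_UNIV)
  qed
  then show ?thesis
    using eventually_poly_card_complement_up_closed[OF up_closed_leads[OF I]]
    by (simp add: quotient_hilbert_function_eq[OF I])
qed

section \<open>Upper bound for the Hilbert function\<close>

text \<open>\<open>L\<close> and \<open>R\<close> are the parts of the ordered product before and
  after \<open>u\<close>, so anything that commutes with all the other factors passes through
  them.\<close>

lemma prod_list_update_factor:
  fixes F :: "'w \<Rightarrow> 'r::monoid_mult"
  assumes "distinct ws" "u \<in> set ws"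
  obtains L R where "\<And>X. prod_list (map (F(u := X)) ws) = L * X * R"
    "\<And>Z. (\<And>w. w \<noteq> u \<Longrightarrow> Z * F w = F w * Z) \<Longrightarrow> Z * L = L * Z"
    "\<And>Z. (\<And>w. w \<noteq> u \<Longrightarrow> Z * F w = F w * Z) \<Longrightarrow> Z * R = R * Z"
proof -
  from assms obtain ys zs where ws: "ws = ys @ u # zs" "u \<notin> set ys" "u \<notin> set zs"
    by (metis distinct.simps(2) distinct_append disjoint_insert(1) list.simps(15) split_list)
  have upd: "map (F(u := X)) xs = map F xs" if "u \<notin> set xs" for X xs
    using that by (induction xs) auto
  have comm: "Z * prod_list (map F xs) = prod_list (map F xs) * Z"
    if "u \<notin> set xs" "\<And>w. w \<noteq> u \<Longrightarrow> Z * F w = F w * Z" for Z xs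
    using that(1)
  proof (induction xs)
    case (Cons x xs)
    then have "Z * F x = F x * Z" using that(2) by auto
    with Cons show ?case by (simp add: mult.assoc[symmetric]) (simp add: mult.assoc)
  qed simp
  show thesis
    by (rule that[of "prod_list (map F ys)" "prod_list (map F zs)"])
       (simp_all add: ws upd comm mult.assoc)
qed

text \<open>The scalar \<open>c w\<close> is the commutator of \<open>B w\<close> with
  \<open>A w\<close>. Since \<open>A w * B w\<close> vanishes in the quotient by the left ideal,
  words that contain both members of a pair reduce to pure powers of one of them.\<close>

locale canonical_pairs =
  fixes A B :: "'w::finite \<Rightarrow> 'v::finite weyl" and c :: "'w \<Rightarrow> complex" and I :: "'v weyl set"
  assumes AA: "A v * A w = A w * A v" and BB: "B v * B w = B w * B v"
    and BA: "B v * A w = A w * B v + (if v = w then weyl_const (c v) else 0)"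
    and ideal: "left_ideal I" and AB_in: "A w * B w \<in> I"
begin

lemmas ideal_sub = left_ideal_subspace[OF ideal]

lemma ideal_mult: "Q \<in> I \<Longrightarrow> P * Q \<in> I"
  using ideal by (simp add: left_ideal_def)

text \<open>Leibniz rule for an inner derivation with constant value. At \<open>n = 0\<close> the
  exponent \<open>n - 1\<close> truncates to 0, which is harmless because the coefficient is
  0.\<close>

lemma A_power_B: "B w * A w ^ n = A w ^ n * B w + weyl_scale (of_nat n * c w) (A w ^ (n - 1))"
proof (induction n)
  case (Suc n)
  have "B w * A w ^ Suc n = A w * (B w * A w ^ n) + weyl_scale (c w) (A w ^ n)"
    by (simp add: mult.assoc[symmetric] BA distrib_right weyl_scale_def)
  also have "\<dots> = A w ^ Suc n * B w + (weyl_scale (of_nat n * c w) (A w * A w ^ (n - 1)) + weyl_scale (c w) (A w ^ n))"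
    by (simp add: Suc distrib_left mult_weyl_scale mult.assoc)
  also have "weyl_scale (of_nat n * c w) (A w * A w ^ (n - 1)) = weyl_scale (of_nat n * c w) (A w ^ n)"
    by (cases n) simp_all
  finally have "B w * A w ^ Suc n = A w ^ Suc n * B w + (weyl_scale (of_nat n * c w) (A w ^ n) + weyl_scale (c w) (A w ^ n))" .
  moreover have "of_nat (Suc n) * c w = of_nat n * c w + c w" by (simp add: distrib_right)
  ultimately show ?case by (simp only: weyl.scale_left_distrib diff_Suc_1)
qed simp

lemma B_power_A: "A w * B w ^ n = B w ^ n * A w - weyl_scale (of_nat n * c w) (B w ^ (n - 1))"
proof (induction n)
  case (Suc n)
  have "A w * B w ^ Suc n = B w * (A w * B w ^ n) - weyl_scale (c w) (B w ^ n)"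
    by (simp add: mult.assoc[symmetric] BA distrib_right weyl_scale_def)
  also have "\<dots> = B w ^ Suc n * A w - (weyl_scale (of_nat n * c w) (B w * B w ^ (n - 1)) + weyl_scale (c w) (B w ^ n))"
    by (simp add: Suc right_diff_distrib mult_weyl_scale mult.assoc)
  also have "weyl_scale (of_nat n * c w) (B w * B w ^ (n - 1)) = weyl_scale (of_nat n * c w) (B w ^ n)"
    by (cases n) simp_all
  finally have "A w * B w ^ Suc n = B w ^ Suc n * A w - (weyl_scale (of_nat n * c w) (B w ^ n) + weyl_scale (c w) (B w ^ n))" .
  moreover have "of_nat (Suc n) * c w = of_nat n * c w + c w" by (simp add: distrib_right)
  ultimately show ?case by (simp only: weyl.scale_left_distrib diff_Suc_1)
qed simp

text \<open>A signed exponent encodes the pure powers of a pair. Up to scalars and the ideal,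
  multiplication by \<open>A w\<close> then shifts the exponent by 1 and multiplication by
  \<open>B w\<close> shifts it by -1.\<close>

definition fac :: "'w \<Rightarrow> int \<Rightarrow> 'v weyl" where
  "fac w k = (if 0 \<le> k then A w ^ nat k else B w ^ nat (- k))"

definition basis_elem :: "('w \<Rightarrow> int) \<Rightarrow> 'v weyl" where
  "basis_elem f = prod_list (map (\<lambda>w. fac w (f w)) var_enum)"

text \<open>Only negative exponents need work: there \<open>A w\<close> is moved to the right past
  all but one of the factors \<open>B w\<close>, so that \<open>A w * B w\<close> appears at the
  right end, where a left ideal can absorb it.\<close>

lemma A_fac: "\<exists>G k. A w * fac w i = G * (A w * B w) + weyl_scale k (fac w (i + 1))"
proof (cases "0 \<le> i")
  case True
  then have "A w * fac w i = 0 * (A w * B w) + weyl_scale 1 (fac w (i + 1))"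
    by (simp add: fac_def nat_add_distrib)
  then show ?thesis by blast
next
  case False
  define n where "n = nat (- i - 1)"
  have i: "i = - int (Suc n)" using False by (simp add: n_def)
  have "A w * B w ^ Suc n = (A w * B w ^ n) * B w"
    by (simp add: power_commutes mult.assoc)
  also have "\<dots> = B w ^ n * (A w * B w) - weyl_scale (of_nat n * c w) (B w ^ (n - 1) * B w)"
    by (simp add: B_power_A left_diff_distrib weyl_scale_mult mult.assoc)
  also have "weyl_scale (of_nat n * c w) (B w ^ (n - 1) * B w) = weyl_scale (of_nat n * c w) (B w ^ n)"
    by (cases n) (simp_all add: power_commutes)
  finally have "A w * fac w i = B w ^ n * (A w * B w) + weyl_scale (- (of_nat n * c w)) (fac w (i + 1))"
    by (cases n) (auto simp: fac_def i nat_add_distrib)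
  then show ?thesis by blast
qed

lemma B_fac: "\<exists>G k. B w * fac w i = G * (A w * B w) + weyl_scale k (fac w (i - 1))"
proof (cases "i \<le> 0")
  case True
  define n where "n = nat (- i)"
  have i: "i = - int n" using True by (simp add: n_def)
  have "B w * fac w i = 0 * (A w * B w) + weyl_scale 1 (fac w (i - 1))"
    by (cases n) (auto simp: fac_def i nat_add_distrib)
  then show ?thesis by blast
next
  case False
  define n where "n = nat (i - 1)"
  have i: "i = int (Suc n)" using False by (simp add: n_def)
  have "B w * A w ^ Suc n = A w ^ n * (A w * B w) + weyl_scale (of_nat (Suc n) * c w) (A w ^ n)"
    by (simp only: A_power_B) (simp add: power_commutes mult.assoc[symmetric])
  then have "B w * fac w i = A w ^ n * (A w * B w) + weyl_scale (of_nat (Suc n) * c w) (fac w (i - 1))"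
    by (simp add: fac_def i nat_add_distrib)
  then show ?thesis by blast
qed

lemma commute_power:
  fixes Z Y :: "'v weyl"
  assumes "Z * Y = Y * Z"
  shows "Z * Y ^ n = Y ^ n * Z"
  using power_commuting_commutes[of Y Z n] assms by simp

lemma A_commutes_fac: "w \<noteq> u \<Longrightarrow> A u * fac w k = fac w k * A u"
  using BA[of w u] by (auto simp: fac_def intro!: commute_power AA)

lemma B_commutes_fac: "w \<noteq> u \<Longrightarrow> B u * fac w k = fac w k * B u"
  using BA[of u w] by (auto simp: fac_def intro!: commute_power BB)

text \<open>\<open>Z\<close> passes the factors before \<open>u\<close> and produces
  \<open>A u * B u\<close> at position \<open>u\<close>; this product in turn passes the factors
  after \<open>u\<close>. It ends at the far right, so the left ideal contains the whole
  term.\<close>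

lemma mult_basis_elem:
  assumes Z: "\<And>w k. w \<noteq> u \<Longrightarrow> Z * fac w k = fac w k * Z"
    and fac: "\<exists>G k. Z * fac u (f u) = G * (A u * B u) + weyl_scale k (fac u j)"
  shows "\<exists>k. Z * basis_elem f - weyl_scale k (basis_elem (f(u := j))) \<in> I"
proof -
  let ?F = "\<lambda>w. fac w (f w)"
  obtain L R where LR: "\<And>X. prod_list (map (?F(u := X)) var_enum) = L * X * R"
    "\<And>Z. (\<And>w. w \<noteq> u \<Longrightarrow> Z * ?F w = ?F w * Z) \<Longrightarrow> Z * L = L * Z"
    "\<And>Z. (\<And>w. w \<noteq> u \<Longrightarrow> Z * ?F w = ?F w * Z) \<Longrightarrow> Z * R = R * Z"
    using prod_list_update_factor[of var_enum u ?F] var_enum by blast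
  have be: "basis_elem (f(u := i)) = L * fac u i * R" for i
  proof -
    have "(\<lambda>w. fac w ((f(u := i)) w)) = ?F(u := fac u i)" by auto
    then show ?thesis unfolding basis_elem_def LR(1)[symmetric] by simp
  qed
  obtain G k where Gk: "Z * fac u (f u) = G * (A u * B u) + weyl_scale k (fac u j)"
    using fac by blast
  have ZL: "Z * L = L * Z" by (rule LR(2)) (rule Z)
  have AR: "A u * R = R * A u" by (rule LR(3)) (rule A_commutes_fac)
  have BR: "B u * R = R * B u" by (rule LR(3)) (rule B_commutes_fac)
  have ABR: "A u * B u * R = R * (A u * B u)"
    using AR BR by (metis mult.assoc)
  have "Z * basis_elem f = Z * (L * fac u (f u) * R)"
    using be[of "f u"] by simp
  also have "\<dots> = L * (Z * fac u (f u)) * R"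
    using ZL by (metis mult.assoc)
  also have "\<dots> = L * G * (A u * B u * R) + weyl_scale k (basis_elem (f(u := j)))"
    by (simp add: Gk be distrib_left distrib_right mult_weyl_scale weyl_scale_mult mult.assoc)
  finally have "Z * basis_elem f - weyl_scale k (basis_elem (f(u := j))) = L * G * R * (A u * B u)"
    by (simp add: ABR[unfolded mult.assoc] mult.assoc)
  then show ?thesis using ideal_mult[OF AB_in] by metis
qed

text \<open>Exponents are bounded individually instead of in total; the number of points still has
  the order \<open>k ^ CARD('w)\<close>, which is all that the dimension needs.\<close>

definition cube :: "nat \<Rightarrow> ('w \<Rightarrow> int) set" where
  "cube k = {f. \<forall>w. \<bar>f w\<bar> \<le> int k}"

lemma cube_mono: "k \<le> l \<Longrightarrow> cube k \<subseteq> cube l"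
  by (auto simp: cube_def intro: order_trans[of _ "int k" "int l"])

lemma cube_update:
  assumes "f \<in> cube k" "\<bar>j\<bar> \<le> \<bar>f u\<bar> + 1"
  shows "f(u := j) \<in> cube (Suc k)"
proof -
  have "\<bar>f w\<bar> \<le> int k" for w using assms(1) by (simp add: cube_def)
  moreover from this have "\<bar>f w\<bar> \<le> 1 + int k" for w by (rule order_trans) simp
  ultimately show ?thesis using assms(2) order_trans[of "\<bar>j\<bar>" "\<bar>f u\<bar> + 1" "1 + int k"] by (simp add: cube_def)
qed

definition tspan :: "nat \<Rightarrow> 'v weyl set" where
  "tspan k = {P. \<exists>R\<in>weyl.span (basis_elem ` cube k). P - R \<in> I}"

lemma tspan_I: "P \<in> I \<Longrightarrow> P \<in> tspan k"
  unfolding tspan_def by (auto intro!: bexI[of _ 0] weyl.span_zero)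

lemma tspan_base: "f \<in> cube k \<Longrightarrow> basis_elem f \<in> tspan k"
  unfolding tspan_def using weyl.subspace_0[OF ideal_sub]
  by (auto intro!: bexI[of _ "basis_elem f"] weyl.span_base)

lemma tspan_add:
  assumes "P \<in> tspan k" "Q \<in> tspan k"
  shows "P + Q \<in> tspan k"
proof -
  from assms obtain R S where RS: "R \<in> weyl.span (basis_elem ` cube k)" "P - R \<in> I"
    "S \<in> weyl.span (basis_elem ` cube k)" "Q - S \<in> I" by (auto simp: tspan_def)
  have "P + Q - (R + S) = (P - R) + (Q - S)" by simp
  with RS have "P + Q - (R + S) \<in> I" using weyl.subspace_add[OF ideal_sub] by metis
  with RS show ?thesis unfolding tspan_def by (blast intro: weyl.span_add)
qed

lemma tspan_scale:
  assumes "P \<in> tspan k"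
  shows "weyl_scale a P \<in> tspan k"
proof -
  from assms obtain R where R: "R \<in> weyl.span (basis_elem ` cube k)" "P - R \<in> I"
    by (auto simp: tspan_def)
  have "weyl_scale a P - weyl_scale a R \<in> I"
    using weyl.subspace_scale[OF ideal_sub R(2), of a] by (simp add: weyl.scale_right_diff_distrib)
  with R(1) show ?thesis unfolding tspan_def by (blast intro: weyl.span_scale)
qed

lemma tspan_diff: "P \<in> tspan k \<Longrightarrow> Q \<in> tspan k \<Longrightarrow> P - Q \<in> tspan k"
  using tspan_add[of P k "weyl_scale (- 1) Q"] tspan_scale[of Q k "- 1"] by simp

lemma tspan_zero: "0 \<in> tspan k"
  by (rule tspan_I) (rule weyl.subspace_0[OF ideal_sub])

lemma tspan_sum: "(\<And>i. i \<in> S \<Longrightarrow> P i \<in> tspan k) \<Longrightarrow> sum P S \<in> tspan k"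
  by (induction S rule: infinite_finite_induct) (auto intro: tspan_add tspan_zero)

lemma tspan_mono: "k \<le> l \<Longrightarrow> P \<in> tspan k \<Longrightarrow> P \<in> tspan l"
proof -
  assume "k \<le> l" "P \<in> tspan k"
  moreover from this have "cube k \<subseteq> cube l" by (intro cube_mono)
  ultimately show ?thesis
    unfolding tspan_def using weyl.span_mono[of "basis_elem ` cube k" "basis_elem ` cube l"] by blast
qed

lemma tspan_mult:
  assumes Z: "\<And>f. f \<in> cube k \<Longrightarrow> Z * basis_elem f \<in> tspan l" and P: "P \<in> tspan k"
  shows "Z * P \<in> tspan l"
proof -
  from P obtain R where R: "R \<in> weyl.span (basis_elem ` cube k)" "P - R \<in> I"
    by (auto simp: tspan_def)
  have "Z * R \<in> tspan l"
    using R(1)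
  proof (induction rule: weyl.span_induct_alt)
    case (step a x y)
    then show ?case
      using Z by (auto simp: distrib_left mult_weyl_scale intro!: tspan_add tspan_scale)
  qed (simp add: tspan_zero)
  moreover have "Z * (P - R) \<in> tspan l" by (rule tspan_I[OF ideal_mult[OF R(2)]])
  ultimately have "Z * R + Z * (P - R) \<in> tspan l" by (rule tspan_add)
  then show ?thesis by (simp add: distrib_left[symmetric])
qed

lemma tspan_mod:
  assumes "P - weyl_scale a Q \<in> I" "Q \<in> tspan k"
  shows "P \<in> tspan k"
proof -
  have "(P - weyl_scale a Q) + weyl_scale a Q \<in> tspan k"
    by (rule tspan_add[OF tspan_I[OF assms(1)] tspan_scale[OF assms(2)]])
  then show ?thesis by simp
qed

lemma A_tspan: "P \<in> tspan k \<Longrightarrow> A u * P \<in> tspan (Suc k)"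
proof (rule tspan_mult)
  fix f assume "f \<in> cube k"
  then have "f(u := f u + 1) \<in> cube (Suc k)" by (rule cube_update) simp
  from tspan_base[OF this] show "A u * basis_elem f \<in> tspan (Suc k)"
    using mult_basis_elem[OF A_commutes_fac A_fac] tspan_mod by blast
qed

lemma B_tspan: "P \<in> tspan k \<Longrightarrow> B u * P \<in> tspan (Suc k)"
proof (rule tspan_mult)
  fix f assume "f \<in> cube k"
  then have "f(u := f u - 1) \<in> cube (Suc k)" by (rule cube_update) simp
  from tspan_base[OF this] show "B u * basis_elem f \<in> tspan (Suc k)"
    using mult_basis_elem[OF B_commutes_fac B_fac] tspan_mod by blast
qed

lemma one_tspan: "1 \<in> tspan k"
proof -
  have "basis_elem (\<lambda>_. 0) = 1"
    by (simp add: basis_elem_def fac_def map_replicate_const prod_list_replicate)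
  then show ?thesis using tspan_base[of "\<lambda>_. 0" k] by (simp add: cube_def)
qed

lemma card_cube: "finite (cube k)" "card (cube k) = (2 * k + 1) ^ CARD('w)"
proof -
  have cube: "cube k = (\<Pi>\<^sub>E w\<in>UNIV. {- int k..int k})"
    by (auto simp: cube_def PiE_def Pi_def extensional_def abs_le_iff minus_le_iff)
  show "finite (cube k)" unfolding cube by (rule finite_PiE) auto
  have "nat (int k + int k + 1) = 2 * k + 1" by simp
  then show "card (cube k) = (2 * k + 1) ^ CARD('w)"
    unfolding cube by (simp add: card_PiE)
qed

text \<open>The constant \<open>s\<close> allows for old generators that are polynomials of degree
  at most \<open>s\<close> in the new ones. A monomial of degree \<open>k\<close> then lies in
  \<open>tspan (s * k)\<close>, so the standard monomials are no more numerous than the points of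
  \<open>cube (s * k)\<close>.\<close>

lemma hilbert_function_upper_bound:
  assumes var: "\<And>u P k. P \<in> tspan k \<Longrightarrow> weyl_var u * P \<in> tspan (k + s)"
    and deriv: "\<And>u P k. P \<in> tspan k \<Longrightarrow> weyl_deriv u * P \<in> tspan (k + s)"
  shows "quotient_hilbert_function I k \<le> (2 * (s * k) + 1) ^ CARD('w)"
proof -
  have 0: "wmon (0, b) \<in> tspan (s * deg (0, b))" for b
  proof (induction b rule: exponent_induct)
    case zero
    have "wmon (0, 0) = (1 :: 'v weyl)"
      by (simp add: wmon_def weyl_monom_def map_replicate_const prod_list_replicate)
    then show ?case using one_tspan by simp
  next
    case (add b u)
    have "wmon (0, b + Poly_Mapping.single u 1) = weyl_deriv u * wmon (0, b)"
      by (simp only: wmon_def fst_conv snd_conv weyl_deriv_monom0)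
    then show ?case using deriv[OF add, of u] by (simp only: deg_add_single mult_Suc_right add.commute)
  qed
  have "wmon (a, b) \<in> tspan (s * deg (a, b))" for a b
  proof (induction a rule: exponent_induct)
    case (add a u)
    then show ?case
      using var[OF add, of u] by (simp only: deg_add_single mult_Suc_right add.commute weyl_var_wmon)
  qed (rule 0)
  then have wmon: "wmon m \<in> tspan (s * k)" if "deg m \<le> k" for m
    using that tspan_mono[of "s * deg m" "s * k"] by (cases m) simp
  let ?A = "{m. m \<notin> leads I \<and> deg m \<le> k}"
  have "card (wmon ` ?A) \<le> card (basis_elem ` cube (s * k))"
  proof (rule card_independent_mod_le[OF ideal_sub])
    show "finite (wmon ` ?A)"
      by (intro finite_imageI finite_subset[OF _ finite_deg_le[of k]]) auto
    show "P = 0" if "P \<in> weyl.span (wmon ` ?A)" "P \<in> I" for P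
      by (rule span_standard_Int_ideal[OF that(1) _ that(2)]) auto
    show "\<exists>R\<in>weyl.span (basis_elem ` cube (s * k)). P - R \<in> I" if "P \<in> wmon ` ?A" for P
      using that wmon by (auto simp: tspan_def)
  qed (auto simp: card_cube independent_wmon)
  also have "\<dots> \<le> (2 * (s * k) + 1) ^ CARD('w)"
    using card_image_le[OF card_cube(1)] card_cube(2) by metis
  also have "card (wmon ` ?A) = card ?A"
    by (rule card_image) (meson inj_wmon inj_on_subset subset_UNIV)
  finally show ?thesis by (simp add: quotient_hilbert_function_eq[OF ideal])
qed

end

section \<open>Homomorphisms out of the Weyl algebra and the lower bound\<close>

lemma weyl_coeffs_add: "weyl_coeffs (P + Q) = weyl_coeffs P + weyl_coeffs Q"
  by (metis weyl_coeffs_of_coeffs weyl_of_coeffs_add weyl_of_coeffs_coeffs)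

lemma wmon_0: "wmon (0, 0) = 1"
  by (simp add: wmon_def weyl_monom_def map_replicate_const prod_list_replicate)

lemma span_wmon_UNIV: "P \<in> weyl.span (range wmon)"
proof -
  have "range wmon = (weyl_monoms :: 'a weyl set)" by (auto simp: wmon_def image_def)
  then show ?thesis using weyl_span_monoms by simp
qed

text \<open>\<open>X\<close> and \<open>Y\<close> are intended images of the variables and
  derivatives. As they satisfy the canonical commutation relations, the universal property of the
  Weyl algebra yields a ring homomorphism.\<close>

locale weyl_hom =
  fixes X Y :: "'v::finite \<Rightarrow> 'w::finite weyl"
  assumes XX: "X v * X w = X w * X v" and YY: "Y v * Y w = Y w * Y v"
    and YX: "Y v * X w = X w * Y v + (if v = w then 1 else 0)"
begin

definition mon :: "'v exponents \<Rightarrow> 'w weyl" where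
  "mon m = prod_list (map (\<lambda>v. X v ^ Poly_Mapping.lookup (fst m) v) var_enum) *
     prod_list (map (\<lambda>v. Y v ^ Poly_Mapping.lookup (snd m) v) var_enum)"

text \<open>Linear extension from the basis of normally ordered monomials makes \<open>hom\<close>
  well defined at once; multiplicativity has to be proved afterwards.\<close>

definition hom :: "'v weyl \<Rightarrow> 'w weyl" where
  "hom P = (\<Sum>m\<in>Poly_Mapping.keys (weyl_coeffs P). weyl_scale (Poly_Mapping.lookup (weyl_coeffs P) m) (mon m))"

lemma hom_superset:
  assumes "finite A" "Poly_Mapping.keys (weyl_coeffs P) \<subseteq> A"
  shows "hom P = (\<Sum>m\<in>A. weyl_scale (Poly_Mapping.lookup (weyl_coeffs P) m) (mon m))"
  unfolding hom_def using assms by (intro sum.mono_neutral_left) (auto simp: in_keys_iff)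

lemma hom_add: "hom (P + Q) = hom P + hom Q"
proof -
  let ?A = "Poly_Mapping.keys (weyl_coeffs P) \<union> Poly_Mapping.keys (weyl_coeffs Q)"
  have "Poly_Mapping.keys (weyl_coeffs (P + Q)) \<subseteq> ?A"
    unfolding weyl_coeffs_add by (rule keys_add)
  then show ?thesis
    by (simp add: hom_superset[where A = ?A] sum.distrib[symmetric] weyl_coeffs_add
        lookup_add weyl.scale_left_distrib)
qed

lemma hom_scale_wmon: "hom (weyl_scale c (wmon m)) = weyl_scale c (mon m)"
  using weyl_coeffs_scale_monom_add[of c m 0]
  by (simp add: hom_superset[where A = "{m}"] weyl_coeffs_0)

lemma hom_wmon: "hom (wmon m) = mon m"
  using hom_scale_wmon[of 1 m] by simp

lemma hom_0: "hom 0 = 0"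
  by (simp add: hom_def weyl_coeffs_0)

lemma hom_scale: "hom (weyl_scale k P) = weyl_scale k (hom P)"
  using span_wmon_UNIV[of P]
proof (induction rule: weyl.span_induct_alt)
  case (step c x y)
  then obtain m where "x = wmon m" by blast
  then show ?case
    by (simp only: weyl.scale_right_distrib hom_add step.IH hom_scale_wmon weyl.scale_scale)
qed (simp add: hom_0)

lemma hom_1: "hom 1 = 1"
  using hom_wmon[of "(0, 0)"]
  by (simp add: wmon_0 mon_def map_replicate_const prod_list_replicate)

lemma hom_mult_wmon:
  assumes "\<And>m. hom (P * wmon m) = Z * mon m"
  shows "hom (P * Q) = Z * hom Q"
  using span_wmon_UNIV[of Q]
proof (induction rule: weyl.span_induct_alt)
  case (step c x y)
  then obtain m where "x = wmon m" by blast
  then show ?case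
    by (simp only: distrib_left hom_add step.IH mult_weyl_scale hom_scale assms hom_wmon)
qed (simp add: hom_0)

lemma X_mon: "X u * mon (a, b) = mon (a + Poly_Mapping.single u 1, b)"
  unfolding mon_def mult.assoc[symmetric]
  by (subst commuting_prod_list) (simp_all add: XX var_enum)

lemma Y_mon: "Y u * mon (0, b) = mon (0, b + Poly_Mapping.single u 1)"
  unfolding mon_def
  using commuting_prod_list[of Y var_enum u b, OF YY var_enum(1)]
  by (simp add: map_replicate_const prod_list_replicate var_enum)

lemma hom_var_mult: "hom (weyl_var u * Q) = X u * hom Q"
proof (rule hom_mult_wmon)
  fix m
  show "hom (weyl_var u * wmon m) = X u * mon m"
    by (cases m) (simp only: weyl_var_wmon hom_wmon X_mon)
qed

lemma hom_deriv_mult: "hom (weyl_deriv u * Q) = Y u * hom Q"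
proof (rule hom_mult_wmon)
  fix m :: "'v exponents"
  obtain a b where m: "m = (a, b)" by fastforce
  have "hom (weyl_deriv u * wmon (a, b)) = Y u * mon (a, b)"
  proof (induction a rule: exponent_induct)
    case zero
    have "weyl_deriv u * wmon (0, b) = wmon (0, b + Poly_Mapping.single u 1)"
      by (simp only: wmon_def fst_conv snd_conv weyl_deriv_monom0)
    then show ?case by (simp only: hom_wmon Y_mon)
  next
    case (add a v)
    have "weyl_deriv u * wmon (a + Poly_Mapping.single v 1, b) =
        weyl_var v * (weyl_deriv u * wmon (a, b)) + (if u = v then 1 else 0) * wmon (a, b)"
      unfolding weyl_var_wmon[symmetric]
      by (simp only: mult.assoc[symmetric] weyl_deriv_var distrib_right)
    then have "hom (weyl_deriv u * wmon (a + Poly_Mapping.single v 1, b)) =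
        X v * (Y u * mon (a, b)) + (if u = v then 1 else 0) * mon (a, b)"
      by (simp add: hom_add hom_var_mult add hom_wmon hom_0 del: One_nat_def)
    then show ?case
      unfolding X_mon[symmetric] by (simp only: mult.assoc[symmetric] YX distrib_right)
  qed
  then show "hom (weyl_deriv u * wmon m) = Y u * mon m" by (simp only: m)
qed

lemma hom_var: "hom (weyl_var u) = X u" and hom_deriv: "hom (weyl_deriv u) = Y u"
  using hom_var_mult[of u 1] hom_deriv_mult[of u 1] by (simp_all add: hom_1)

text \<open>It is enough to treat left factors that generate the algebra, because the claim for all
  \<open>Q\<close> is inherited by sums and products of left factors.\<close>

lemma hom_mult: "hom (P * Q) = hom P * hom Q"
proof (induction P arbitrary: Q rule: weyl_induct)
  case (const c)
  have "hom (weyl_const c) = weyl_const c"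
    using hom_scale[of c 1] by (simp add: weyl_scale_def hom_1)
  then show ?case using hom_scale[of c Q] by (simp add: weyl_scale_def)
next
  case (add P1 P2)
  then show ?case by (simp add: distrib_right hom_add)
next
  case (mult P1 P2)
  then show ?case by (simp add: mult.assoc)
qed (simp_all add: hom_var_mult hom_deriv_mult hom_var hom_deriv)

lemma hom_uminus: "hom (- P) = - hom P"
  using hom_scale[of "- 1" P] by simp

lemma hom_diff: "hom (P - Q) = hom P - hom Q"
  using hom_add[of P "- Q"] by (simp add: hom_uminus)

lemma hom_sum: "hom (sum f A) = (\<Sum>x\<in>A. hom (f x))"
  by (induction A rule: infinite_finite_induct) (simp_all add: hom_0 hom_add)

text \<open>Through \<open>hom\<close> the polynomial ring becomes a module over the source algebra;
  the zero set of \<open>eval1\<close> is the annihilator of the polynomial 1 and hence a left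
  ideal.\<close>

definition eval1 :: "'v weyl \<Rightarrow> 'w mpoly" where
  "eval1 P = weyl_op (hom P) 1"

lemma eval1_mult: "eval1 (P * Q) = weyl_op (hom P) (eval1 Q)"
  by (simp add: eval1_def hom_mult times_weyl.rep_eq)

lemma weyl_op_0: "weyl_op R 0 = 0"
  using weyl_ops_add[OF weyl_op, of R 0 0] by simp

lemma left_ideal_eval1: "left_ideal {P. eval1 P = 0}"
  unfolding left_ideal_def
  by (auto simp: eval1_mult weyl_op_0) (auto simp: eval1_def hom_0 hom_add zero_weyl.rep_eq plus_weyl.rep_eq)

lemma eval1_sum_scale: "eval1 (\<Sum>i\<in>A. weyl_scale (c i) (P i)) = (\<Sum>i\<in>A. mconst (c i) * eval1 (P i))"
proof -
  have "weyl_op (weyl_scale a R) p = mconst a * weyl_op R p" for a p and R :: "'w weyl"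
    by (simp add: weyl_scale_def times_weyl.rep_eq weyl_const.rep_eq)
  then show ?thesis
    by (simp add: eval1_def hom_sum hom_scale weyl_op_sum)
qed

end

lemma finite_bounded_exponents:
  "finite {e :: 'v::finite \<Rightarrow>\<^sub>0 nat. \<forall>v. Poly_Mapping.lookup e v \<le> k}"
  "card {e :: 'v::finite \<Rightarrow>\<^sub>0 nat. \<forall>v. Poly_Mapping.lookup e v \<le> k} = (k + 1) ^ CARD('v)"
proof -
  let ?K = "{e :: 'v \<Rightarrow>\<^sub>0 nat. \<forall>v. Poly_Mapping.lookup e v \<le> k}"
  have bij: "bij_betw Poly_Mapping.lookup ?K (\<Pi>\<^sub>E v\<in>UNIV. {..k})"
  proof (rule bij_betwI[where g = Abs_poly_mapping])
    show "Poly_Mapping.lookup \<in> ?K \<rightarrow> (\<Pi>\<^sub>E v\<in>UNIV. {..k})" by auto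
    show "Abs_poly_mapping \<in> (\<Pi>\<^sub>E v\<in>UNIV. {..k}) \<rightarrow> ?K"
      by (auto simp: lookup_Abs_poly_mapping)
  qed (auto simp: lookup_Abs_poly_mapping lookup_inverse)
  have "finite ((\<Pi>\<^sub>E v\<in>UNIV. {..k}) :: ('v \<Rightarrow> nat) set)" by (rule finite_PiE) auto
  then show "finite ?K" using bij_betw_finite[OF bij] by blast
  show "card ?K = (k + 1) ^ CARD('v)"
    using bij_betw_same_card[OF bij] by (simp add: card_PiE)
qed

lemma bernstein_filtration_step:
  assumes "P \<in> bernstein_filtration k"
  shows "weyl_var u * P \<in> bernstein_filtration (Suc k)" "weyl_deriv u * P \<in> bernstein_filtration (Suc k)"
proof -
  let ?S = "weyl.span (wmon ` {m. deg m \<le> Suc k})"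
  show "weyl_var u * P \<in> bernstein_filtration (Suc k)"
    using assms unfolding bernstein_filtration_eq
  proof (rule mult_span_wmon)
    fix m :: "'a exponents" assume "m \<in> {m. deg m \<le> k}"
    then show "weyl_var u * wmon m \<in> ?S"
      by (cases m) (simp del: One_nat_def add: weyl_var_wmon wmon_in_span_iff deg_add_single)
  qed
  show "weyl_deriv u * P \<in> bernstein_filtration (Suc k)"
    using assms unfolding bernstein_filtration_eq
  proof (rule mult_span_wmon)
    fix m :: "'a exponents" assume m: "m \<in> {m. deg m \<le> k}"
    obtain a b where ab: "m = (a, b)" by fastforce
    have "weyl_deriv u * wmon (a, b) - wmon (a, b + Poly_Mapping.single u 1) \<in> ?S"
      using weyl_deriv_wmon[of u a b] by (rule weyl.span_mono[THEN subsetD, rotated]) (use m ab in auto)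
    moreover have "wmon (a, b + Poly_Mapping.single u 1) \<in> ?S"
      using m ab by (simp del: One_nat_def add: wmon_in_span_iff deg_add_single)
    ultimately show "weyl_deriv u * wmon m \<in> ?S"
      unfolding ab using weyl.span_add by fastforce
  qed
qed

text \<open>A quotient by a polynomial of larger degree tends to 0, so an eventually positive
  polynomial cannot be dominated by one of smaller degree. Comparing \<open>p\<close> with each of
  the two bounds excludes smaller and larger degrees.\<close>

lemma degree_eqI:
  fixes p :: "real poly"
  assumes c: "c > 0"
    and lower: "\<forall>\<^sub>F k in sequentially. (real k + 1) ^ N \<le> poly p (real k)"
    and upper: "\<forall>\<^sub>F k in sequentially. poly p (real k) \<le> (c * real k + 1) ^ N"
  shows "p \<noteq> 0" "degree p = N"
proof -
  have *: "\<not> (\<forall>\<^sub>F k in sequentially. 0 < poly r (real k) \<and> poly r (real k) \<le> poly q (real k))" if "degree q < degree r" for q r :: "real poly"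
  proof
    assume ev: "\<forall>\<^sub>F k in sequentially. 0 < poly r (real k) \<and> poly r (real k) \<le> poly q (real k)"
    have "filterlim (\<lambda>k. real k) at_infinity sequentially"
      by (rule tendsto_of_nat)
    from filterlim_compose[OF poly_divide_tendsto_0_at_infinity[OF that] this]
    have "((\<lambda>k. poly q (real k) / poly r (real k)) \<longlongrightarrow> 0) sequentially" .
    moreover have "\<forall>\<^sub>F k in sequentially. 1 \<le> poly q (real k) / poly r (real k)"
      using ev by eventually_elim simp
    ultimately have "(1::real) \<le> 0" by (intro tendsto_lowerbound) auto
    then show False by simp
  qed
  have deg1: "degree ([:1, 1:] ^ N :: real poly) = N" "degree ([:1, c:] ^ N) = N"
    using c by (simp_all add: degree_power_eq)
  have "\<not> degree p < N"
    using *[of p "[:1, 1:] ^ N"] lower by (force simp: deg1 poly_power add.commute elim: eventually_mono)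
  moreover have "\<not> N < degree p"
  proof
    assume "N < degree p"
    moreover have "\<forall>\<^sub>F k in sequentially. 0 < poly p (real k) \<and> poly p (real k) \<le> poly ([:1, c:] ^ N) (real k)"
      using lower upper
    proof eventually_elim
      case (elim k)
      have "0 < (real k + 1) ^ N" by simp
      with elim(1) have "0 < poly p (real k)" by (rule less_le_trans[rotated])
      with elim(2) show ?case by (simp add: poly_power algebra_simps)
    qed
    ultimately show False using *[of "[:1, c:] ^ N" p] deg1 by simp
  qed
  ultimately show "degree p = N" by simp
  show "p \<noteq> 0"
  proof
    assume "p = 0"
    from lower obtain k where "(real k + 1) ^ N \<le> poly p (real k)"
      using eventually_happens'[OF sequentially_bot] by blast
    moreover have "0 < (real k + 1) ^ N" by simp
    ultimately show False using \<open>p = 0\<close> by simp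
  qed
qed

text \<open>\<open>eval1\<close> factors through the quotient by \<open>I\<close>. The elements
  \<open>Z u\<close> have degree 1 and act as multiplication by the variables, so every monomial is
  reached from 1 within the filtration step given by its degree. These independent images bound the
  Hilbert function from below.\<close>

lemma (in weyl_hom) has_bernstein_dimension_CARD:
  fixes I :: "'v weyl set" and Z :: "'w \<Rightarrow> 'v weyl"
  assumes I: "left_ideal I" "\<And>P. P \<in> I \<Longrightarrow> eval1 P = 0"
    and Z: "\<And>u P. eval1 (Z u * P) = mvar u * eval1 P" "\<And>u. \<exists>v. Z u = weyl_var v \<or> Z u = weyl_deriv v"
    and upper: "\<And>k. quotient_hilbert_function I k \<le> (2 * (s * k) + 1) ^ CARD('w)" and "s > 0"
  shows "has_bernstein_dimension I CARD('w)"
proof -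
  let ?n = "CARD('w)"
  have ex: "\<exists>P\<in>bernstein_filtration (\<Sum>v\<in>UNIV. Poly_Mapping.lookup e v). eval1 P = Poly_Mapping.single e 1" for e :: "'w \<Rightarrow>\<^sub>0 nat"
  proof (induction e rule: exponent_induct)
    case zero
    have "1 \<in> bernstein_filtration 0"
      unfolding bernstein_filtration_eq wmon_0[symmetric] wmon_in_span_iff by simp
    moreover have "eval1 1 = Poly_Mapping.single 0 1"
      by (simp add: eval1_def hom_1 one_weyl.rep_eq)
    ultimately show ?case by auto
  next
    case (add e u)
    then obtain P where P: "P \<in> bernstein_filtration (\<Sum>v\<in>UNIV. Poly_Mapping.lookup e v)"
      "eval1 P = Poly_Mapping.single e 1" by blast
    have "(\<Sum>v\<in>UNIV. Poly_Mapping.lookup (e + Poly_Mapping.single u 1) v) = Suc (\<Sum>v\<in>UNIV. Poly_Mapping.lookup e v)"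
      by (simp add: lookup_add sum.distrib lookup_single when_def)
    moreover have "Z u * P \<in> bernstein_filtration (Suc (\<Sum>v\<in>UNIV. Poly_Mapping.lookup e v))"
      using Z(2)[of u] bernstein_filtration_step[OF P(1)] by auto
    moreover have "eval1 (Z u * P) = Poly_Mapping.single (e + Poly_Mapping.single u 1) 1"
      by (simp add: Z(1) P(2) mvar_def mult_single add.commute)
    ultimately show ?case by metis
  qed
  then obtain T where T: "\<And>e. T e \<in> bernstein_filtration (\<Sum>v\<in>UNIV. Poly_Mapping.lookup e v)"
    "\<And>e. eval1 (T e) = Poly_Mapping.single e 1" by metis
  have injT: "inj T"
  proof (rule injI)
    fix e e' assume "T e = T e'"
    then have "Poly_Mapping.single e (1::complex) = Poly_Mapping.single e' 1" using T(2) by metis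
    then show "e = e'" by (metis lookup_single_eq lookup_single_not_eq zero_neq_one)
  qed
  \<comment> \<open>Applying \<open>eval1\<close> turns a linear combination of the
    \<open>T e\<close> into a polynomial whose coefficients are the \<open>c e\<close>.\<close>
  have zero: "\<forall>e\<in>K. c e = 0"
    if "finite K" "eval1 (\<Sum>e\<in>K. weyl_scale (c e) (T e)) = 0" for K c
  proof
    fix e assume "e \<in> K"
    have "0 = Poly_Mapping.lookup (\<Sum>e\<in>K. mconst (c e) * Poly_Mapping.single e 1) e"
      using that(2) by (simp add: eval1_sum_scale T(2))
    also have "\<dots> = (\<Sum>e'\<in>K. c e' when e' = e)"
      by (simp add: lookup_sum lookup_mconst_mult lookup_single)
         (rule sum.cong, auto simp: when_def)
    also have "\<dots> = c e" using \<open>e \<in> K\<close> that(1) by (simp add: when_def)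
    finally show "c e = 0" by simp
  qed
  \<comment> \<open>Exponents bounded by \<open>k\<close> in each variable give total degree at most
    \<open>?n * k\<close>, hence the index of the filtration.\<close>
  have lower: "(k + 1) ^ ?n \<le> quotient_hilbert_function I (?n * k)" for k
  proof -
    define K where "K = {e :: 'w \<Rightarrow>\<^sub>0 nat. \<forall>v. Poly_Mapping.lookup e v \<le> k}"
    have finK: "finite K" unfolding K_def by (rule finite_bounded_exponents)
    have injK: "inj_on T K" using injT by (rule inj_on_subset) simp
    have span0: "P = 0" if "P \<in> weyl.span (T ` K)" "P \<in> I" for P
    proof -
      from that(1) finK obtain d where "P = (\<Sum>x\<in>T ` K. weyl_scale (d x) x)"
        by (auto simp: weyl.span_finite)
      then have P: "P = (\<Sum>e\<in>K. weyl_scale (d (T e)) (T e))"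
        by (simp add: sum.reindex[OF injK])
      then have "\<forall>e\<in>K. d (T e) = 0" using zero[OF finK] I(2)[OF that(2)] by metis
      then show ?thesis by (simp add: P)
    qed
    have ind: "weyl.independent (T ` K)"
    proof
      assume "weyl.dependent (T ` K)"
      then obtain d where d: "\<exists>x\<in>T ` K. d x \<noteq> 0" "(\<Sum>x\<in>T ` K. weyl_scale (d x) x) = 0"
        using finK by (auto simp: weyl.dependent_finite)
      then have "(\<Sum>e\<in>K. weyl_scale (d (T e)) (T e)) = 0"
        using d(2) by (simp add: sum.reindex[OF injK])
      then have "\<forall>e\<in>K. d (T e) = 0"
        using zero[OF finK, of "\<lambda>e. d (T e)"] by (simp add: eval1_def hom_0 zero_weyl.rep_eq)
      with d(1) show False by auto
    qed
    let ?S = "{m. m \<notin> leads I \<and> deg m \<le> ?n * k}"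
    have "card (T ` K) \<le> card (wmon ` ?S)"
    proof (rule card_independent_mod_le[OF left_ideal_subspace[OF I(1)] _ ind span0])
      show "finite (wmon ` ?S)"
        by (intro finite_imageI finite_subset[OF _ finite_deg_le[of "?n * k"]]) auto
      fix P assume "P \<in> T ` K"
      then obtain e where e: "P = T e" "e \<in> K" by blast
      have "(\<Sum>v\<in>UNIV. Poly_Mapping.lookup e v) \<le> ?n * k"
        using sum_bounded_above[of UNIV "Poly_Mapping.lookup e" k] e(2) by (simp add: K_def)
      then have "(bernstein_filtration (\<Sum>v\<in>UNIV. Poly_Mapping.lookup e v) :: 'v weyl set) \<subseteq> bernstein_filtration (?n * k)"
        unfolding bernstein_filtration_eq by (intro weyl.span_mono image_mono) auto
      then show "\<exists>R\<in>weyl.span (wmon ` ?S). P - R \<in> I"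
        using bernstein_normal_form[OF I(1), of P "?n * k"] T(1)[of e] e(1) by blast
    qed (auto simp: finK)
    moreover have "card (T ` K) = (k + 1) ^ ?n"
      using card_image[OF injK] by (simp add: K_def finite_bounded_exponents)
    moreover have "card (wmon ` ?S) = card ?S"
      by (rule card_image) (meson inj_wmon inj_on_subset subset_UNIV)
    ultimately show ?thesis by (simp add: quotient_hilbert_function_eq[OF I(1)])
  qed
  obtain p where p: "\<forall>\<^sub>F k in sequentially. real (quotient_hilbert_function I k) = poly p (real k)"
    using eventually_poly_quotient_hilbert_function[OF I(1)] by (auto simp: eventually_poly_def)
  \<comment> \<open>The lower bound is available only along multiples of \<open>?n\<close>;
    composing with this linear polynomial keeps the degree and allows a comparison at every
    \<open>k\<close>.\<close>
  define q where "q = pcompose p [:0, real ?n:]"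
  have "filterlim (\<lambda>k. ?n * k) sequentially sequentially"
    by (rule filterlim_subseq) (simp add: strict_mono_def)
  with p have "\<forall>\<^sub>F k in sequentially. real (quotient_hilbert_function I (?n * k)) = poly p (real (?n * k))"
    unfolding filterlim_iff by blast
  then have q: "\<forall>\<^sub>F k in sequentially. poly q (real k) = real (quotient_hilbert_function I (?n * k))"
    by eventually_elim (simp add: q_def poly_pcompose mult.commute)
  have "q \<noteq> 0 \<and> degree q = ?n"
  proof (intro conjI)
    have 1: "\<forall>\<^sub>F k in sequentially. (real k + 1) ^ ?n \<le> poly q (real k)"
      using q
    proof eventually_elim
      case (elim k)
      have "real ((k + 1) ^ ?n) \<le> real (quotient_hilbert_function I (?n * k))"
        using lower by (simp only: of_nat_le_iff)
      then show ?case using elim by (simp add: add.commute)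
    qed
    have 2: "\<forall>\<^sub>F k in sequentially. poly q (real k) \<le> (real (2 * s * ?n) * real k + 1) ^ ?n"
      using q
    proof eventually_elim
      case (elim k)
      have "real (quotient_hilbert_function I (?n * k)) \<le> real ((2 * (s * (?n * k)) + 1) ^ ?n)"
        using upper by (simp only: of_nat_le_iff)
      then show ?case using elim by (simp add: algebra_simps)
    qed
    show "q \<noteq> 0" "degree q = ?n"
      by (rule degree_eqI[OF _ 1 2]; use \<open>s > 0\<close> in simp)+
  qed
  then have "p \<noteq> 0" "degree p = ?n"
    by (auto simp: q_def degree_pcompose)
  with p show ?thesis unfolding has_bernstein_dimension_def by blast
qed

section \<open>The ideal of the orthant integral\<close>

text \<open>With commutators the relations below become computations by the derivation rules
  collected in \<open>comm_simps\<close>.\<close>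

definition comm :: "'v weyl \<Rightarrow> 'v weyl \<Rightarrow> 'v weyl" where
  "comm P Q = P * Q - Q * P"

lemma comm_add: "comm (P + Q) R = comm P R + comm Q R" "comm P (Q + R) = comm P Q + comm P R"
  by (simp_all add: comm_def algebra_simps)

lemma comm_diff: "comm (P - Q) R = comm P R - comm Q R" "comm P (Q - R) = comm P Q - comm P R"
  by (simp_all add: comm_def algebra_simps)

lemma comm_uminus: "comm (- P) R = - comm P R" "comm P (- R) = - comm P R"
  by (simp_all add: comm_def)

lemma comm_mult: "comm (P * Q) R = P * comm Q R + comm P R * Q" "comm P (Q * R) = comm P Q * R + Q * comm P R"
  by (simp_all add: comm_def algebra_simps)

lemma comm_scale: "comm (weyl_scale c P) Q = weyl_scale c (comm P Q)" "comm P (weyl_scale c Q) = weyl_scale c (comm P Q)"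
  by (simp_all add: comm_def weyl_scale_mult mult_weyl_scale weyl.scale_right_diff_distrib)

lemma comm_0: "comm 0 P = 0" "comm P 0 = 0"
  by (simp_all add: comm_def)

lemma comm_1: "comm 1 P = 0" "comm P 1 = 0"
  by (simp_all add: comm_def)

lemma comm_sum: "comm (sum f A) P = (\<Sum>x\<in>A. comm (f x) P)" "comm P (sum f A) = (\<Sum>x\<in>A. comm P (f x))"
  by (simp_all add: comm_def sum_distrib_left sum_distrib_right sum_subtractf)

lemma comm_swap: "comm P Q = - comm Q P"
  by (simp add: comm_def)

lemma comm_var: "comm (weyl_var v) (weyl_var w) = 0"
  by (simp add: comm_def weyl_var_commute)

lemma comm_deriv: "comm (weyl_deriv v) (weyl_deriv w) = 0"
  by (simp add: comm_def weyl_deriv_commute)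

lemma comm_deriv_var:
  "comm (weyl_deriv v) (weyl_var w) = (if v = w then 1 else 0)"
  "comm (weyl_var w) (weyl_deriv v) = (if v = w then - 1 else 0)"
  by (simp_all add: comm_def weyl_deriv_var)

lemma comm_if: "comm (if b then P else Q) R = (if b then comm P R else comm Q R)"
  "comm R (if b then P else Q) = (if b then comm R P else comm R Q)"
  by simp_all

lemmas comm_simps = comm_add comm_diff comm_uminus comm_mult comm_scale comm_0 comm_1 comm_sum
  comm_var comm_deriv comm_deriv_var

lemma sum_if_const: "(\<Sum>k\<in>A. if b then f k else 0) = (if b then \<Sum>k\<in>A. f k else 0)"
  by simp

text \<open>This is the coefficient of the coordinate x_v in the sum of x_jk Z_j Z_k over all
  ordered pairs. Both orders of an off-diagonal pair count, which is the source of the factor 2 for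
  \<open>i \<noteq> j\<close>.\<close>

definition quad :: "('n::finite \<Rightarrow> 'r::semiring_0) \<Rightarrow> 'n uprod \<Rightarrow> 'r" where
  "quad Z v = (\<Sum>j\<in>UNIV. \<Sum>k\<in>UNIV. if Upair j k = v then Z j * Z k else 0)"

lemma quad_Upair:
  "quad Z (Upair i j) = (if i = j then Z i * Z i else Z i * Z j + Z j * Z i)"
proof (cases "i = j")
  case True
  have "quad Z (Upair i i) = (\<Sum>k\<in>UNIV. \<Sum>l\<in>UNIV. if k = i then if l = i then Z i * Z i else 0 else 0)"
    unfolding quad_def by (intro sum.cong) auto
  then show ?thesis using True by (simp add: sum.delta sum_if_const)
next
  case False
  have "quad Z (Upair i j) = (\<Sum>k\<in>UNIV. \<Sum>l\<in>UNIV.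
      (if k = i then if l = j then Z i * Z j else 0 else 0) + (if k = j then if l = i then Z j * Z i else 0 else 0))"
    unfolding quad_def using False by (intro sum.cong) auto
  then show ?thesis using False by (simp add: sum.distrib sum.delta sum_if_const)
qed

text \<open>
  For \<open>Z = \<partial>\<^sub>y\<close>, \<open>W = y\<close>, \<open>s = 1\<close> the operators below are the \<open>D\<^sub>i\<close> and \<open>E\<^sub>v\<close> in the generators of the
  ideal; for \<open>Z = y\<close>, \<open>W = - \<partial>\<^sub>y\<close>, \<open>s = - 1\<close> they are the images of \<open>y\<^sub>i\<close> and \<open>\<partial>\<^sub>x\<^sub>v\<close> under the
  endomorphism that sends \<open>\<partial>\<^sub>y\<^sub>i\<close> to \<open>y\<^sub>i\<close>, the \<open>D\<^sub>i\<close> to \<open>- \<partial>\<^sub>y\<^sub>i\<close> and the \<open>E\<^sub>v\<close> to \<open>\<partial>\<^sub>x\<^sub>v\<close>.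
\<close>

locale twisted_pairs =
  fixes Z W :: "'n::finite \<Rightarrow> 'n coord weyl" and s :: complex
  assumes ZZ: "comm (Z i) (Z j) = 0" and WW: "comm (W i) (W j) = 0"
    and ZW: "comm (Z i) (W j) = (if i = j then 1 else 0)"
    and xZ: "comm (weyl_var (Inl v)) (Z i) = 0" and xW: "comm (weyl_var (Inl v)) (W i) = 0"
    and dZ: "comm (weyl_deriv (Inl v)) (Z i) = 0" and dW: "comm (weyl_deriv (Inl v)) (W i) = 0"
begin

lemma swapped: "comm (W i) (Z j) = (if i = j then - 1 else 0)"
  "comm (Z i) (weyl_var (Inl v)) = 0" "comm (W i) (weyl_var (Inl v)) = 0"
  "comm (Z i) (weyl_deriv (Inl v)) = 0" "comm (W i) (weyl_deriv (Inl v)) = 0"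
  using ZW[of j i] xZ[of v i] xW[of v i] dZ[of v i] dW[of v i] comm_swap[of "W i" "Z j"]
    comm_swap[of "Z i" "weyl_var (Inl v)"] comm_swap[of "W i" "weyl_var (Inl v)"]
    comm_swap[of "Z i" "weyl_deriv (Inl v)"] comm_swap[of "W i" "weyl_deriv (Inl v)"]
  by auto

definition D :: "'n \<Rightarrow> 'n coord weyl" where
  "D i = W i + weyl_scale (2 * s) (\<Sum>k\<in>UNIV. x_var i k * Z k)"

definition E :: "'n uprod \<Rightarrow> 'n coord weyl" where
  "E v = weyl_deriv (Inl v) - weyl_scale s (quad Z v)"

lemmas rules = comm_simps ZZ WW ZW xZ xW dZ dW swapped

lemma comm_quad:
  assumes "\<And>j. comm (Z j) P = 0"
  shows "comm (quad Z v) P = 0" "comm P (quad Z v) = 0"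
proof -
  show "comm (quad Z v) P = 0"
    by (simp add: quad_def comm_sum comm_if comm_mult comm_0 assms cong: if_cong)
  then show "comm P (quad Z v) = 0" by (subst comm_swap) simp
qed

lemma comm_quad_W: "comm (quad Z v) (W i) = weyl_scale 2 (\<Sum>k\<in>UNIV. if Upair i k = v then Z k else 0)"
proof -
  have "comm (quad Z v) (W i) = (\<Sum>j\<in>UNIV. \<Sum>k\<in>UNIV.
      (if k = i then if Upair j i = v then Z j else 0 else 0) + (if j = i then if Upair i k = v then Z k else 0 else 0))"
    unfolding quad_def comm_sum by (intro sum.cong) (auto simp: rules)
  also have "\<dots> = (\<Sum>j\<in>UNIV. if Upair j i = v then Z j else 0) + (\<Sum>k\<in>UNIV. if Upair i k = v then Z k else 0)"
    by (simp add: sum.distrib sum.delta sum_if_const)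
  also have "(\<Sum>j\<in>UNIV. if Upair j i = v then Z j else 0) = (\<Sum>k\<in>UNIV. if Upair i k = v then Z k else 0)"
    by (intro sum.cong) auto
  finally show ?thesis
    using weyl.scale_left_distrib[of 1 1 "\<Sum>k\<in>UNIV. if Upair i k = v then Z k else 0"] by simp
qed

lemma comm_Z_D: "comm (Z j) (D i) = (if i = j then 1 else 0)" "comm (D i) (Z j) = (if i = j then - 1 else 0)"
  by (auto simp: D_def rules)

lemma comm_x_D: "comm (weyl_var (Inl v)) (D i) = 0" "comm (D i) (weyl_var (Inl v)) = 0"
  by (auto simp: D_def rules)

text \<open>The two cross terms are \<open>2 * s\<close> times \<open>- x_var j i\<close> and
  \<open>x_var i j\<close>, which cancel because the matrix of coordinates is symmetric.\<close>

lemma comm_D_D: "comm (D i) (D j) = 0"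
proof -
  have "comm (D i) (D j) = weyl_scale (2 * s) (\<Sum>k\<in>UNIV. if i = k then - x_var j k else 0) +
      weyl_scale (2 * s) (\<Sum>k\<in>UNIV. if k = j then x_var i k else 0)"
    by (simp add: D_def rules if_distrib[where f = "\<lambda>P. _ * P"] cong: if_cong)
  also have "\<dots> = 0"
    using arg_cong[of "Upair j i" "Upair i j" "\<lambda>v. weyl_var (Inl v) :: 'n coord weyl"] by (simp add: weyl.scale_minus_right)
  finally show ?thesis .
qed

lemma comm_E_Z: "comm (E v) (Z j) = 0" "comm (Z j) (E v) = 0"
  by (simp_all add: E_def comm_simps comm_quad rules)

lemma comm_E_x: "comm (E v) (weyl_var (Inl w)) = (if v = w then 1 else 0)"
  "comm (weyl_var (Inl w)) (E v) = (if v = w then - 1 else 0)"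
  by (simp_all add: E_def comm_simps comm_quad swapped)

lemma comm_E_E: "comm (E v) (E w) = 0"
  by (simp add: E_def comm_simps comm_quad rules)

text \<open>Differentiating the coefficients \<open>x_var i k\<close> in \<open>D i\<close>
  contributes \<open>2 * s\<close> times the matching \<open>Z k\<close>, exactly what the
  commutator of \<open>weyl_scale s (quad Z v)\<close> with \<open>W i\<close> subtracts.\<close>

lemma comm_E_D: "comm (E v) (D i) = 0" "comm (D i) (E v) = 0"
proof -
  have "comm (E v) (D i) = weyl_scale (2 * s) (\<Sum>k\<in>UNIV. if v = Upair i k then Z k else 0) - weyl_scale s (comm (quad Z v) (W i))"
    by (simp add: E_def D_def comm_simps rules comm_quad if_distrib[where f = "\<lambda>P. P * _"] cong: if_cong)
  also have "\<dots> = 0"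
    by (simp add: comm_quad_W eq_commute mult.commute)
  finally show "comm (E v) (D i) = 0" .
  then show "comm (D i) (E v) = 0" by (subst comm_swap) simp
qed

end

section \<open>The orthant ideal in canonical generators\<close>

interpretation op: twisted_pairs dy y_var 1
  by standard (auto simp: comm_simps)

interpretation tw: twisted_pairs y_var "\<lambda>i. - dy i" "- 1"
  by standard (auto simp: comm_simps)

definition orthant_ideal :: "('n::finite) coord weyl set" where
  "orthant_ideal = left_ideal hull orthant_operators"

lemma left_ideal_orthant_ideal: "left_ideal orthant_ideal"
  unfolding orthant_ideal_def by (rule hull_in) (auto simp: left_ideal_def)

text \<open>The summand 1 in the first family is the commutator that arises when
  \<open>dy i * y_var i\<close> is put in normal order; the constants 2 and 1 in front of the second
  derivatives come from \<open>quad_Upair\<close>.\<close>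

lemma orthant_operators_eq:
  "orthant_operators = (\<lambda>i. dy i * op.D i) ` UNIV \<union> (range op.E :: 'n::finite coord weyl set)"
proof -
  have y: "dy i * op.D i = 2 * (\<Sum>k\<in>UNIV. x_var i k * dy i * dy k) + y_var i * dy i + 1" for i :: 'n
  proof -
    have "weyl_scale 2 P = 2 * P" for P :: "'n coord weyl"
      using weyl.scale_left_distrib[of 1 1 P] by (simp add: mult_2)
    moreover have "dy i * (x_var i k * dy k) = x_var i k * dy i * dy k" for k
      using weyl_deriv_var[of "Inr i" "Inl (Upair i k)"] by (simp add: mult.assoc[symmetric])
    ultimately have *: "weyl_scale 2 (\<Sum>k\<in>UNIV. dy i * (x_var i k * dy k)) = 2 * (\<Sum>k\<in>UNIV. x_var i k * dy i * dy k)"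
      by simp
    have "dy i * op.D i = dy i * y_var i + weyl_scale 2 (\<Sum>k\<in>UNIV. dy i * (x_var i k * dy k))"
      by (simp add: op.D_def distrib_left mult_weyl_scale sum_distrib_left)
    then show ?thesis
      unfolding * by (simp add: weyl_deriv_var)
  qed
  have E: "op.E (Upair i j) = (if i = j then dx i i - dy i ^ 2 else dx i j - 2 * dy i * dy j)" for i j :: 'n
    using weyl_deriv_commute[of "Inr i :: 'n coord" "Inr j"]
    by (simp add: op.E_def quad_Upair power2_eq_square mult_2 distrib_right)
  have "range op.E = {dx i j - 2 * dy i * dy j | i j. i \<noteq> j} \<union> {dx i i - dy i ^ 2 | i :: 'n. True}"
  proof (intro equalityI subsetI)
    fix P assume "P \<in> (range op.E :: 'n coord weyl set)"
    then obtain v where "P = op.E v" by blast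
    then show "P \<in> {dx i j - 2 * dy i * dy j | i j. i \<noteq> j} \<union> {dx i i - dy i ^ 2 | i. True}"
      by (cases v) (auto simp: E)
  next
    fix P assume "P \<in> {dx i j - 2 * dy i * dy j | i j. i \<noteq> j} \<union> {dx i i - dy i ^ 2 | i :: 'n. True}"
    then have "\<exists>i j. P = op.E (Upair i j)" unfolding E by fastforce
    then show "P \<in> range op.E" by blast
  qed
  then show ?thesis
    unfolding orthant_operators_def y by auto
qed

lemma orthant_ideal_gens:
  "dy i * op.D i \<in> orthant_ideal" "op.E v \<in> orthant_ideal"
  using hull_subset[of orthant_operators left_ideal]
  unfolding orthant_ideal_def orthant_operators_eq by auto

lemma comm_imp_commute: "comm P Q = R \<Longrightarrow> P * Q = Q * P + R"
  by (auto simp: comm_def)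

text \<open>The constant is 1 for the pairs of an x-coordinate with \<open>op.E v\<close>, and -1
  for the pairs of \<open>dy i\<close> with \<open>op.D i\<close>, where the derivative is the first
  member. The product required to lie in the ideal is a generator or a left multiple of one.\<close>

interpretation normal: canonical_pairs
  "case_sum (\<lambda>v. weyl_var (Inl v)) dy :: 'n::finite coord \<Rightarrow> 'n coord weyl" "case_sum op.E op.D" "case_sum (\<lambda>_. 1) (\<lambda>_. - 1)" orthant_ideal
proof
  fix v w :: "'n coord"
  let ?A = "case_sum (\<lambda>v. weyl_var (Inl v)) dy :: 'n coord \<Rightarrow> 'n coord weyl"
  let ?B = "case_sum op.E op.D :: 'n coord \<Rightarrow> 'n coord weyl"
  have "comm (?A v) (?A w) = 0"
    by (cases v; cases w) (auto simp: comm_simps)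
  then show "?A v * ?A w = ?A w * ?A v" by (simp add: comm_def)
  have "comm (?B v) (?B w) = 0"
    by (cases v; cases w) (auto simp: op.comm_E_E op.comm_E_D op.comm_D_D)
  then show "?B v * ?B w = ?B w * ?B v" by (simp add: comm_def)
  have m1: "weyl_const (- 1) = (- 1 :: 'n coord weyl)"
    using weyl_const_simps(3)[of 1 "- 1"] by (simp add: weyl_const_simps eq_neg_iff_add_eq_0 add.commute)
  show "?B v * ?A w = ?A w * ?B v + (if v = w then weyl_const (case_sum (\<lambda>_. 1) (\<lambda>_. - 1) v) else 0)"
    by (rule comm_imp_commute; cases v; cases w)
       (auto simp: op.comm_E_x op.comm_E_Z op.comm_x_D op.comm_Z_D weyl_const_simps m1)
  show "left_ideal (orthant_ideal :: 'n coord weyl set)" by (rule left_ideal_orthant_ideal)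
  then have "P * Q \<in> orthant_ideal" if "Q \<in> orthant_ideal" for P Q :: "'n coord weyl"
    using that by (simp add: left_ideal_def)
  then show "?A w * ?B w \<in> orthant_ideal"
    by (cases w) (auto intro: orthant_ideal_gens)
qed

text \<open>Here \<open>dy i\<close> goes to multiplication by \<open>y_var i\<close>, as under the
  Fourier transform, while \<open>tw.D\<close> and \<open>tw.E\<close> carry the corrections from
  conjugating with the exponential of the quadratic form.\<close>

interpretation twist: weyl_hom
  "case_sum (\<lambda>v. weyl_var (Inl v)) tw.D :: 'n::finite coord \<Rightarrow> 'n coord weyl" "case_sum tw.E y_var"
proof
  fix v w :: "'n coord"
  let ?X = "case_sum (\<lambda>v. weyl_var (Inl v)) tw.D :: 'n coord \<Rightarrow> 'n coord weyl"
  let ?Y = "case_sum tw.E y_var :: 'n coord \<Rightarrow> 'n coord weyl"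
  have "comm (?X v) (?X w) = 0"
    by (cases v; cases w) (auto simp: comm_simps tw.comm_x_D tw.comm_D_D)
  then show "?X v * ?X w = ?X w * ?X v" by (simp add: comm_def)
  have "comm (?Y v) (?Y w) = 0"
    by (cases v; cases w) (auto simp: comm_simps tw.comm_E_E tw.comm_E_Z)
  then show "?Y v * ?Y w = ?Y w * ?Y v" by (simp add: comm_def)
  show "?Y v * ?X w = ?X w * ?Y v + (if v = w then 1 else 0)"
    by (rule comm_imp_commute; cases v; cases w)
       (auto simp: comm_simps tw.comm_E_x tw.comm_E_D tw.comm_Z_D)
qed

text \<open>Under the twist the quadratic corrections of opposite sign cancel, so
  \<open>op.E v\<close> becomes a pure derivative and \<open>op.D i\<close> becomes
  \<open>- dy i\<close>; both kill the polynomial 1.\<close>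

lemma eval1_orthant_operators:
  assumes "P \<in> (orthant_operators :: 'n::finite coord weyl set)"
  shows "twist.eval1 P = 0"
proof -
  have hom_quad: "twist.hom (quad dy v) = quad y_var v" for v :: "'n uprod"
    unfolding quad_def by (simp add: twist.hom_sum if_distrib[where f = twist.hom] twist.hom_mult twist.hom_deriv twist.hom_0 cong: if_cong)
  have mdiff_1: "mdiff u 1 = 0" for u :: "'n coord"
  proof (rule poly_mapping_eqI)
    fix m :: "'n coord \<Rightarrow>\<^sub>0 nat"
    have "Poly_Mapping.lookup (m + Poly_Mapping.single u 1) u \<noteq> 0" by (simp add: lookup_add)
    then have "m + Poly_Mapping.single u 1 \<noteq> 0" by (metis lookup_zero)
    then show "Poly_Mapping.lookup (mdiff u 1) m = Poly_Mapping.lookup 0 m"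
      by (simp add: mdiff.rep_eq lookup_one)
  qed
  have "twist.hom (op.E v) = weyl_deriv (Inl v)" for v :: "'n uprod"
    by (simp add: op.E_def tw.E_def twist.hom_diff twist.hom_deriv hom_quad)
  then have "twist.eval1 (op.E v) = 0" for v :: "'n uprod"
    by (simp add: twist.eval1_def weyl_deriv.rep_eq mdiff_1)
  moreover have "twist.hom (op.D i) = - dy i" for i :: 'n
    by (simp add: op.D_def tw.D_def twist.hom_add twist.hom_scale twist.hom_sum twist.hom_mult twist.hom_var twist.hom_deriv
        weyl.scale_minus_left)
  then have "twist.eval1 (op.D i) = 0" for i :: 'n
    by (simp add: twist.eval1_def uminus_weyl.rep_eq weyl_deriv.rep_eq mdiff_1)
  then have "twist.eval1 (dy i * op.D i) = 0" for i :: 'n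
    by (simp add: twist.eval1_mult twist.weyl_op_0)
  ultimately show ?thesis
    using assms unfolding orthant_operators_eq by auto
qed

text \<open>Both \<open>y_var i\<close> and the derivatives in the x-coordinates are at most
  quadratic in the canonical generators, so the upper bound applies with \<open>s = 2\<close>.
  Through the twist, the x-variables and the \<open>dy i\<close> act as multiplication by the
  coordinates, which gives the matching lower bound.\<close>

theorem holonomic_orthant_ideal: "holonomic_ideal (orthant_ideal :: 'n::finite coord weyl set)"
proof -
  let ?I = "orthant_ideal :: 'n coord weyl set"
  have eval: "twist.eval1 P = 0" if "P \<in> ?I" for P
    using hull_minimal[of orthant_operators "{P :: 'n coord weyl. twist.eval1 P = 0}" left_ideal]
      eval1_orthant_operators twist.left_ideal_eval1 that unfolding orthant_ideal_def by blast
  have y: "y_var i = op.D i - weyl_scale 2 (\<Sum>k\<in>UNIV. x_var i k * dy k)" for i :: 'n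
    by (simp add: op.D_def)
  have d: "weyl_deriv (Inl v) = op.E v + quad dy v" for v :: "'n uprod"
    by (simp add: op.E_def)
  have A: "weyl_var (Inl v) * P \<in> normal.tspan (Suc k)" "dy i * P \<in> normal.tspan (Suc k)"
    if "P \<in> normal.tspan k" for P k and v :: "'n uprod" and i :: 'n
    using normal.A_tspan[OF that, of "Inl v"] normal.A_tspan[OF that, of "Inr i"] by simp_all
  have B: "op.E v * P \<in> normal.tspan (Suc k)" "op.D i * P \<in> normal.tspan (Suc k)"
    if "P \<in> normal.tspan k" for P k and v :: "'n uprod" and i :: 'n
    using normal.B_tspan[OF that, of "Inl v"] normal.B_tspan[OF that, of "Inr i"] by simp_all
  have mono: "P \<in> normal.tspan (k + 2)" if "P \<in> normal.tspan (Suc k)" for P and k :: nat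
    using that by (rule normal.tspan_mono[rotated]) simp
  have y_in: "y_var i * P \<in> normal.tspan (k + 2)" if "P \<in> normal.tspan k" for P k and i :: 'n
  proof -
    have "y_var i * P = op.D i * P - weyl_scale 2 (\<Sum>k\<in>UNIV. x_var i k * (dy k * P))"
      by (subst y) (simp add: left_diff_distrib weyl_scale_mult sum_distrib_right mult.assoc)
    moreover have "op.D i * P \<in> normal.tspan (k + 2)" using B that by (blast intro: mono)
    moreover have "x_var i j * (dy j * P) \<in> normal.tspan (k + 2)" for j
      using A(1)[OF A(2)[OF that]] by (simp add: numeral_2_eq_2)
    ultimately show ?thesis
      by (auto intro!: normal.tspan_diff normal.tspan_scale normal.tspan_sum)
  qed
  have d_in: "weyl_deriv (Inl v) * P \<in> normal.tspan (k + 2)" if "P \<in> normal.tspan k" for P k and v :: "'n uprod"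
  proof -
    have "weyl_deriv (Inl v) * P = op.E v * P + (\<Sum>i\<in>UNIV. \<Sum>j\<in>UNIV. if Upair i j = v then dy i * (dy j * P) else 0)"
      by (subst d) (simp add: distrib_right quad_def sum_distrib_right mult.assoc if_distrib[where f = "\<lambda>Q. Q * P"] cong: if_cong)
    moreover have "op.E v * P \<in> normal.tspan (k + 2)" using B that by (blast intro: mono)
    moreover have "dy i * (dy j * P) \<in> normal.tspan (k + 2)" for i j :: 'n
      using A(2)[OF A(2)[OF that]] by (simp add: numeral_2_eq_2)
    ultimately show ?thesis
      by (auto intro!: normal.tspan_add normal.tspan_sum normal.tspan_zero)
  qed
  have "has_bernstein_dimension ?I CARD('n coord)"
  proof (rule twist.has_bernstein_dimension_CARD[OF left_ideal_orthant_ideal eval])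
    fix k
    show "quotient_hilbert_function ?I k \<le> (2 * (2 * k) + 1) ^ CARD('n coord)"
    proof (rule normal.hilbert_function_upper_bound)
      fix u :: "'n coord" and P :: "'n coord weyl" and k assume P: "P \<in> normal.tspan k"
      show "weyl_var u * P \<in> normal.tspan (k + 2)"
        using mono[OF A(1)[OF P]] y_in[OF P] by (cases u) simp_all
      show "weyl_deriv u * P \<in> normal.tspan (k + 2)"
        using mono[OF A(2)[OF P]] d_in[OF P] by (cases u) simp_all
    qed
  next
    fix u :: "'n coord" and P :: "'n coord weyl"
    show "twist.eval1 (case_sum (\<lambda>v. weyl_var (Inl v)) dy u * P) = mvar u * twist.eval1 P"
      by (cases u) (simp_all add: twist.eval1_mult twist.hom_var twist.hom_deriv weyl_var.rep_eq)
    show "\<exists>v. case_sum (\<lambda>v. weyl_var (Inl v)) dy u = weyl_var v \<or> case_sum (\<lambda>v. weyl_var (Inl v)) dy u = weyl_deriv v"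
      by (cases u) auto
    show "(0 :: nat) < 2" by simp
  qed
  then show ?thesis
    unfolding holonomic_ideal_def using left_ideal_orthant_ideal by blast
qed

section \<open>Moments of the Gaussian weight on the orthant\<close>

text \<open>This is the factor that differentiation in the coordinate \<open>v\<close> brings down
  from the exponential, whose exponent is linear in the parameters.\<close>

fun wt :: "('n::finite) coord \<Rightarrow> real^'n \<Rightarrow> real" where
  "wt (Inl u) t = quad (\<lambda>i. t $ i) u"
| "wt (Inr i) t = t $ i"

definition phase :: "real^('n::finite) coord \<Rightarrow> real^'n \<Rightarrow> real" where
  "phase p t = (\<Sum>v\<in>UNIV. p $ v * wt v t)"

lemma sum_coord: "(\<Sum>v\<in>UNIV. f v) = (\<Sum>u\<in>UNIV. f (Inl u)) + (\<Sum>i\<in>UNIV. f (Inr i :: 'n::finite coord))"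
  unfolding UNIV_Plus_UNIV[symmetric] by (subst sum.Plus) (simp_all add: comp_def)

text \<open>After exchanging the summations, exactly one unordered pair \<open>u\<close> survives
  for each ordered pair.\<close>

lemma sum_quad:
  "(\<Sum>u\<in>UNIV. a u * (\<Sum>j\<in>UNIV. \<Sum>k\<in>UNIV. if Upair j k = u then f j k else 0)) =
    (\<Sum>j\<in>UNIV. \<Sum>k\<in>UNIV. a (Upair j k) * (f j k :: real))" for a :: "'n::finite uprod \<Rightarrow> real"
proof -
  have "(\<Sum>u\<in>UNIV. a u * (\<Sum>j\<in>UNIV. \<Sum>k\<in>UNIV. if Upair j k = u then f j k else 0)) =
    (\<Sum>u\<in>UNIV. \<Sum>j\<in>UNIV. \<Sum>k\<in>UNIV. if Upair j k = u then a (Upair j k) * f j k else 0)"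
    unfolding sum_distrib_left by (intro sum.cong) auto
  also have "\<dots> = (\<Sum>j\<in>UNIV. \<Sum>u\<in>UNIV. \<Sum>k\<in>UNIV. if Upair j k = u then a (Upair j k) * f j k else 0)"
    by (rule sum.swap)
  also have "\<dots> = (\<Sum>j\<in>UNIV. \<Sum>k\<in>UNIV. \<Sum>u\<in>UNIV. if Upair j k = u then a (Upair j k) * f j k else 0)"
    by (intro sum.cong refl sum.swap)
  finally show ?thesis by simp
qed

lemma sum_wt_Inl: "(\<Sum>u\<in>UNIV. p $ Inl u * wt (Inl u) t) = (\<Sum>i\<in>UNIV. \<Sum>j\<in>UNIV. x_part p $ i $ j * t $ i * t $ j)"
  using sum_quad[of "\<lambda>u. p $ Inl u" "\<lambda>j k. t $ j * t $ k"] by (simp add: quad_def x_part_def mult.assoc)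

lemma phase_eq: "phase p t = (\<Sum>i\<in>UNIV. \<Sum>j\<in>UNIV. x_part p $ i $ j * t $ i * t $ j) + (\<Sum>i\<in>UNIV. y_part p $ i * t $ i)"
  unfolding phase_def sum_coord sum_wt_Inl by (simp add: y_part_def)

lemma phase_add: "phase (p + q) t = phase p t + phase q t"
  by (simp add: phase_def distrib_right sum.distrib)

lemma abs_component_mult_le: "\<bar>(t :: real^'n) $ i * t $ j\<bar> \<le> t \<bullet> t"
proof -
  have "\<bar>t $ i\<bar> * \<bar>t $ j\<bar> \<le> norm t * norm t"
    by (intro mult_mono component_le_norm_cart) auto
  then show ?thesis by (simp add: abs_mult dot_square_norm power2_eq_square)
qed

lemma wt_Inl_bound: "\<bar>wt (Inl u) t\<bar> \<le> 2 * (t \<bullet> t)"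
proof (cases u)
  case (Upair i j)
  have aux: "\<bar>w\<bar> \<le> 2 * z" if "w = x \<or> w = 2 * x" "\<bar>x\<bar> \<le> z" for w x z :: real
    using that by arith
  have "wt (Inl u) t = t $ i * t $ j \<or> wt (Inl u) t = 2 * (t $ i * t $ j)"
    by (simp add: Upair quad_Upair mult.commute)
  then show ?thesis by (rule aux) (rule abs_component_mult_le)
qed

lemma wt_bound: "\<bar>wt v t\<bar> \<le> 2 * (1 + t \<bullet> t)"
proof (cases v)
  case (Inl u)
  then show ?thesis using wt_Inl_bound[of u t] by simp
next
  case (Inr i)
  have "2 * norm t \<le> 1 + (norm t)\<^sup>2"
    using zero_le_power2[of "norm t - 1"] by (simp add: power2_diff)
  moreover have "\<bar>t $ i\<bar> \<le> norm t" by (rule component_le_norm_cart)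
  ultimately have "\<bar>t $ i\<bar> \<le> 1 + t \<bullet> t" using norm_ge_zero[of t] by (simp add: dot_square_norm)
  then show ?thesis using Inr inner_ge_zero[of t] by simp
qed

lemma phase_bound: "\<bar>phase u t\<bar> \<le> norm u * (\<Sum>v\<in>UNIV. \<bar>wt v t\<bar>)"
proof -
  have "\<bar>phase u t\<bar> \<le> (\<Sum>v\<in>UNIV. \<bar>u $ v * wt v t\<bar>)" unfolding phase_def by (rule sum_abs)
  also have "\<dots> \<le> (\<Sum>v\<in>UNIV. norm u * \<bar>wt v t\<bar>)"
    by (intro sum_mono) (simp add: abs_mult mult_right_mono component_le_norm_cart)
  finally show ?thesis by (simp add: sum_distrib_left)
qed

text \<open>Growth below every Gaussian is stable under sums and products, covers all
  \<open>wt v\<close>, and is absorbed by any Gaussian decay of the exponential.\<close>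

definition subgauss :: "(real^'n::finite \<Rightarrow> real) \<Rightarrow> bool" where
  "subgauss h \<longleftrightarrow> h \<in> borel_measurable borel \<and> (\<forall>e>0. \<exists>C. \<forall>t. \<bar>h t\<bar> \<le> C * exp (e * (t \<bullet> t)))"

lemma subgauss_measurable [measurable_dest]: "subgauss h \<Longrightarrow> h \<in> borel_measurable borel"
  by (simp add: subgauss_def)

lemma subgaussD:
  assumes "subgauss h" "e > 0"
  obtains C where "C \<ge> 0" "\<And>t. \<bar>h t\<bar> \<le> C * exp (e * (t \<bullet> t))"
proof -
  from assms obtain C where C: "\<And>t. \<bar>h t\<bar> \<le> C * exp (e * (t \<bullet> t))" unfolding subgauss_def by blast
  have "0 \<le> C" using C[of 0] by simp
  with C show thesis using that by blast
qed

lemma subgauss_mult: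
  assumes "subgauss f" "subgauss g"
  shows "subgauss (\<lambda>t. f t * g t)"
  unfolding subgauss_def
proof (intro conjI allI impI)
  show "(\<lambda>t. f t * g t) \<in> borel_measurable borel"
    using assms by (intro borel_measurable_times subgauss_measurable)
  fix e :: real assume "e > 0"
  then have "e / 2 > 0" by simp
  obtain C where C: "C \<ge> 0" "\<And>t. \<bar>f t\<bar> \<le> C * exp (e / 2 * (t \<bullet> t))"
    using subgaussD[OF assms(1) \<open>e / 2 > 0\<close>] by blast
  obtain D where D: "D \<ge> 0" "\<And>t. \<bar>g t\<bar> \<le> D * exp (e / 2 * (t \<bullet> t))"
    using subgaussD[OF assms(2) \<open>e / 2 > 0\<close>] by blast
  have "\<bar>f t * g t\<bar> \<le> (C * D) * exp (e * (t \<bullet> t))" for t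
  proof -
    have "\<bar>f t\<bar> * \<bar>g t\<bar> \<le> (C * exp (e / 2 * (t \<bullet> t))) * (D * exp (e / 2 * (t \<bullet> t)))"
      by (intro mult_mono C D) (auto simp: C)
    also have "\<dots> = (C * D) * (exp (e / 2 * (t \<bullet> t)) * exp (e / 2 * (t \<bullet> t)))" by simp
    also have "exp (e / 2 * (t \<bullet> t)) * exp (e / 2 * (t \<bullet> t)) = exp (e * (t \<bullet> t))"
      unfolding exp_add[symmetric] by simp
    finally show ?thesis by (simp add: abs_mult)
  qed
  then show "\<exists>C. \<forall>t. \<bar>f t * g t\<bar> \<le> C * exp (e * (t \<bullet> t))" by blast
qed

lemma subgauss_const: "subgauss (\<lambda>_. c)"
  unfolding subgauss_def
proof (intro conjI allI impI)
  fix e :: real assume "e > 0"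
  have "\<bar>c\<bar> \<le> \<bar>c\<bar> * exp (e * (t \<bullet> t))" for t :: "real^'a"
  proof -
    have "1 \<le> exp (e * (t \<bullet> t))" using \<open>e > 0\<close> by simp
    then show ?thesis using mult_left_mono[of 1 _ "\<bar>c\<bar>"] by simp
  qed
  then show "\<exists>C. \<forall>t :: real^'a. \<bar>c\<bar> \<le> C * exp (e * (t \<bullet> t))" by blast
qed simp

lemma subgauss_add:
  assumes "subgauss f" "subgauss g"
  shows "subgauss (\<lambda>t. f t + g t)"
  unfolding subgauss_def
proof (intro conjI allI impI)
  show "(\<lambda>t. f t + g t) \<in> borel_measurable borel"
    using assms by (intro borel_measurable_add subgauss_measurable)
  fix e :: real assume e: "e > 0"
  obtain C where C: "\<And>t. \<bar>f t\<bar> \<le> C * exp (e * (t \<bullet> t))" using subgaussD[OF assms(1) e] by blast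
  obtain D where D: "\<And>t. \<bar>g t\<bar> \<le> D * exp (e * (t \<bullet> t))" using subgaussD[OF assms(2) e] by blast
  have "\<bar>f t + g t\<bar> \<le> (C + D) * exp (e * (t \<bullet> t))" for t
    using C[of t] D[of t] by (simp add: distrib_right abs_le_iff)
  then show "\<exists>C. \<forall>t. \<bar>f t + g t\<bar> \<le> C * exp (e * (t \<bullet> t))" by blast
qed

lemma subgauss_abs: "subgauss h \<Longrightarrow> subgauss (\<lambda>t. \<bar>h t\<bar>)"
  unfolding subgauss_def by (auto intro: borel_measurable_abs)

lemma subgauss_sum: "(\<And>i. i \<in> A \<Longrightarrow> subgauss (f i)) \<Longrightarrow> subgauss (\<lambda>t. \<Sum>i\<in>A. f i t)"
  by (induction A rule: infinite_finite_induct) (auto intro: subgauss_const subgauss_add)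

lemma wt_measurable [measurable]: "wt v \<in> borel_measurable borel"
proof -
  have "continuous_on UNIV (\<lambda>t :: real^'a. if b then t $ j * t $ k else 0)" for b and j k :: 'a
    by (cases b) (auto intro!: continuous_intros)
  then have "continuous_on UNIV (wt v)"
    by (cases v) (auto simp: quad_def[abs_def] intro!: continuous_intros)
  then show ?thesis by (rule borel_measurable_continuous_onI)
qed

lemma subgauss_wt: "subgauss (wt v)"
  unfolding subgauss_def
proof (intro conjI allI impI)
  fix e :: real assume e: "e > 0"
  have "\<bar>wt v t\<bar> \<le> (2 + 2 / e) * exp (e * (t \<bullet> t))" for t
  proof -
    have "e * (t \<bullet> t) \<le> exp (e * (t \<bullet> t))" using exp_ge_add_one_self[of "e * (t \<bullet> t)"] by linarith
    then have "t \<bullet> t \<le> exp (e * (t \<bullet> t)) / e" using e by (simp add: field_simps)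
    moreover have "1 \<le> exp (e * (t \<bullet> t))" using e by simp
    moreover have "2 * (1 + z) \<le> 2 * (X + Y)" if "z \<le> Y" "1 \<le> X" for z X Y :: real
      using add_mono[OF that(2,1)] by simp
    ultimately have "2 * (1 + t \<bullet> t) \<le> 2 * (exp (e * (t \<bullet> t)) + exp (e * (t \<bullet> t)) / e)" by blast
    also have "\<dots> = (2 + 2 / e) * exp (e * (t \<bullet> t))" by (simp add: algebra_simps)
    finally show ?thesis using wt_bound[of v t] by linarith
  qed
  then show "\<exists>C. \<forall>t. \<bar>wt v t\<bar> \<le> C * exp (e * (t \<bullet> t))" by blast
qed simp

lemma phase_measurable [measurable]: "phase p \<in> borel_measurable borel"
  unfolding phase_def[abs_def] by measurable

text \<open>The weight factors over the coordinates into rescaled one-dimensional normal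
  densities.\<close>

lemma integrable_gauss:
  assumes "c > 0"
  shows "integrable lborel (\<lambda>t :: real^'n::finite. exp (- c * (t \<bullet> t)))"
proof (rule integrableI_nonneg)
  have c1: "integrable lborel (\<lambda>x::real. exp (- c * x\<^sup>2))"
  proof -
    \<comment> \<open>The standard deviation for which the normal density has the exponent
      \<open>- c * x\<^sup>2\<close>.\<close>
    define s where "s = 1 / sqrt (2 * c)"
    have s: "s > 0" "s\<^sup>2 = 1 / (2 * c)" using assms by (simp_all add: s_def power_divide)
    have "integrable lborel (\<lambda>x. sqrt (2 * pi * s\<^sup>2) * normal_density 0 s x)"
      using s by (intro integrable_mult_right integrable_normal_density)
    moreover have "sqrt (2 * pi * s\<^sup>2) * normal_density 0 s x = exp (- c * x\<^sup>2)" for x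
      using s assms by (simp add: normal_density_def)
    ultimately show ?thesis by simp
  qed
  have fin: "(\<integral>\<^sup>+x. ennreal (exp (- c * (x::real)\<^sup>2)) \<partial>lborel) < \<infinity>"
    using c1 unfolding integrable_iff_bounded by simp
  have "(\<integral>\<^sup>+t. ennreal (exp (- c * ((t :: real^'n) \<bullet> t))) \<partial>lborel) =
      (\<integral>\<^sup>+t. (\<Prod>b\<in>Basis. ennreal (exp (- c * ((t :: real^'n) \<bullet> b)\<^sup>2))) \<partial>lborel)"
  proof (rule nn_integral_cong)
    fix t :: "real^'n"
    have "exp (- c * (t \<bullet> t)) = (\<Prod>b\<in>Basis. exp (- c * (t \<bullet> b)\<^sup>2))"
      unfolding exp_sum[OF finite_Basis, symmetric] euclidean_inner[of t t]
      by (simp add: sum_distrib_left power2_eq_square)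
    then show "ennreal (exp (- c * (t \<bullet> t))) = (\<Prod>b\<in>Basis. ennreal (exp (- c * (t \<bullet> b)\<^sup>2)))"
      by (simp add: prod_ennreal)
  qed
  also have "\<dots> = (\<Prod>b\<in>(Basis :: (real^'n) set). (\<integral>\<^sup>+x. ennreal (exp (- c * x\<^sup>2)) \<partial>lborel))"
    by (rule nn_integral_lborel_prod) simp_all
  also have "\<dots> < \<infinity>"
    using fin by (simp add: ennreal_prod_eq_top less_top power_less_top_ennreal)
  finally show "(\<integral>\<^sup>+t. ennreal (exp (- c * ((t :: real^'n) \<bullet> t))) \<partial>lborel) < \<infinity>" .
qed auto

text \<open>Half of the decay rate \<open>c\<close> dominates \<open>h\<close>; the other half keeps
  the integral finite.\<close>

lemma integrable_subgauss:
  assumes h: "subgauss h" and "c > 0"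
  shows "integrable lborel (\<lambda>t. h t * exp (K - c * (t \<bullet> t)))"
proof -
  have "c / 2 > 0" using assms by simp
  then obtain C where C: "C \<ge> 0" "\<And>t. \<bar>h t\<bar> \<le> C * exp (c / 2 * (t \<bullet> t))"
    using subgaussD[OF h] by blast
  note [measurable] = subgauss_measurable[OF h]
  show ?thesis
  proof (rule Bochner_Integration.integrable_bound)
    show "integrable lborel (\<lambda>t :: real^'a. (C * exp K) * exp (- (c / 2) * (t \<bullet> t)))"
      by (intro integrable_mult_right integrable_gauss \<open>c / 2 > 0\<close>)
    show "AE t in lborel. norm (h t * exp (K - c * (t \<bullet> t))) \<le> norm ((C * exp K) * exp (- (c / 2) * (t \<bullet> t)))"
    proof (rule AE_I2)
      fix t :: "real^'a"
      have "\<bar>h t\<bar> * exp (K - c * (t \<bullet> t)) \<le> (C * exp (c / 2 * (t \<bullet> t))) * exp (K - c * (t \<bullet> t))"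
        by (intro mult_right_mono C) simp
      also have "\<dots> = C * exp (c / 2 * (t \<bullet> t) + (K - c * (t \<bullet> t)))"
        by (simp only: exp_add mult.assoc)
      also have "c / 2 * (t \<bullet> t) + (K - c * (t \<bullet> t)) = K + - (c / 2) * (t \<bullet> t)"
        by (simp add: field_simps)
      also have "C * exp \<dots> = (C * exp K) * exp (- (c / 2) * (t \<bullet> t))"
        by (simp only: exp_add mult.assoc)
      finally show "norm (h t * exp (K - c * (t \<bullet> t))) \<le> norm ((C * exp K) * exp (- (c / 2) * (t \<bullet> t)))"
        using C(1) by (simp add: abs_mult)
    qed
  qed simp
qed

section \<open>Coercivity on the domain and its openness\<close>

lemma inner_x_part: "t \<bullet> (- x_part p *v t) = - (\<Sum>u\<in>UNIV. p $ Inl u * wt (Inl u) t)"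
proof -
  have "t \<bullet> (x_part p *v t) = (\<Sum>i\<in>UNIV. \<Sum>j\<in>UNIV. x_part p $ i $ j * t $ i * t $ j)"
    by (simp add: inner_vec_def matrix_vector_mult_def sum_distrib_left mult.left_commute mult.assoc)
  then show ?thesis unfolding sum_wt_Inl by (simp add: matrix_vector_mult_def inner_vec_def sum_negf)
qed

lemma symmetric_x_part: "transpose (x_part p) = x_part (p :: real^('n::finite) coord)"
proof -
  have "p $ Inl (Upair i j) = p $ Inl (Upair j i)" for i j :: 'n
    by (rule arg_cong[where f = "\<lambda>u. p $ Inl u"]) simp
  then show ?thesis by (simp add: transpose_def x_part_def vec_eq_iff)
qed

lemma in_orthant_domain_iff:
  "p \<in> orthant_domain \<longleftrightarrow> (\<forall>t. t \<noteq> 0 \<longrightarrow> (\<Sum>u\<in>UNIV. p $ Inl u * wt (Inl u) t) < 0)"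
proof -
  have "transpose (- x_part p) = - x_part p"
    using symmetric_x_part[of p] by (simp add: transpose_def vec_eq_iff)
  then show ?thesis by (simp add: orthant_domain_def positive_definite_def inner_x_part)
qed

text \<open>The quadratic form attains its maximum on the compact unit sphere; this maximum is
  negative, and homogeneity of degree 2 carries the bound to all \<open>t\<close>.\<close>

lemma orthant_domain_coercive:
  fixes p :: "real^('n::finite) coord"
  assumes "p \<in> orthant_domain"
  obtains c where "c > 0" "\<And>t. (\<Sum>u\<in>UNIV. p $ Inl u * wt (Inl u) t) \<le> - c * (t \<bullet> t)"
proof -
  define Q where "Q = (\<lambda>t :: real^'n. \<Sum>u\<in>UNIV. p $ Inl u * wt (Inl u) t)"
  have Q_eq: "Q t = (\<Sum>i\<in>UNIV. \<Sum>j\<in>UNIV. x_part p $ i $ j * t $ i * t $ j)" for t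
    unfolding Q_def by (rule sum_wt_Inl)
  have scale: "Q (a *\<^sub>R t) = a\<^sup>2 * Q t" for a t
    unfolding Q_eq by (simp add: sum_distrib_left power2_eq_square mult_ac)
  have neg: "Q t < 0" if "t \<noteq> 0" for t
    using assms that by (simp add: in_orthant_domain_iff Q_def)
  have "continuous_on (sphere 0 1) Q"
    unfolding Q_eq by (intro continuous_intros)
  moreover have "sphere (0 :: real^'n) 1 \<noteq> {}" by simp
  ultimately obtain s where s: "s \<in> sphere 0 1" "\<And>t. t \<in> sphere 0 1 \<Longrightarrow> Q t \<le> Q s"
    using continuous_attains_sup[of "sphere (0 :: real^'n) 1" Q] by auto
  have "s \<noteq> 0" using s(1) by auto
  have "Q t \<le> - (- Q s) * (t \<bullet> t)" for t
  proof (cases "t = 0")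
    case True
    then show ?thesis using scale[of 0 0] by simp
  next
    case False
    have "Q t = Q (norm t *\<^sub>R (t /\<^sub>R norm t))" using False by simp
    also have "\<dots> = (norm t)\<^sup>2 * Q (t /\<^sub>R norm t)" by (rule scale)
    also have "\<dots> \<le> (norm t)\<^sup>2 * Q s" using False by (intro mult_left_mono s(2)) auto
    finally show ?thesis by (simp add: dot_square_norm mult.commute)
  qed
  moreover have "- Q s > 0" using neg[OF \<open>s \<noteq> 0\<close>] by simp
  ultimately show thesis using that unfolding Q_def by blast
qed

lemma open_orthant_domain: "open (orthant_domain :: (real^('n::finite) coord) set)"
  unfolding open_contains_ball
proof
  fix p :: "real^'n coord" assume "p \<in> orthant_domain"
  then obtain c where c: "c > 0" "\<And>t. (\<Sum>u\<in>UNIV. p $ Inl u * wt (Inl u) t) \<le> - c * (t \<bullet> t)"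
    using orthant_domain_coercive by blast
  \<comment> \<open>Each matrix coordinate contributes at most \<open>2 * (t \<bullet> t)\<close>
    times the distance from \<open>p\<close>, so a change by less than \<open>c / M\<close> cannot
    outweigh the decay \<open>c * (t \<bullet> t)\<close> for \<open>t \<noteq> 0\<close>.\<close>
  define M where "M = 2 * real CARD('n uprod)"
  have M: "M > 0" by (simp add: M_def)
  have "q \<in> orthant_domain" if "q \<in> ball p (c / M)" for q
    unfolding in_orthant_domain_iff
  proof (intro allI impI)
    fix t :: "real^'n" assume "t \<noteq> 0"
    have "(\<Sum>u\<in>UNIV. (q - p) $ Inl u * wt (Inl u) t) \<le> (\<Sum>u\<in>(UNIV :: 'n uprod set). norm (q - p) * (2 * (t \<bullet> t)))"
    proof (rule sum_mono)
      fix u :: "'n uprod"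
      have "(q - p) $ Inl u * wt (Inl u) t \<le> \<bar>(q - p) $ Inl u\<bar> * \<bar>wt (Inl u) t\<bar>"
        unfolding abs_mult[symmetric] by (rule abs_ge_self)
      also have "\<dots> \<le> norm (q - p) * (2 * (t \<bullet> t))"
        by (intro mult_mono wt_Inl_bound component_le_norm_cart) auto
      finally show "(q - p) $ Inl u * wt (Inl u) t \<le> norm (q - p) * (2 * (t \<bullet> t))" .
    qed
    also have "\<dots> = (M * norm (q - p)) * (t \<bullet> t)" by (simp add: M_def)
    finally have "(\<Sum>u\<in>UNIV. q $ Inl u * wt (Inl u) t) \<le> (M * norm (q - p)) * (t \<bullet> t) + - c * (t \<bullet> t)"
      using c(2)[of t] by (simp add: left_diff_distrib sum_subtractf)
    also have "\<dots> = (M * norm (q - p) - c) * (t \<bullet> t)" by (simp add: algebra_simps)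
    also have "\<dots> < 0"
    proof (rule mult_neg_pos)
      show "M * norm (q - p) - c < 0"
        using that M by (simp add: dist_norm norm_minus_commute field_simps)
    qed (use \<open>t \<noteq> 0\<close> in simp)
    finally show "(\<Sum>u\<in>UNIV. q $ Inl u * wt (Inl u) t) < 0" .
  qed
  then show "\<exists>e>0. ball p e \<subseteq> orthant_domain"
    using c(1) M by (intro exI[of _ "c / M"]) auto
qed

text \<open>The linear term is dominated by half of the quadratic decay through the weighted
  inequality of arithmetic and geometric means, at the price of an additive constant.\<close>

lemma orthant_domain_phase_bound:
  assumes "p \<in> orthant_domain"
  obtains c K where "c > 0" "\<And>t. phase p t \<le> K - c * (t \<bullet> t)"
proof -
  obtain c where c: "c > 0" "\<And>t. (\<Sum>u\<in>UNIV. p $ Inl u * wt (Inl u) t) \<le> - c * (t \<bullet> t)"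
    using orthant_domain_coercive[OF assms] by blast
  have "phase p t \<le> (norm (y_part p))\<^sup>2 / (2 * c) - (c / 2) * (t \<bullet> t)" for t
  proof -
    have "(\<Sum>i\<in>UNIV. p $ Inr i * wt (Inr i) t) = y_part p \<bullet> t"
      by (simp add: inner_vec_def y_part_def)
    also have "\<dots> \<le> norm (y_part p) * norm t" by (rule norm_cauchy_schwarz)
    also have "\<dots> \<le> (norm (y_part p))\<^sup>2 / (2 * c) + (c / 2) * (norm t)\<^sup>2"
      using c(1) zero_le_power2[of "norm (y_part p) - c * norm t"]
      by (simp add: power2_diff field_simps power2_eq_square)
    finally show ?thesis
      unfolding phase_def sum_coord using c(2)[of t] by (simp add: dot_square_norm field_simps)
  qed
  then show thesis using that[of "c / 2" "(norm (y_part p))\<^sup>2 / (2 * c)"] c(1) by simp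
qed

section \<open>Moments and differentiation under the integral\<close>

definition orthant :: "(real^'n::finite) set" where
  "orthant = {t. \<forall>i. 0 \<le> t $ i}"

lemma orthant_measurable [measurable]: "orthant \<in> sets borel"
proof -
  have "closed (orthant :: (real^'n::finite) set)"
    unfolding orthant_def by (intro closed_Collect_all closed_Collect_le continuous_intros)
  then show ?thesis by (rule borel_closed)
qed

text \<open>A general prefactor \<open>h\<close> makes the family closed under partial derivatives,
  each of which multiplies \<open>h\<close> by some \<open>wt v\<close>.\<close>

definition moment :: "(real^'n::finite \<Rightarrow> real) \<Rightarrow> real^'n coord \<Rightarrow> real" where
  "moment h p = (\<integral>t. indicator orthant t * (h t * exp (phase p t)) \<partial>lborel)"

lemma orthant_integral_eq: "orthant_integral (x_part p) (y_part p) = moment (\<lambda>_. 1) p"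
  unfolding orthant_integral_def moment_def set_lebesgue_integral_def phase_eq orthant_def[symmetric] by simp

lemma integrable_moment:
  assumes "subgauss h" "c > 0" "\<And>t. phase p t \<le> K - c * (t \<bullet> t)"
  shows "integrable lborel (\<lambda>t. indicator orthant t * (h t * exp (phase p t)))"
proof (rule Bochner_Integration.integrable_bound[OF integrable_subgauss[OF assms(1,2), of K]])
  note [measurable] = subgauss_measurable[OF assms(1)]
  show "(\<lambda>t. indicator orthant t * (h t * exp (phase p t))) \<in> borel_measurable lborel" by simp
  show "AE t in lborel. norm (indicator orthant t * (h t * exp (phase p t))) \<le> norm (h t * exp (K - c * (t \<bullet> t)))"
    using assms(3) by (intro AE_I2) (auto simp: indicator_def abs_mult intro!: mult_left_mono)
qed

lemma integrable_moment_domain: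
  assumes "subgauss h" "p \<in> orthant_domain"
  shows "integrable lborel (\<lambda>t. indicator orthant t * (h t * exp (phase p t)))"
  using orthant_domain_phase_bound[OF assms(2)] integrable_moment[OF assms(1)] by metis

lemma moment_add:
  assumes "subgauss f" "subgauss g" "p \<in> orthant_domain"
  shows "moment (\<lambda>t. f t + g t) p = moment f p + moment g p"
proof -
  have "moment (\<lambda>t. f t + g t) p = (\<integral>t. indicator orthant t * (f t * exp (phase p t)) +
      indicator orthant t * (g t * exp (phase p t)) \<partial>lborel)"
    unfolding moment_def by (rule Bochner_Integration.integral_cong) (simp_all add: algebra_simps)
  also have "\<dots> = moment f p + moment g p"
    unfolding moment_def
    by (rule Bochner_Integration.integral_add) (rule integrable_moment_domain[OF _ assms(3)], rule assms)+
  finally show ?thesis .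
qed

lemma moment_cmult: "moment (\<lambda>t. a * h t) p = a * moment h p"
  unfolding moment_def by (subst integral_mult_right_zero[symmetric]) (simp add: mult_ac)

lemma moment_sum:
  assumes "\<And>i. i \<in> A \<Longrightarrow> subgauss (f i)" "p \<in> orthant_domain"
  shows "moment (\<lambda>t. \<Sum>i\<in>A. f i t) p = (\<Sum>i\<in>A. moment (f i) p)"
  using assms(1)
proof (induction A rule: infinite_finite_induct)
  case (insert a A)
  then show ?case by (simp add: moment_add assms(2) subgauss_sum)
qed (simp_all add: moment_def)

text \<open>Lagrange remainder of order 2; the factor \<open>x\<^sup>2\<close> makes the error after
  integration quadratic in the increment.\<close>

lemma exp_second_order: "\<bar>exp x - 1 - x\<bar> \<le> x\<^sup>2 * exp \<bar>x\<bar>" for x :: real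
proof -
  obtain s where s: "\<bar>s\<bar> \<le> \<bar>x\<bar>" "exp x = (\<Sum>m<2. x ^ m / fact m) + exp s / fact 2 * x ^ 2"
    using Maclaurin_exp_le[of x 2] by blast
  have "exp x - 1 - x = exp s / 2 * x\<^sup>2" using s(2) by (simp add: numeral_2_eq_2)
  moreover have "exp s \<le> exp \<bar>x\<bar>" using s(1) by simp
  then have "exp s / 2 \<le> exp \<bar>x\<bar>" using exp_gt_zero[of s] by linarith
  then have "exp s / 2 * x\<^sup>2 \<le> exp \<bar>x\<bar> * x\<^sup>2" by (rule mult_right_mono) simp
  moreover have "0 \<le> exp s / 2 * x\<^sup>2" by simp
  ultimately show ?thesis by (simp only: abs_of_nonneg mult.commute)
qed

text \<open>For small \<open>u\<close>, the second-order remainder of the integrand is bounded by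
  \<open>(norm u)\<^sup>2 * F t\<close> with an integrable \<open>F\<close> that does not depend on
  \<open>u\<close>, so the error divided by \<open>norm u\<close> tends to 0.\<close>

lemma moment_has_derivative:
  fixes p :: "real^('n::finite) coord"
  assumes h: "subgauss h" and p: "p \<in> orthant_domain"
  shows "(moment h has_derivative (\<lambda>u. \<Sum>v\<in>UNIV. u $ v * moment (\<lambda>t. h t * wt v t) p)) (at p)"
proof -
  obtain c K where c: "c > 0" "\<And>t. phase p t \<le> K - c * (t \<bullet> t)"
    using orthant_domain_phase_bound[OF p] by blast
  \<comment> \<open>\<open>norm u * B t\<close> bounds the change of the phase. The radius
    \<open>d\<close> satisfies \<open>d * M = c / 2\<close>, so increments up to \<open>d\<close>
    use up at most half of the Gaussian decay; \<open>F\<close> is the resulting majorant.\<close>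
  define B where "B = (\<lambda>t :: real^'n. \<Sum>v\<in>UNIV. \<bar>wt v t\<bar>)"
  define M where "M = 2 * real CARD('n coord)"
  define d where "d = c / (2 * M)"
  define F where "F = (\<lambda>t. (\<bar>h t\<bar> * (B t * B t)) * exp ((K + c / 2) - (c / 2) * (t \<bullet> t)))"
  have "0 < CARD('n coord)" by (rule zero_less_card_finite)
  then have M: "M > 0" by (simp only: M_def of_nat_0_less_iff mult_pos_pos zero_less_numeral)
  then have d: "d > 0" "d * M = c / 2" using c(1) by (simp_all add: d_def)
  have B0: "B t \<ge> 0" for t unfolding B_def by (rule sum_nonneg) simp
  have BM: "B t \<le> M * (1 + t \<bullet> t)" for t
  proof -
    have "B t \<le> (\<Sum>v\<in>(UNIV :: 'n coord set). 2 * (1 + t \<bullet> t))"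
      unfolding B_def by (intro sum_mono wt_bound)
    also have "\<dots> = M * (1 + t \<bullet> t)" unfolding M_def sum_constant by (simp only: mult_ac)
    finally show ?thesis .
  qed
  have subB: "subgauss B"
    unfolding B_def by (intro subgauss_sum subgauss_abs subgauss_wt)
  have intF: "integrable lborel F"
    unfolding F_def using c(1) by (intro integrable_subgauss subgauss_mult subgauss_abs h subB) simp
  have phase_u: "\<bar>phase u t\<bar> \<le> norm u * B t" for u t
    unfolding B_def by (rule phase_bound)
  have small: "norm u * B t \<le> c / 2 + c / 2 * (t \<bullet> t)" if "norm u \<le> d" for u :: "real^'n coord" and t
  proof -
    have "norm u * B t \<le> d * (M * (1 + t \<bullet> t))"
      using that d B0 BM by (intro mult_mono) auto
    also have "\<dots> = d * M * (1 + t \<bullet> t)" by simp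
    finally show ?thesis by (simp add: d distrib_left)
  qed
  have rem: "\<bar>moment h (p + u) - moment h p - (\<Sum>v\<in>UNIV. u $ v * moment (\<lambda>t. h t * wt v t) p)\<bar> \<le> (norm u)\<^sup>2 * integral\<^sup>L lborel F"
    if u: "norm u \<le> d" for u
  proof -
    define R where "R = (\<lambda>t. indicator orthant t * (h t * exp (phase (p + u) t)) - indicator orthant t * (h t * exp (phase p t))
        - (\<Sum>v\<in>UNIV. u $ v * (indicator orthant t * (h t * wt v t * exp (phase p t)))))"
    have i1: "integrable lborel (\<lambda>t. indicator orthant t * (h t * exp (phase (p + u) t)))"
    proof (rule integrable_moment[OF h, of "c / 2" _ "K + c / 2"])
      fix t
      show "phase (p + u) t \<le> K + c / 2 - c / 2 * (t \<bullet> t)"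
        using c(2)[of t] phase_u[of u t] small[OF u, of t] by (simp add: phase_add)
    qed (use c in simp)
    have i2: "integrable lborel (\<lambda>t. indicator orthant t * (h t * exp (phase p t)))"
      by (rule integrable_moment_domain[OF h p])
    have i3: "integrable lborel (\<lambda>t. indicator orthant t * (h t * wt v t * exp (phase p t)))" for v
      by (rule integrable_moment_domain[OF subgauss_mult[OF h subgauss_wt] p])
    have intR: "integrable lborel R"
      unfolding R_def
      by (intro Bochner_Integration.integrable_diff Bochner_Integration.integrable_sum integrable_mult_right i1 i2 i3)
    have "moment h (p + u) - moment h p - (\<Sum>v\<in>UNIV. u $ v * moment (\<lambda>t. h t * wt v t) p) = integral\<^sup>L lborel R"
      unfolding R_def moment_def using i1 i2 i3 by simp
    moreover have "\<bar>integral\<^sup>L lborel R\<bar> \<le> (\<integral>t. (norm u)\<^sup>2 * F t \<partial>lborel)"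
    proof (rule integral_abs_bound_integral)
      show "integrable lborel (\<lambda>t. (norm u)\<^sup>2 * F t)" using intF by simp
      fix t :: "real^'n"
      have "(\<Sum>v\<in>UNIV. u $ v * (indicator orthant t * (h t * wt v t * exp (phase p t)))) =
          indicator orthant t * (h t * exp (phase p t)) * phase u t"
        by (simp add: phase_def[of u] sum_distrib_left mult_ac)
      then have R: "R t = indicator orthant t * (h t * exp (phase p t)) * (exp (phase u t) - 1 - phase u t)"
        unfolding R_def phase_add exp_add by (simp add: algebra_simps)
      have "\<bar>exp (phase u t) - 1 - phase u t\<bar> \<le> (phase u t)\<^sup>2 * exp \<bar>phase u t\<bar>" by (rule exp_second_order)
      also have "\<dots> \<le> (norm u * B t)\<^sup>2 * exp (c / 2 + c / 2 * (t \<bullet> t))"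
      proof (rule mult_mono)
        show "(phase u t)\<^sup>2 \<le> (norm u * B t)\<^sup>2" using phase_u[of u t] by (simp add: abs_le_square_iff[symmetric] B0)
        show "exp \<bar>phase u t\<bar> \<le> exp (c / 2 + c / 2 * (t \<bullet> t))"
          using phase_u[of u t] small[OF u, of t] by simp
      qed auto
      finally have e: "\<bar>exp (phase u t) - 1 - phase u t\<bar> \<le> (norm u * B t)\<^sup>2 * exp (c / 2 + c / 2 * (t \<bullet> t))" .
      have "\<bar>R t\<bar> \<le> (\<bar>h t\<bar> * exp (phase p t)) * \<bar>exp (phase u t) - 1 - phase u t\<bar>"
        unfolding R by (auto simp: abs_mult indicator_def)
      also have "\<dots> \<le> (\<bar>h t\<bar> * exp (K - c * (t \<bullet> t))) * ((norm u * B t)\<^sup>2 * exp (c / 2 + c / 2 * (t \<bullet> t)))"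
        using c(2)[of t] by (intro mult_mono e) auto
      also have "\<dots> = (norm u)\<^sup>2 * (\<bar>h t\<bar> * (B t * B t)) * (exp (K - c * (t \<bullet> t)) * exp (c / 2 + c / 2 * (t \<bullet> t)))"
        by (simp add: power2_eq_square)
      also have "exp (K - c * (t \<bullet> t)) * exp (c / 2 + c / 2 * (t \<bullet> t)) = exp ((K + c / 2) - (c / 2) * (t \<bullet> t))"
        unfolding exp_add[symmetric] by (rule arg_cong[where f = exp]) (simp add: field_simps)
      finally show "\<bar>R t\<bar> \<le> (norm u)\<^sup>2 * F t" by (simp add: F_def mult.assoc)
    qed (rule intR)
    ultimately show ?thesis by simp
  qed
  show ?thesis
    unfolding has_derivative_at
  proof
    show "bounded_linear (\<lambda>u. \<Sum>v\<in>UNIV. u $ v * moment (\<lambda>t. h t * wt v t) p)"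
      by (intro bounded_linear_sum bounded_linear_mult_const bounded_linear_vec_nth)
    let ?r = "\<lambda>u. norm (moment h (p + u) - moment h p - (\<Sum>v\<in>UNIV. u $ v * moment (\<lambda>t. h t * wt v t) p)) / norm u"
    show "(?r \<longlongrightarrow> 0) (at 0)"
    proof (rule Lim_null_comparison)
      have "\<forall>\<^sub>F u in at (0 :: real^'n coord). norm u < d"
        unfolding eventually_at using d(1) by (auto simp: dist_norm)
      then show "\<forall>\<^sub>F u in at 0. norm (?r u) \<le> norm u * integral\<^sup>L lborel F"
      proof eventually_elim
        case (elim u)
        show ?case
        proof (cases "u = 0")
          case False
          have "norm (?r u) \<le> ((norm u)\<^sup>2 * integral\<^sup>L lborel F) / norm u"
            using rem[of u] elim by (simp add: divide_right_mono)
          then show ?thesis using False by (simp add: power2_eq_square)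
        qed simp
      qed
      show "((\<lambda>u. norm u * integral\<^sup>L lborel F) \<longlongrightarrow> 0) (at 0)"
        by (rule tendsto_eq_intros tendsto_mult_left_zero tendsto_norm_zero tendsto_ident_at)+
    qed
  qed
qed

section \<open>Annihilation of the orthant integral\<close>

lemma continuous_on_moment: "subgauss h \<Longrightarrow> continuous_on orthant_domain (moment h)"
  using moment_has_derivative has_derivative_continuous continuous_at_imp_continuous_on by blast

text \<open>Agreement of \<open>f\<close> with a moment is asked only on the domain, so that the
  result can be iterated on partial derivatives, which are known only there. Openness of the domain
  makes this enough.\<close>

lemma moment_partial:
  assumes h: "subgauss h" and f: "\<And>q. q \<in> orthant_domain \<Longrightarrow> f q = complex_of_real (moment h q)"
    and p: "p \<in> orthant_domain"
  shows "((\<lambda>s. f (p + s *\<^sub>R axis v 1)) has_vector_derivative complex_of_real (moment (\<lambda>t. h t * wt v t) p)) (at 0)"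
proof -
  let ?l = "\<lambda>s :: real. p + s *\<^sub>R axis v 1"
  have l: "(?l has_derivative (\<lambda>s. s *\<^sub>R axis v 1)) (at 0)"
    by (auto intro!: derivative_eq_intros)
  have "(moment h has_derivative (\<lambda>u. \<Sum>w\<in>UNIV. u $ w * moment (\<lambda>t. h t * wt w t) p)) (at (?l 0))"
    using moment_has_derivative[OF h p] by simp
  from has_derivative_compose[OF l this] have "((\<lambda>s. moment h (?l s)) has_derivative
      (\<lambda>s. \<Sum>w\<in>UNIV. (s *\<^sub>R axis v 1) $ w * moment (\<lambda>t. h t * wt w t) p)) (at 0)"
    .
  also have "(\<lambda>s. \<Sum>w\<in>UNIV. (s *\<^sub>R axis v 1) $ w * moment (\<lambda>t. h t * wt w t) p) =
      (\<lambda>s. s * moment (\<lambda>t. h t * wt v t) p)"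
    by (rule ext) (simp add: axis_def if_distrib[where f = "\<lambda>x. _ * x"] if_distrib[where f = "\<lambda>x. x * _"] cong: if_cong)
  finally have "((\<lambda>s. moment h (?l s)) has_vector_derivative moment (\<lambda>t. h t * wt v t) p) (at 0)"
    by (simp add: has_vector_derivative_def)
  then have "((\<lambda>s. complex_of_real (moment h (?l s))) has_vector_derivative complex_of_real (moment (\<lambda>t. h t * wt v t) p)) (at 0)"
    by (rule bounded_linear.has_vector_derivative[OF bounded_linear_of_real])
  moreover have "open (?l -` orthant_domain)"
    by (rule open_vimage[OF open_orthant_domain]) (auto intro!: continuous_intros)
  ultimately show ?thesis
    by (rule has_vector_derivative_transform_within_open[of _ _ _ "?l -` orthant_domain"]) (use p f in auto)
qed

lemma partial_moment:
  assumes "subgauss h" "\<And>q. q \<in> orthant_domain \<Longrightarrow> f q = complex_of_real (moment h q)" "p \<in> orthant_domain"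
  shows "partial v f p = complex_of_real (moment (\<lambda>t. h t * wt v t) p)"
  unfolding partial_def by (rule vector_derivative_at[OF moment_partial[OF assms]])

text \<open>The induction generalises over the prefactor, since a partial derivative of a moment is
  the moment with \<open>h\<close> multiplied by \<open>wt v\<close>.\<close>

lemma Ck_on_moment:
  assumes "subgauss h" "\<And>q. q \<in> orthant_domain \<Longrightarrow> f q = complex_of_real (moment h q)"
  shows "Ck_on k orthant_domain f"
  using assms
proof (induction k arbitrary: f h)
  case 0
  have "continuous_on orthant_domain (\<lambda>q. complex_of_real (moment h q))"
    by (intro continuous_intros continuous_on_moment 0)
  then have "continuous_on orthant_domain f" by (rule continuous_on_eq) (simp add: 0(2))
  then show ?case by simp
next
  case (Suc k)
  have "continuous_on orthant_domain (\<lambda>q. complex_of_real (moment h q))"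
    by (intro continuous_intros continuous_on_moment Suc)
  then have "continuous_on orthant_domain f" by (rule continuous_on_eq) (simp add: Suc.prems(2))
  moreover have "(\<lambda>s. f (p + s *\<^sub>R axis v 1)) differentiable (at 0)" if "p \<in> orthant_domain" for p v
    using moment_partial[OF Suc.prems that] differentiableI_vector by blast
  moreover have "Ck_on k orthant_domain (partial v f)" for v
    by (rule Suc.IH[OF subgauss_mult[OF Suc.prems(1) subgauss_wt]]) (rule partial_moment[OF Suc.prems])
  ultimately show ?case by simp
qed

lemma subgauss_power: "subgauss h \<Longrightarrow> subgauss (\<lambda>t. h t ^ n)"
  by (induction n) (auto intro: subgauss_mult subgauss_const)

lemma subgauss_prod_list: "subgauss (\<lambda>t. prod_list (map (\<lambda>v. wt v t ^ b v) vs))"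
  by (induction vs) (auto intro!: subgauss_const subgauss_mult[OF subgauss_power[OF subgauss_wt]])

lemma partial_power_moment:
  assumes "subgauss h" "\<And>q. q \<in> orthant_domain \<Longrightarrow> f q = complex_of_real (moment h q)" "p \<in> orthant_domain"
  shows "(partial v ^^ n) f p = complex_of_real (moment (\<lambda>t. h t * wt v t ^ n) p)"
  using assms(3)
proof (induction n arbitrary: p)
  case 0
  then show ?case by (simp add: assms(2))
next
  case (Suc n)
  have "partial v ((partial v ^^ n) f) p = complex_of_real (moment (\<lambda>t. h t * wt v t ^ n * wt v t) p)"
    by (rule partial_moment[OF subgauss_mult[OF assms(1) subgauss_power[OF subgauss_wt]] Suc.IH Suc.prems])
  then show ?case by (simp add: mult_ac)
qed

lemma partials_moment:
  assumes "subgauss h" "\<And>q. q \<in> orthant_domain \<Longrightarrow> f q = complex_of_real (moment h q)" "p \<in> orthant_domain"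
  shows "partials b f p = complex_of_real (moment (\<lambda>t. h t * (\<Prod>v\<in>UNIV. wt v t ^ Poly_Mapping.lookup b v)) p)"
proof -
  have "foldr (\<lambda>v. partial v ^^ Poly_Mapping.lookup b v) vs f p =
      complex_of_real (moment (\<lambda>t. h t * prod_list (map (\<lambda>v. wt v t ^ Poly_Mapping.lookup b v) vs)) p)"
    if "p \<in> orthant_domain" for vs p
    using that
  proof (induction vs arbitrary: p)
    case Nil
    then show ?case by (simp add: assms(2))
  next
    case (Cons v vs)
    have "(partial v ^^ Poly_Mapping.lookup b v) (foldr (\<lambda>v. partial v ^^ Poly_Mapping.lookup b v) vs f) p =
        complex_of_real (moment (\<lambda>t. h t * prod_list (map (\<lambda>v. wt v t ^ Poly_Mapping.lookup b v) vs) * wt v t ^ Poly_Mapping.lookup b v) p)"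
      by (rule partial_power_moment[OF subgauss_mult[OF assms(1) subgauss_prod_list] Cons.IH Cons.prems])
    then show ?case by (simp add: mult_ac)
  qed
  from this[OF assms(3), of var_enum] show ?thesis
    unfolding partials_def by (simp add: prod.distinct_set_conv_list[OF var_enum(1), unfolded var_enum(2)])
qed

section \<open>Action of Weyl algebra elements on the integral\<close>

lemma weyl_apply_superset:
  assumes "finite A" "Poly_Mapping.keys (weyl_coeffs P) \<subseteq> A"
  shows "weyl_apply P f p = (\<Sum>m\<in>A. Poly_Mapping.lookup (weyl_coeffs P) m *
    (\<Prod>v\<in>UNIV. complex_of_real (p $ v) ^ Poly_Mapping.lookup (fst m) v) * partials (snd m) f p)"
  unfolding weyl_apply_def split_def prod.collapse using assms
  by (intro sum.mono_neutral_left) (auto simp: in_keys_iff)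

lemma weyl_apply_add: "weyl_apply (P + Q) f p = weyl_apply P f p + weyl_apply Q f p"
proof -
  let ?A = "Poly_Mapping.keys (weyl_coeffs P) \<union> Poly_Mapping.keys (weyl_coeffs Q)"
  have "Poly_Mapping.keys (weyl_coeffs (P + Q)) \<subseteq> ?A"
    unfolding weyl_coeffs_add by (rule keys_add)
  then show ?thesis
    by (simp add: weyl_apply_superset[where A = ?A] sum.distrib[symmetric] weyl_coeffs_add lookup_add distrib_right)
qed

lemma weyl_apply_0: "weyl_apply 0 f p = 0"
  by (simp add: weyl_apply_def weyl_coeffs_0)

lemma weyl_apply_uminus: "weyl_apply (- P) f p = - weyl_apply P f p"
  using weyl_apply_add[of P "- P" f p] by (simp add: weyl_apply_0 eq_neg_iff_add_eq_0 add.commute)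

lemma weyl_apply_diff: "weyl_apply (P - Q) f p = weyl_apply P f p - weyl_apply Q f p"
  using weyl_apply_add[of P "- Q" f p] by (simp add: weyl_apply_uminus)

lemma weyl_apply_sum: "weyl_apply (sum g A) f p = (\<Sum>x\<in>A. weyl_apply (g x) f p)"
  by (induction A rule: infinite_finite_induct) (simp_all add: weyl_apply_0 weyl_apply_add)

lemma weyl_apply_wmon:
  "weyl_apply (wmon (a, b)) f p = (\<Prod>v\<in>UNIV. complex_of_real (p $ v) ^ Poly_Mapping.lookup a v) * partials b f p"
  using weyl_coeffs_scale_monom_add[of 1 "(a, b)" 0]
  by (simp add: weyl_apply_superset[where A = "{(a, b)}"] weyl_coeffs_0)

lemma prod_power_single:
  "(\<Prod>v\<in>UNIV. X v ^ Poly_Mapping.lookup (Poly_Mapping.single u 1) v) = (X u :: 'r::comm_monoid_mult)" for u :: "'v::finite"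
proof -
  have "(\<Prod>v\<in>UNIV. X v ^ Poly_Mapping.lookup (Poly_Mapping.single u 1) v) = (\<Prod>v\<in>UNIV. if v = u then X v else 1)"
    by (rule prod.cong) (auto simp: lookup_single)
  then show ?thesis by simp
qed

lemma prod_power_add:
  "(\<Prod>v\<in>UNIV. X v ^ Poly_Mapping.lookup (a + b) v) =
    (\<Prod>v\<in>UNIV. X v ^ Poly_Mapping.lookup a v) * (\<Prod>v\<in>UNIV. (X v :: 'r::comm_monoid_mult) ^ Poly_Mapping.lookup b v)"
  for a b :: "'v::finite \<Rightarrow>\<^sub>0 nat"
  by (simp add: lookup_add power_add prod.distrib)

lemma weyl_deriv_wmon_0: "weyl_deriv u * wmon (0, b) = wmon (0, b + Poly_Mapping.single u 1)"
  by (simp only: wmon_def fst_conv snd_conv weyl_deriv_monom0)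

text \<open>These are the kinds of normally ordered monomials that occur in the generators.\<close>

lemma weyl_apply_moment:
  fixes u v w :: "'n::finite coord"
  assumes f: "\<And>q. q \<in> orthant_domain \<Longrightarrow> f q = complex_of_real (moment (\<lambda>_. 1) q)" and p: "p \<in> orthant_domain"
  shows "weyl_apply 1 f p = complex_of_real (moment (\<lambda>_. 1) p)"
    "weyl_apply (weyl_deriv u) f p = complex_of_real (moment (wt u) p)"
    "weyl_apply (weyl_deriv u * weyl_deriv v) f p = complex_of_real (moment (\<lambda>t. wt u t * wt v t) p)"
    "weyl_apply (weyl_var w * weyl_deriv u) f p = complex_of_real (p $ w * moment (wt u) p)"
    "weyl_apply (weyl_var w * weyl_deriv u * weyl_deriv v) f p = complex_of_real (p $ w * moment (\<lambda>t. wt u t * wt v t) p)"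
proof -
  have pm: "partials b f p = complex_of_real (moment (\<lambda>t. \<Prod>v\<in>UNIV. wt v t ^ Poly_Mapping.lookup b v) p)" for b
    using partials_moment[of "\<lambda>_. 1" f p b] f p by (simp add: subgauss_const)
  have d1: "weyl_deriv u = wmon (0, Poly_Mapping.single u 1)" for u :: "'n coord"
    using weyl_deriv_wmon_0[of u 0] by (simp add: wmon_0)
  have d2: "weyl_deriv u * weyl_deriv v = wmon (0, Poly_Mapping.single v 1 + Poly_Mapping.single u 1)"
    using weyl_deriv_wmon_0[of u "Poly_Mapping.single v 1"] by (simp only: d1[of v])
  have x1: "weyl_var w * weyl_deriv u = wmon (Poly_Mapping.single w 1, Poly_Mapping.single u 1)"
    unfolding d1 weyl_var_wmon by simp
  have x2: "weyl_var w * weyl_deriv u * weyl_deriv v = wmon (Poly_Mapping.single w 1, Poly_Mapping.single v 1 + Poly_Mapping.single u 1)"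
    unfolding mult.assoc d2 weyl_var_wmon by simp
  show "weyl_apply 1 f p = complex_of_real (moment (\<lambda>_. 1) p)"
    unfolding wmon_0[symmetric] weyl_apply_wmon pm by simp
  show "weyl_apply (weyl_deriv u) f p = complex_of_real (moment (wt u) p)"
    unfolding d1 weyl_apply_wmon pm prod_power_single by simp
  show "weyl_apply (weyl_deriv u * weyl_deriv v) f p = complex_of_real (moment (\<lambda>t. wt u t * wt v t) p)"
    unfolding d2 weyl_apply_wmon pm prod_power_single prod_power_add by (simp add: mult.commute)
  show "weyl_apply (weyl_var w * weyl_deriv u) f p = complex_of_real (p $ w * moment (wt u) p)"
    unfolding x1 weyl_apply_wmon pm prod_power_single by simp
  show "weyl_apply (weyl_var w * weyl_deriv u * weyl_deriv v) f p = complex_of_real (p $ w * moment (\<lambda>t. wt u t * wt v t) p)"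
    unfolding x2 weyl_apply_wmon pm prod_power_single prod_power_add by (simp add: mult.commute)
qed

section \<open>Scaling of one coordinate and the Euler relation\<close>

definition scale_coord :: "'n::finite \<Rightarrow> real \<Rightarrow> real^'n \<Rightarrow> real^'n" where
  "scale_coord i l t = (\<chi> k. (if k = i then l else 1) * t $ k)"

text \<open>The exponent of \<open>t\<^sub>i\<close> in the monomial \<open>wt v t\<close>.\<close>

fun mult_of :: "'n \<Rightarrow> ('n::finite) coord \<Rightarrow> nat" where
  "mult_of i (Inl u) = (if u = Upair i i then 2 else if i \<in> set_uprod u then 1 else 0)"
| "mult_of i (Inr j) = (if j = i then 1 else 0)"

text \<open>The dual action on the parameters: each coordinate has weight \<open>mult_of\<close>, so
  that scaling \<open>t\<close> in the phase equals scaling the parameters.\<close>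

definition scale_param :: "'n::finite \<Rightarrow> real \<Rightarrow> real^'n coord \<Rightarrow> real^'n coord" where
  "scale_param i l p = (\<chi> v. l ^ mult_of i v * p $ v)"

lemma wt_scale_coord: "wt v (scale_coord i l t) = l ^ mult_of i v * wt v t"
proof (cases v)
  case (Inl u)
  obtain j k where "u = Upair j k" by (cases u)
  then show ?thesis using Inl by (auto simp: quad_Upair scale_coord_def power2_eq_square algebra_simps)
qed (simp add: scale_coord_def)

lemma phase_scale: "phase p (scale_coord i l t) = phase (scale_param i l p) t"
  by (simp add: phase_def scale_param_def wt_scale_coord mult_ac)

text \<open>Euler's identity for the phase in the variable \<open>t $ i\<close>. Diagonal weights
  have exponent 2, off-diagonal ones have exponent 1 but a factor 2 from \<open>wt\<close>, so all
  products receive the same factor 2.\<close>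

lemma sum_mult_of_wt:
  "(\<Sum>v\<in>UNIV. real (mult_of i v) * p $ v * wt v t) =
    2 * (\<Sum>k\<in>UNIV. p $ Inl (Upair i k) * (t $ i * t $ k)) + p $ Inr i * t $ i"
proof -
  have "(\<Sum>u\<in>UNIV. real (mult_of i (Inl u)) * p $ Inl u * wt (Inl u) t) =
      (\<Sum>j\<in>UNIV. \<Sum>k\<in>UNIV. (real (mult_of i (Inl (Upair j k))) * p $ Inl (Upair j k)) * (t $ j * t $ k))"
    using sum_quad[of "\<lambda>u. real (mult_of i (Inl u)) * p $ Inl u" "\<lambda>j k. t $ j * t $ k"] by (simp add: quad_def)
  also have "\<dots> = (\<Sum>j\<in>UNIV. \<Sum>k\<in>UNIV.
      (if j = i then p $ Inl (Upair i k) * (t $ i * t $ k) else 0) + (if k = i then p $ Inl (Upair i j) * (t $ i * t $ j) else 0))"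
  proof (intro sum.cong refl)
    fix j k :: 'a
    have "p $ Inl (Upair j i) = p $ Inl (Upair i j)"
      by (rule arg_cong[where f = "\<lambda>u. p $ Inl u"]) simp
    then show "real (mult_of i (Inl (Upair j k))) * p $ Inl (Upair j k) * (t $ j * t $ k) =
      (if j = i then p $ Inl (Upair i k) * (t $ i * t $ k) else 0) + (if k = i then p $ Inl (Upair i j) * (t $ i * t $ j) else 0)"
      by (cases "j = i"; cases "k = i") (auto simp: mult_ac)
  qed
  also have "\<dots> = 2 * (\<Sum>k\<in>UNIV. p $ Inl (Upair i k) * (t $ i * t $ k))"
    by (simp add: sum.distrib sum_if_const)
  finally show ?thesis
    unfolding sum_coord by (simp add: if_distrib[where f = real] if_distrib[where f = "\<lambda>x. x * _"] cong: if_cong)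
qed

text \<open>Substitution by a diagonal linear map with determinant \<open>l\<close>; it preserves
  the orthant because \<open>l\<close> is positive, and \<open>phase_scale\<close> moves the scaling
  into the parameters.\<close>

lemma moment_scale:
  assumes "l > 0"
  shows "moment (\<lambda>_. 1) p = l * moment (\<lambda>_. 1) (scale_param i l p)"
proof -
  \<comment> \<open>The scaling of the axis \<open>i\<close> is written as a diagonal affine map
    along \<open>Basis\<close> with zero translation, the form that
    \<open>lborel_affine_euclidean\<close> expects.\<close>
  define c where "c = (\<lambda>b :: real^'a. if b = axis i 1 then l else 1)"
  define T where "T = (\<lambda>x :: real^'a. 0 + (\<Sum>b\<in>Basis. (c b * (x \<bullet> b)) *\<^sub>R b))"
  define F where "F = (\<lambda>t :: real^'a. indicator orthant t * exp (phase p t) :: real)"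
  have Bas: "(Basis :: (real^'a) set) = (\<lambda>k. axis k 1) ` UNIV"
    by (auto simp: Basis_vec_def)
  have inj: "inj (\<lambda>k :: 'a. axis k (1 :: real))" by (auto simp: inj_def axis_eq_axis)
  have T: "T x = scale_coord i l x" for x
  proof -
    have "T x = (\<Sum>k\<in>UNIV. ((if k = i then l else 1) * x $ k) *\<^sub>R axis k 1)"
      unfolding T_def Bas by (simp add: sum.reindex[OF inj] c_def axis_eq_axis inner_axis)
    also have "\<dots> = scale_coord i l x"
      by (simp add: scale_coord_def vec_eq_iff axis_def if_distrib[where f = "\<lambda>y. _ * y"] cong: if_cong)
    finally show ?thesis .
  qed
  have prodc: "(\<Prod>b\<in>Basis. \<bar>c b\<bar>) = l"
  proof -
    have "(\<Prod>b\<in>Basis. \<bar>c b\<bar>) = (\<Prod>k\<in>UNIV. if k = i then l else 1)"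
      unfolding Bas using assms by (simp add: prod.reindex[OF inj] c_def axis_eq_axis if_distrib[where f = abs] cong: if_cong)
    then show ?thesis by simp
  qed
  have [measurable]: "T \<in> borel_measurable borel" unfolding T_def by simp
  have [measurable]: "F \<in> borel_measurable borel" unfolding F_def by simp
  have lb: "lborel = density (distr lborel borel T) (\<lambda>_. ennreal (\<Prod>b\<in>Basis. \<bar>c b\<bar>))"
    unfolding T_def using assms by (intro lborel_affine_euclidean) (auto simp: c_def)
  have "moment (\<lambda>_. 1) p = integral\<^sup>L lborel F" by (simp add: moment_def F_def)
  also have "\<dots> = (\<integral>t. F t \<partial>density (distr lborel borel T) (\<lambda>_. ennreal l))"
    using lb prodc by simp
  also have "\<dots> = (\<integral>t. l *\<^sub>R F t \<partial>distr lborel borel T)"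
    using assms by (intro integral_density) auto
  also have "\<dots> = (\<integral>t. l *\<^sub>R F (T t) \<partial>lborel)"
    by (rule integral_distr) auto
  also have "\<dots> = l * (\<integral>t. F (T t) \<partial>lborel)" by simp
  also have "(\<integral>t. F (T t) \<partial>lborel) = moment (\<lambda>_. 1) (scale_param i l p)"
  proof -
    have "0 \<le> (if k = i then l else 1) * x \<longleftrightarrow> 0 \<le> x" for k x
      using assms by (simp add: zero_le_mult_iff)
    then have "scale_coord i l t \<in> orthant \<longleftrightarrow> t \<in> orthant" for t
      by (simp add: orthant_def scale_coord_def)
    then show ?thesis
      unfolding moment_def F_def T phase_scale by (simp add: indicator_def)
  qed
  finally show ?thesis .
qed

text \<open>The scaled integral is differentiated at \<open>l = 1\<close> in two ways: the chain
  rule gives a weighted sum of first moments, and the form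
  \<open>moment (\<lambda>_. 1) p / l\<close> from \<open>moment_scale\<close> gives minus the
  integral.\<close>

lemma moment_euler:
  assumes p: "p \<in> orthant_domain"
  shows "2 * (\<Sum>k\<in>UNIV. p $ Inl (Upair i k) * moment (\<lambda>t. t $ i * t $ k) p) + p $ Inr i * moment (\<lambda>t. t $ i) p + moment (\<lambda>_. 1) p = 0"
proof -
  let ?S = "\<Sum>v\<in>UNIV. real (mult_of i v) * p $ v * moment (wt v) p"
  have at1: "scale_param i 1 p = p" by (simp add: scale_param_def vec_eq_iff)
  have "((\<lambda>l. scale_param i l p) has_derivative (\<lambda>s. \<chi> v. s * (real (mult_of i v) * p $ v))) (at 1)"
    unfolding scale_param_def
    by (subst has_derivative_componentwise_within) (auto intro!: derivative_eq_intros simp: Basis_vec_def inner_axis)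
  then have "((\<lambda>l. moment (\<lambda>_. 1) (scale_param i l p)) has_derivative
      (\<lambda>s. \<Sum>v\<in>UNIV. (\<chi> v. s * (real (mult_of i v) * p $ v)) $ v * moment (\<lambda>t. 1 * wt v t) p)) (at 1)"
    by (rule has_derivative_compose) (use moment_has_derivative[OF subgauss_const p, of 1] in \<open>simp add: at1\<close>)
  then have 1: "((\<lambda>l. moment (\<lambda>_. 1) (scale_param i l p)) has_real_derivative ?S) (at 1)"
    by (rule has_derivative_imp_has_field_derivative) (simp add: sum_distrib_left mult_ac)
  have 2: "((\<lambda>l. moment (\<lambda>_. 1) p / l) has_real_derivative - moment (\<lambda>_. 1) p) (at 1)"
    by (auto intro!: derivative_eq_intros)
  have "((\<lambda>l. moment (\<lambda>_. 1) (scale_param i l p)) has_real_derivative - moment (\<lambda>_. 1) p) (at 1)"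
  proof (rule has_field_derivative_transform_within_open[OF 2])
    show "open {0 :: real<..}" "(1 :: real) \<in> {0<..}" by auto
    fix l :: real assume "l \<in> {0<..}"
    then show "moment (\<lambda>_. 1) p / l = moment (\<lambda>_. 1) (scale_param i l p)"
      using moment_scale[of l p i] by simp
  qed
  with 1 have "?S = - moment (\<lambda>_. 1) p" by (rule DERIV_unique)
  moreover have "?S = 2 * (\<Sum>k\<in>UNIV. p $ Inl (Upair i k) * moment (\<lambda>t. t $ i * t $ k) p) + p $ Inr i * moment (\<lambda>t. t $ i) p"
  proof -
    have sg: "subgauss (\<lambda>t. t $ k)" for k :: 'a using subgauss_wt[of "Inr k"] by (simp add: wt.simps(2)[abs_def])
    have sgm: "subgauss (\<lambda>t. a * h t)" if "subgauss h" for a and h :: "real^'a \<Rightarrow> real"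
      using subgauss_mult[OF subgauss_const that] .
    have "?S = moment (\<lambda>t. \<Sum>v\<in>UNIV. (real (mult_of i v) * p $ v) * wt v t) p"
      by (simp add: moment_sum[OF _ p] sgm subgauss_wt moment_cmult)
    also have "\<dots> = moment (\<lambda>t. 2 * (\<Sum>k\<in>UNIV. p $ Inl (Upair i k) * (t $ i * t $ k)) + p $ Inr i * t $ i) p"
      unfolding sum_mult_of_wt ..
    also have "\<dots> = 2 * (\<Sum>k\<in>UNIV. p $ Inl (Upair i k) * moment (\<lambda>t. t $ i * t $ k) p) + p $ Inr i * moment (\<lambda>t. t $ i) p"
      by (simp add: moment_add[OF _ _ p] moment_sum[OF _ p] moment_cmult subgauss_sum subgauss_mult sg sgm)
    finally show ?thesis .
  qed
  ultimately show ?thesis by simp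
qed

text \<open>The first family is \<open>moment_euler\<close>. In the other two, the derivative in an
  x-coordinate and the given multiple of the second derivative in y bring down the same factor from
  the exponential.\<close>

lemma orthant_operators_annihilate:
  assumes P: "P \<in> (orthant_operators :: ('n::finite) coord weyl set)"
  shows "annihilates_on orthant_domain P (\<lambda>p. complex_of_real (orthant_integral (x_part p) (y_part p)))"
  unfolding annihilates_on_def
proof
  let ?f = "\<lambda>p :: real^'n coord. complex_of_real (orthant_integral (x_part p) (y_part p))"
  have f: "?f q = complex_of_real (moment (\<lambda>_. 1) q)" for q
    by (simp add: orthant_integral_eq)
  show "smooth_on orthant_domain ?f"
    unfolding smooth_on_def using open_orthant_domain Ck_on_moment[OF subgauss_const f] by blast
  show "\<forall>p\<in>orthant_domain. weyl_apply P ?f p = 0"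
  proof
    fix p :: "real^'n coord" assume p: "p \<in> orthant_domain"
    note app = weyl_apply_moment[OF f p]
    have two: "2 * Q = Q + Q" for Q :: "'n coord weyl" by (rule mult_2)
    from P have "(\<exists>i. P = 2 * (\<Sum>k\<in>UNIV. x_var i k * dy i * dy k) + y_var i * dy i + 1) \<or>
        (\<exists>i j. P = dx i j - 2 * dy i * dy j \<and> i \<noteq> j) \<or> (\<exists>i. P = dx i i - dy i ^ 2)"
      unfolding orthant_operators_def by (simp only: Un_iff mem_Collect_eq simp_thms disj_assoc)
    then show "weyl_apply P ?f p = 0"
    proof (elim disjE exE conjE)
      fix i assume 1: "P = 2 * (\<Sum>k\<in>UNIV. x_var i k * dy i * dy k) + y_var i * dy i + 1"
      have "weyl_apply P ?f p = complex_of_real (2 * (\<Sum>k\<in>UNIV. p $ Inl (Upair i k) * moment (\<lambda>t. t $ i * t $ k) p) +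
          p $ Inr i * moment (\<lambda>t. t $ i) p + moment (\<lambda>_. 1) p)"
        by (simp add: 1 two weyl_apply_add weyl_apply_sum app wt.simps(2)[abs_def])
      then show "weyl_apply P ?f p = 0" using moment_euler[OF p, of i] by simp
    next
      fix i j :: 'n assume 2: "P = dx i j - 2 * dy i * dy j" "i \<noteq> j"
      have "moment (wt (Inl (Upair i j))) p = moment (\<lambda>t. 2 * (t $ i * t $ j)) p"
        unfolding wt.simps(1)[abs_def] quad_Upair using 2 by (simp add: mult.commute)
      then show "weyl_apply P ?f p = 0"
        by (simp add: 2 two distrib_right weyl_apply_diff weyl_apply_add app moment_cmult)
    next
      fix i assume 3: "P = dx i i - dy i ^ 2"
      show "weyl_apply P ?f p = 0"
        by (simp add: 3 power2_eq_square weyl_apply_diff app wt.simps(1)[abs_def] quad_Upair)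
    qed
  qed
qed

theorem theorem7:
  shows "(\<forall>P \<in> (orthant_operators :: ('n::finite) coord weyl set).
           annihilates_on orthant_domain P
             (\<lambda>p. complex_of_real (orthant_integral (x_part p) (y_part p)))) \<and>
         holonomic_ideal (left_ideal hull (orthant_operators :: 'n coord weyl set))"
  using orthant_operators_annihilate holonomic_orthant_ideal[unfolded orthant_ideal_def] by blast

end
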